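(* Let $\mathsf B$ be a semi-abelian category, let $$E=(f,k):\ B\xrightarrow{\,k\,}E\xrightarrow{\,f\,}C,\qquad E'=(f',k'):\ B'\xrightarrow{\,k'\,}E'\xrightarrow{\,f'\,}C'$$ be two abelian extensions in $\mathsf B$, with induced abelian actions $\xi$ (of $C$ on $B$) and $\xi'$ (of $C'$ on $B'$), and let $(\varphi_0,\varphi_1)\colon\xi\to\xi'$ be a morphism of abelian actions. Then: (i) There exist morphisms of extensions $E\to E'$ which induce $(\varphi_0,\varphi_1)$ if and only if $\varphi_0^*E'\cong\varphi_{1*}E$ in the groupoid $\mathsf{OPEXT}(\mathsf B)(C,B',\varphi_0^*\xi')$. (ii) In this case, the set $\mathsf{OPEXT}(\mathsf B)_{(\varphi_0,\varphi_1)}(E,E')$ of morphisms of extensions $E\to E'$ inducing $(\varphi_0,\varphi_1)$ is a simply transitive $\pi_1\big(\mathsf{OPEXT}(\mathsf B)(C,B',\varphi_0^*\xi')\big)$-set.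
   Context: For objects $C,B$ of a semi-abelian category $\mathsf B$, $C\flat B$ denotes the kernel of $[1,0]\colon C+B\to C$; $C\flat(-)$ is a monad and an internal action of $C$ on $B$ is an algebra structure $\xi\colon C\flat B\to B$. Internal actions of $C$ are equivalent to split extensions over $C$; the split extension associated with $\xi$ is $B\to B\rtimes_\xi C\rightleftarrows C$. An abelian action is an internal action $\xi$ whose associated split epimorphism $B\rtimes_\xi C\to C$ carries an internal abelian group structure in the slice category $\mathsf B/C$ with unit the given section (i.e. is a Beck $C$-module). A morphism of abelian actions $(\varphi_0,\varphi_1)\colon\xi\to\xi'$ is a pair of arrows $\varphi_0\colon C\to C'$, $\varphi_1\colon B\to B'$ with $\varphi_1\cdot\xi=\xi'\cdot(\varphi_0\flat\varphi_1)$. $\mathsf{Mod}(\mathsf B)$ is the category of abelian actions. An extension is a short exact sequence $B\xrightarrow{k}E\xrightarrow{f}C$ in $\mathsf B$. It is abelian if $f$, as an object of $\mathsf B/C$, admits an internal autonomous Mal'tsev operation (equivalently, the kernel pair of $f$ is an abelian equivalence relation). The induced abelian action $\xi\colon C\flat B\to B$ is the unique one with $\xi\cdot(f\flat 1_B)=\chi$, where $\chi\colon E\flat B\to B$ is the conjugation action of $E$ on its normal subobject $B$. A morphism of extensions is a morphism of short exact sequences; it induces the pair formed by its components on $C$ and on $B$. $\mathsf{OPEXT}(\mathsf B)$ is the category of abelian extensions. For an abelian action $\xi$ of $C$ on $B$, $\mathsf{OPEXT}(\mathsf B)(C,B,\xi)$ is the category of abelian extensions of $C$ by $B$ inducing $\xi$,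 with morphisms those that are the identity on $B$ and $C$; it is a groupoid. $\varphi_0^*\xi'=\xi'\cdot(\varphi_0\flat 1_{B'})$ is the pulled back action of $C$ on $B'$. $\varphi_0^*E'$ is the extension of $C$ by $B'$ obtained by pulling back $f'$ along $\varphi_0$; it lies in $\mathsf{OPEXT}(\mathsf B)(C,B',\varphi_0^*\xi')$. $\varphi_{1*}E$ is the push forward of $E$ along $\varphi_1$, i.e. the codomain of an opcartesian lifting at $E$ of the morphism $(1_C,\varphi_1)\colon(C,B,\xi)\to(C,B',\varphi_0^*\xi')$ for the functor from abelian extensions of $C$ (with morphisms that are the identity on $C$) to abelian actions of $C$; it lies in $\mathsf{OPEXT}(\mathsf B)(C,B',\varphi_0^*\xi')$. The groupoid $\mathsf{OPEXT}(\mathsf B)(C,B,\xi)$ is a symmetric categorical group under the Baer sum, with identity object the semidirect product extension $B\to B\rtimes_\xi C\to C$; $\pi_1(\mathsf{OPEXT}(\mathsf B)(C,B,\xi))$ denotes the abelian group of automorphisms of this identity object in the groupoid. A simply transitive $\Gamma$-set is a set on which the group $\Gamma$ acts so that for any two elements exactly one group element carries the first to the second. *)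

theory Defs
  imports "HOL-Algebra.Group_Action"
begin

text \<open>Categories with a set of objects and a set of arrows. Arrows of type \<open>'a\<close> carry their
  domain and codomain; \<open>g \<cdot> f\<close> (first \<open>f\<close>, then \<open>g\<close>) is meaningful only when
  \<open>Cod f = Dom g\<close>.\<close>

record ('o, 'a) cat =
  Obj :: "'o set"
  Arr :: "'a set"
  Dom :: "'a \<Rightarrow> 'o"
  Cod :: "'a \<Rightarrow> 'o"
  Ide :: "'o \<Rightarrow> 'a"
  Comp :: "'a \<Rightarrow> 'a \<Rightarrow> 'a"  (infixr "\<cdot>\<index>" 70)

section \<open>Limits, colimits and classes of arrows\<close>

context
  fixes \<B> :: "('o, 'a) cat" (structure)
begin

definition Hom :: "'o \<Rightarrow> 'o \<Rightarrow> 'a set" where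
  "Hom X Y = {f \<in> Arr \<B>. Dom \<B> f = X \<and> Cod \<B> f = Y}"

definition is_iso :: "'a \<Rightarrow> bool" where
  "is_iso f \<longleftrightarrow> f \<in> Arr \<B> \<and> (\<exists>g \<in> Hom (Cod \<B> f) (Dom \<B> f).
     g \<cdot> f = Ide \<B> (Dom \<B> f) \<and> f \<cdot> g = Ide \<B> (Cod \<B> f))"

definition is_terminal :: "'o \<Rightarrow> bool" where
  "is_terminal Z \<longleftrightarrow> Z \<in> Obj \<B> \<and> (\<forall>X \<in> Obj \<B>. \<exists>!f. f \<in> Hom X Z)"

definition is_initial :: "'o \<Rightarrow> bool" where
  "is_initial Z \<longleftrightarrow> Z \<in> Obj \<B> \<and> (\<forall>X \<in> Obj \<B>. \<exists>!f. f \<in> Hom Z X)"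

definition is_zero_obj :: "'o \<Rightarrow> bool" where
  "is_zero_obj Z \<longleftrightarrow> is_initial Z \<and> is_terminal Z"

definition zero :: "'o \<Rightarrow> 'o \<Rightarrow> 'a" where
  "zero X Y = (THE f. \<exists>Z a b. is_zero_obj Z \<and> a \<in> Hom X Z \<and> b \<in> Hom Z Y \<and> f = b \<cdot> a)"

definition is_pullback :: "'a \<Rightarrow> 'a \<Rightarrow> 'a \<Rightarrow> 'a \<Rightarrow> bool" where
  "is_pullback f g p q \<longleftrightarrow>
     f \<in> Arr \<B> \<and> g \<in> Arr \<B> \<and> Cod \<B> f = Cod \<B> g \<and>
     p \<in> Hom (Dom \<B> p) (Dom \<B> f) \<and> q \<in> Hom (Dom \<B> p) (Dom \<B> g) \<and> f \<cdot> p = g \<cdot> q \<and>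
     (\<forall>T x y. x \<in> Hom T (Dom \<B> f) \<and> y \<in> Hom T (Dom \<B> g) \<and> f \<cdot> x = g \<cdot> y \<longrightarrow>
        (\<exists>!t. t \<in> Hom T (Dom \<B> p) \<and> p \<cdot> t = x \<and> q \<cdot> t = y))"

definition is_coproduct :: "'o \<Rightarrow> 'o \<Rightarrow> 'a \<Rightarrow> 'a \<Rightarrow> bool" where
  "is_coproduct X Y i j \<longleftrightarrow>
     i \<in> Hom X (Cod \<B> i) \<and> j \<in> Hom Y (Cod \<B> i) \<and>
     (\<forall>T x y. x \<in> Hom X T \<and> y \<in> Hom Y T \<longrightarrow>
        (\<exists>!t. t \<in> Hom (Cod \<B> i) T \<and> t \<cdot> i = x \<and> t \<cdot> j = y))"

definition is_coequalizer :: "'a \<Rightarrow> 'a \<Rightarrow> 'a \<Rightarrow> bool" where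
  "is_coequalizer a b q \<longleftrightarrow>
     a \<in> Arr \<B> \<and> b \<in> Hom (Dom \<B> a) (Cod \<B> a) \<and>
     q \<in> Hom (Cod \<B> a) (Cod \<B> q) \<and> q \<cdot> a = q \<cdot> b \<and>
     (\<forall>T x. x \<in> Hom (Cod \<B> a) T \<and> x \<cdot> a = x \<cdot> b \<longrightarrow>
        (\<exists>!t. t \<in> Hom (Cod \<B> q) T \<and> t \<cdot> q = x))"

definition is_kernel :: "'a \<Rightarrow> 'a \<Rightarrow> bool" where
  "is_kernel k f \<longleftrightarrow>
     f \<in> Arr \<B> \<and> k \<in> Hom (Dom \<B> k) (Dom \<B> f) \<and> f \<cdot> k = zero (Dom \<B> k) (Cod \<B> f) \<and>
     (\<forall>T x. x \<in> Hom T (Dom \<B> f) \<and> f \<cdot> x = zero T (Cod \<B> f) \<longrightarrow>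
        (\<exists>!t. t \<in> Hom T (Dom \<B> k) \<and> k \<cdot> t = x))"

definition is_cokernel :: "'a \<Rightarrow> 'a \<Rightarrow> bool" where
  "is_cokernel f k \<longleftrightarrow>
     k \<in> Arr \<B> \<and> f \<in> Hom (Cod \<B> k) (Cod \<B> f) \<and> f \<cdot> k = zero (Dom \<B> k) (Cod \<B> f) \<and>
     (\<forall>T x. x \<in> Hom (Cod \<B> k) T \<and> x \<cdot> k = zero (Dom \<B> k) T \<longrightarrow>
        (\<exists>!t. t \<in> Hom (Cod \<B> f) T \<and> t \<cdot> f = x))"

definition is_regular_epi :: "'a \<Rightarrow> bool" where
  "is_regular_epi q \<longleftrightarrow> (\<exists>a b. is_coequalizer a b q)"

text \<open>An internal equivalence relation \<open>(a, b) : R \<rightarrow> X \<times> X\<close>: it is jointly monic and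
  represents an equivalence relation on each set of generalised elements of \<open>X\<close>.\<close>

definition is_equivalence_relation :: "'a \<Rightarrow> 'a \<Rightarrow> bool" where
  "is_equivalence_relation a b \<longleftrightarrow>
     a \<in> Arr \<B> \<and> b \<in> Hom (Dom \<B> a) (Cod \<B> a) \<and>
     (\<forall>T \<in> Obj \<B>.
        inj_on (\<lambda>t. (a \<cdot> t, b \<cdot> t)) (Hom T (Dom \<B> a)) \<and>
        equiv (Hom T (Cod \<B> a)) ((\<lambda>t. (a \<cdot> t, b \<cdot> t)) ` Hom T (Dom \<B> a)))"

definition is_point :: "'a \<Rightarrow> 'a \<Rightarrow> bool" where
  "is_point f s \<longleftrightarrow>
     f \<in> Arr \<B> \<and> s \<in> Hom (Cod \<B> f) (Dom \<B> f) \<and> f \<cdot> s = Ide \<B> (Cod \<B> f)"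

end

section \<open>Semi-abelian categories\<close>

locale category =
  fixes \<B> :: "('o, 'a) cat" (structure)
  assumes Dom_Obj: "f \<in> Arr \<B> \<Longrightarrow> Dom \<B> f \<in> Obj \<B>"
    and Cod_Obj: "f \<in> Arr \<B> \<Longrightarrow> Cod \<B> f \<in> Obj \<B>"
    and Ide_Hom: "X \<in> Obj \<B> \<Longrightarrow> Ide \<B> X \<in> Hom \<B> X X"
    and Comp_Hom: "f \<in> Hom \<B> X Y \<Longrightarrow> g \<in> Hom \<B> Y Z \<Longrightarrow> g \<cdot> f \<in> Hom \<B> X Z"
    and Comp_assoc: "f \<in> Hom \<B> W X \<Longrightarrow> g \<in> Hom \<B> X Y \<Longrightarrow> h \<in> Hom \<B> Y Z \<Longrightarrow>
       (h \<cdot> g) \<cdot> f = h \<cdot> (g \<cdot> f)"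
    and Ide_left: "f \<in> Hom \<B> X Y \<Longrightarrow> Ide \<B> Y \<cdot> f = f"
    and Ide_right: "f \<in> Hom \<B> X Y \<Longrightarrow> f \<cdot> Ide \<B> X = f"

text \<open>Pointed, Barr exact, Bourn protomodular, with binary coproducts. Finite completeness is
  expressed by the zero object together with pullbacks. Protomodularity is Bourn's condition that
  the change-of-base functors of the fibration of points reflect isomorphisms; \<open>g\<close> is the image
  of the morphism of points \<open>h : (f, s) \<rightarrow> (f', s')\<close> under change of base along \<open>v\<close>.\<close>

locale semi_abelian = category +
  assumes pointed: "\<exists>Z. is_zero_obj \<B> Z"
    and pullbacks: "f \<in> Arr \<B> \<Longrightarrow> g \<in> Arr \<B> \<Longrightarrow> Cod \<B> f = Cod \<B> g \<Longrightarrow>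
       \<exists>p q. is_pullback \<B> f g p q"
    and kernel_pair_coequalizers: "is_pullback \<B> f f p q \<Longrightarrow> \<exists>e. is_coequalizer \<B> p q e"
    and regular_epi_stable: "is_pullback \<B> f g p q \<Longrightarrow> is_regular_epi \<B> f \<Longrightarrow> is_regular_epi \<B> q"
    and effective: "is_equivalence_relation \<B> a b \<Longrightarrow> \<exists>f. is_pullback \<B> f f a b"
    and protomodular: "\<lbrakk> is_point \<B> f s; is_point \<B> f' s'; Cod \<B> f = Cod \<B> f';
       h \<in> Hom \<B> (Dom \<B> f) (Dom \<B> f'); f' \<cdot> h = f; h \<cdot> s = s';
       is_pullback \<B> f v p q; is_pullback \<B> f' v p' q';
       g \<in> Hom \<B> (Dom \<B> p) (Dom \<B> p'); p' \<cdot> g = h \<cdot> p; q' \<cdot> g = q; is_iso \<B> g \<rbrakk>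
       \<Longrightarrow> is_iso \<B> h"
    and coproducts: "X \<in> Obj \<B> \<Longrightarrow> Y \<in> Obj \<B> \<Longrightarrow> \<exists>i j. is_coproduct \<B> X Y i j"

context
  fixes \<B> :: "('o, 'a) cat" (structure)
begin

section \<open>Chosen limits and colimits\<close>

definition inl :: "'o \<Rightarrow> 'o \<Rightarrow> 'a" where
  "inl X Y = fst (SOME (i, j). is_coproduct \<B> X Y i j)"

definition inr :: "'o \<Rightarrow> 'o \<Rightarrow> 'a" where
  "inr X Y = snd (SOME (i, j). is_coproduct \<B> X Y i j)"

definition copair :: "'a \<Rightarrow> 'a \<Rightarrow> 'a" where
  "copair x y = (THE t. t \<in> Hom \<B> (Cod \<B> (inl (Dom \<B> x) (Dom \<B> y))) (Cod \<B> x) \<and>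
     t \<cdot> inl (Dom \<B> x) (Dom \<B> y) = x \<and> t \<cdot> inr (Dom \<B> x) (Dom \<B> y) = y)"

definition pb1 :: "'a \<Rightarrow> 'a \<Rightarrow> 'a" where
  "pb1 f g = fst (SOME (p, q). is_pullback \<B> f g p q)"

definition pb2 :: "'a \<Rightarrow> 'a \<Rightarrow> 'a" where
  "pb2 f g = snd (SOME (p, q). is_pullback \<B> f g p q)"

definition pbpair :: "'a \<Rightarrow> 'a \<Rightarrow> 'a \<Rightarrow> 'a \<Rightarrow> 'a" where
  "pbpair f g x y = (THE t. t \<in> Hom \<B> (Dom \<B> x) (Dom \<B> (pb1 f g)) \<and>
     pb1 f g \<cdot> t = x \<and> pb2 f g \<cdot> t = y)"

section \<open>Internal actions and split extensions\<close>

definition kappa :: "'o \<Rightarrow> 'o \<Rightarrow> 'a" where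
  "kappa C B = (SOME k. is_kernel \<B> k (copair (Ide \<B> C) (zero \<B> B C)))"

definition flat :: "'o \<Rightarrow> 'o \<Rightarrow> 'o"  (infixr "\<flat>" 75) where
  "C \<flat> B = Dom \<B> (kappa C B)"

text \<open>The arrow \<open>\<phi>\<^sub>0 \<flat> \<phi>\<^sub>1\<close>, a restriction of \<open>\<phi>\<^sub>0 + \<phi>\<^sub>1\<close>.\<close>

definition flat_map :: "'a \<Rightarrow> 'a \<Rightarrow> 'a"  (infixr "\<flat>\<^sub>m" 75) where
  "\<phi>\<^sub>0 \<flat>\<^sub>m \<phi>\<^sub>1 = (THE t.
     t \<in> Hom \<B> (Dom \<B> \<phi>\<^sub>0 \<flat> Dom \<B> \<phi>\<^sub>1) (Cod \<B> \<phi>\<^sub>0 \<flat> Cod \<B> \<phi>\<^sub>1) \<and>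
     kappa (Cod \<B> \<phi>\<^sub>0) (Cod \<B> \<phi>\<^sub>1) \<cdot> t =
       copair (inl (Cod \<B> \<phi>\<^sub>0) (Cod \<B> \<phi>\<^sub>1) \<cdot> \<phi>\<^sub>0) (inr (Cod \<B> \<phi>\<^sub>0) (Cod \<B> \<phi>\<^sub>1) \<cdot> \<phi>\<^sub>1)
         \<cdot> kappa (Dom \<B> \<phi>\<^sub>0) (Dom \<B> \<phi>\<^sub>1))"

definition flat_unit :: "'o \<Rightarrow> 'o \<Rightarrow> 'a" where
  "flat_unit C B = (THE t. t \<in> Hom \<B> B (C \<flat> B) \<and> kappa C B \<cdot> t = inr C B)"

definition flat_mult :: "'o \<Rightarrow> 'o \<Rightarrow> 'a" where
  "flat_mult C B = (THE t. t \<in> Hom \<B> (C \<flat> C \<flat> B) (C \<flat> B) \<and>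
     kappa C B \<cdot> t = copair (inl C B) (kappa C B) \<cdot> kappa C (C \<flat> B))"

definition internal_action :: "'o \<Rightarrow> 'o \<Rightarrow> 'a \<Rightarrow> bool" where
  "internal_action C B \<xi> \<longleftrightarrow>
     C \<in> Obj \<B> \<and> B \<in> Obj \<B> \<and> \<xi> \<in> Hom \<B> (C \<flat> B) B \<and>
     \<xi> \<cdot> flat_unit C B = Ide \<B> B \<and> \<xi> \<cdot> flat_mult C B = \<xi> \<cdot> (Ide \<B> C \<flat>\<^sub>m \<xi>)"

text \<open>The split extension \<open>B \<rightarrow> X \<rightleftarrows> C\<close> with kernel \<open>k\<close>, projection \<open>f\<close> and section \<open>s\<close> is
  associated with \<open>\<xi>\<close> when \<open>\<xi>\<close> is the restriction of \<open>[s, k] : C + B \<rightarrow> X\<close> to kernels; this is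
  the equivalence between split extensions over \<open>C\<close> and internal actions of \<open>C\<close>.\<close>

definition associated_split_extension :: "'o \<Rightarrow> 'o \<Rightarrow> 'a \<Rightarrow> 'a \<Rightarrow> 'a \<Rightarrow> 'a \<Rightarrow> bool" where
  "associated_split_extension C B \<xi> f k s \<longleftrightarrow>
     is_point \<B> f s \<and> is_kernel \<B> k f \<and> Cod \<B> f = C \<and> Dom \<B> k = B \<and>
     k \<cdot> \<xi> = copair s k \<cdot> kappa C B"

text \<open>The hom-set from \<open>t\<close> to \<open>f\<close> in the slice category over the common codomain.\<close>

definition slice_Hom :: "'a \<Rightarrow> 'a \<Rightarrow> 'a set" where
  "slice_Hom t f = {x \<in> Hom \<B> (Dom \<B> t) (Dom \<B> f). f \<cdot> x = t}"

text \<open>An internal abelian group structure on \<open>f\<close> in the slice category with unit \<open>s\<close>: an operation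
  \<open>m\<close> on the product \<open>f \<times> f\<close> in the slice (a pullback) making all hom-sets into \<open>f\<close> abelian
  groups. Products and units in these hom-sets are \<open>m \<cdot> \<langle>x, y\<rangle>\<close> and \<open>s \<cdot> t\<close>.\<close>

definition slice_abelian_group :: "'a \<Rightarrow> 'a \<Rightarrow> 'a \<Rightarrow> bool" where
  "slice_abelian_group f s m \<longleftrightarrow>
     is_point \<B> f s \<and> m \<in> slice_Hom (f \<cdot> pb1 f f) f \<and>
     (\<forall>t \<in> Arr \<B>. Cod \<B> t = Cod \<B> f \<longrightarrow>
        comm_group \<lparr>carrier = slice_Hom t f, mult = (\<lambda>x y. m \<cdot> pbpair f f x y), one = s \<cdot> t\<rparr>)"

definition abelian_action :: "'o \<Rightarrow> 'o \<Rightarrow> 'a \<Rightarrow> bool" where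
  "abelian_action C B \<xi> \<longleftrightarrow> internal_action C B \<xi> \<and>
     (\<exists>f k s m. associated_split_extension C B \<xi> f k s \<and> slice_abelian_group f s m)"

definition abelian_action_morphism ::
    "'o \<Rightarrow> 'o \<Rightarrow> 'a \<Rightarrow> 'o \<Rightarrow> 'o \<Rightarrow> 'a \<Rightarrow> 'a \<Rightarrow> 'a \<Rightarrow> bool" where
  "abelian_action_morphism C B \<xi> C' B' \<xi>' \<phi>\<^sub>0 \<phi>\<^sub>1 \<longleftrightarrow>
     abelian_action C B \<xi> \<and> abelian_action C' B' \<xi>' \<and>
     \<phi>\<^sub>0 \<in> Hom \<B> C C' \<and> \<phi>\<^sub>1 \<in> Hom \<B> B B' \<and> \<phi>\<^sub>1 \<cdot> \<xi> = \<xi>' \<cdot> (\<phi>\<^sub>0 \<flat>\<^sub>m \<phi>\<^sub>1)"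

definition pull_action :: "'a \<Rightarrow> 'o \<Rightarrow> 'a \<Rightarrow> 'a" where
  "pull_action \<phi>\<^sub>0 B' \<xi>' = \<xi>' \<cdot> (\<phi>\<^sub>0 \<flat>\<^sub>m Ide \<B> B')"

section \<open>Abelian extensions\<close>

definition extension :: "'o \<Rightarrow> 'o \<Rightarrow> 'a \<Rightarrow> 'a \<Rightarrow> bool" where
  "extension C B f k \<longleftrightarrow>
     Dom \<B> k = B \<and> Cod \<B> f = C \<and> is_kernel \<B> k f \<and> is_cokernel \<B> f k"

text \<open>\<open>c\<close>, with projections \<open>w\<^sub>1, w\<^sub>2, w\<^sub>3\<close>, is the product \<open>f \<times> f \<times> f\<close> in the slice category.\<close>

definition slice_cube :: "'a \<Rightarrow> 'a \<Rightarrow> 'a \<Rightarrow> 'a \<Rightarrow> 'a \<Rightarrow> bool" where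
  "slice_cube f c w\<^sub>1 w\<^sub>2 w\<^sub>3 \<longleftrightarrow>
     f \<in> Arr \<B> \<and> c \<in> Arr \<B> \<and> Cod \<B> c = Cod \<B> f \<and> {w\<^sub>1, w\<^sub>2, w\<^sub>3} \<subseteq> slice_Hom c f \<and>
     (\<forall>t x y z. t \<in> Arr \<B> \<and> Cod \<B> t = Cod \<B> f \<and> {x, y, z} \<subseteq> slice_Hom t f \<longrightarrow>
        (\<exists>!u. u \<in> slice_Hom t c \<and> w\<^sub>1 \<cdot> u = x \<and> w\<^sub>2 \<cdot> u = y \<and> w\<^sub>3 \<cdot> u = z))"

text \<open>An internal autonomous Mal'tsev operation on \<open>f\<close> in the slice category, written on
  generalised elements; it is autonomous when it is a homomorphism for itself.\<close>

definition autonomous_maltsev :: "'a \<Rightarrow> bool" where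
  "autonomous_maltsev f \<longleftrightarrow> (\<exists>c w\<^sub>1 w\<^sub>2 w\<^sub>3 p. slice_cube f c w\<^sub>1 w\<^sub>2 w\<^sub>3 \<and> p \<in> slice_Hom c f \<and>
     (\<forall>t \<in> Arr \<B>. Cod \<B> t = Cod \<B> f \<longrightarrow>
       (let \<mu> = (\<lambda>x y z. p \<cdot> (THE u. u \<in> slice_Hom t c \<and> w\<^sub>1 \<cdot> u = x \<and> w\<^sub>2 \<cdot> u = y \<and> w\<^sub>3 \<cdot> u = z));
            H = slice_Hom t f
        in (\<forall>x \<in> H. \<forall>y \<in> H. \<mu> x x y = y \<and> \<mu> x y y = x) \<and>
           (\<forall>x\<^sub>1 x\<^sub>2 x\<^sub>3 y\<^sub>1 y\<^sub>2 y\<^sub>3 z\<^sub>1 z\<^sub>2 z\<^sub>3. {x\<^sub>1, x\<^sub>2, x\<^sub>3, y\<^sub>1, y\<^sub>2, y\<^sub>3, z\<^sub>1, z\<^sub>2, z\<^sub>3} \<subseteq> H \<longrightarrow>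
              \<mu> (\<mu> x\<^sub>1 x\<^sub>2 x\<^sub>3) (\<mu> y\<^sub>1 y\<^sub>2 y\<^sub>3) (\<mu> z\<^sub>1 z\<^sub>2 z\<^sub>3) =
              \<mu> (\<mu> x\<^sub>1 y\<^sub>1 z\<^sub>1) (\<mu> x\<^sub>2 y\<^sub>2 z\<^sub>2) (\<mu> x\<^sub>3 y\<^sub>3 z\<^sub>3)))))"

definition abelian_extension :: "'o \<Rightarrow> 'o \<Rightarrow> 'a \<Rightarrow> 'a \<Rightarrow> bool" where
  "abelian_extension C B f k \<longleftrightarrow> extension C B f k \<and> autonomous_maltsev f"

text \<open>The conjugation action of \<open>E\<close> on its normal subobject \<open>k : B \<rightarrow> E\<close>.\<close>

definition conjugation :: "'a \<Rightarrow> 'a" where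
  "conjugation k = (THE \<chi>. \<chi> \<in> Hom \<B> (Cod \<B> k \<flat> Dom \<B> k) (Dom \<B> k) \<and>
     k \<cdot> \<chi> = copair (Ide \<B> (Cod \<B> k)) k \<cdot> kappa (Cod \<B> k) (Dom \<B> k))"

definition induces :: "'a \<Rightarrow> 'a \<Rightarrow> 'a \<Rightarrow> bool" where
  "induces f k \<xi> \<longleftrightarrow> abelian_action (Cod \<B> f) (Dom \<B> k) \<xi> \<and>
     \<xi> \<cdot> (f \<flat>\<^sub>m Ide \<B> (Dom \<B> k)) = conjugation k"

text \<open>The morphisms of extensions from \<open>(f, k)\<close> to \<open>(f', k')\<close> inducing \<open>(\<phi>\<^sub>0, \<phi>\<^sub>1)\<close>. As the outer
  components are prescribed, such a morphism is given by its middle component.\<close>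

definition ext_Hom :: "'a \<Rightarrow> 'a \<Rightarrow> 'a \<Rightarrow> 'a \<Rightarrow> 'a \<Rightarrow> 'a \<Rightarrow> 'a set" where
  "ext_Hom f k f' k' \<phi>\<^sub>0 \<phi>\<^sub>1 =
     {e \<in> Hom \<B> (Dom \<B> f) (Dom \<B> f'). f' \<cdot> e = \<phi>\<^sub>0 \<cdot> f \<and> e \<cdot> k = k' \<cdot> \<phi>\<^sub>1}"

section \<open>The groupoids of abelian extensions\<close>

definition opext :: "'o \<Rightarrow> 'o \<Rightarrow> 'a \<Rightarrow> 'a \<Rightarrow> 'a \<Rightarrow> bool" where
  "opext C B \<xi> f k \<longleftrightarrow> abelian_extension C B f k \<and> induces f k \<xi>"

definition opext_isomorphic ::
    "'o \<Rightarrow> 'o \<Rightarrow> 'a \<Rightarrow> 'a \<Rightarrow> 'a \<Rightarrow> 'a \<Rightarrow> 'a \<Rightarrow> bool" where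
  "opext_isomorphic C B \<xi> f k f' k' \<longleftrightarrow> opext C B \<xi> f k \<and> opext C B \<xi> f' k' \<and>
     (\<exists>h \<in> ext_Hom f k f' k' (Ide \<B> C) (Ide \<B> B). is_iso \<B> h)"

text \<open>The pullback of the extension \<open>(f', k')\<close> along \<open>\<phi>\<^sub>0\<close> consists of \<open>pb2 f' \<phi>\<^sub>0\<close> and of the arrow
  induced by \<open>k'\<close> and \<open>0\<close>.\<close>

definition pull_ext_ker :: "'a \<Rightarrow> 'a \<Rightarrow> 'a \<Rightarrow> 'a" where
  "pull_ext_ker \<phi>\<^sub>0 f' k' = pbpair f' \<phi>\<^sub>0 k' (zero \<B> (Dom \<B> k') (Dom \<B> \<phi>\<^sub>0))"

text \<open>\<open>u\<close> is an opcartesian lifting at \<open>(f, k)\<close> of \<open>(1, \<phi>\<^sub>1)\<close>, with codomain the extension \<open>(g, l)\<close> of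
  \<open>C\<close> by \<open>B'\<close> inducing \<open>\<zeta>\<close>, for the functor from abelian extensions of \<open>C\<close> to abelian actions of
  \<open>C\<close>.\<close>

definition opcartesian_lifting ::
    "'o \<Rightarrow> 'a \<Rightarrow> 'a \<Rightarrow> 'o \<Rightarrow> 'a \<Rightarrow> 'a \<Rightarrow> 'a \<Rightarrow> 'a \<Rightarrow> 'a \<Rightarrow> bool" where
  "opcartesian_lifting C f k B' \<zeta> \<phi>\<^sub>1 g l u \<longleftrightarrow>
     opext C B' \<zeta> g l \<and> u \<in> ext_Hom f k g l (Ide \<B> C) \<phi>\<^sub>1 \<and>
     (\<forall>D \<omega> \<psi> g' l' v. opext C D \<omega> g' l' \<and>
        abelian_action_morphism C B' \<zeta> C D \<omega> (Ide \<B> C) \<psi> \<and>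
        v \<in> ext_Hom f k g' l' (Ide \<B> C) (\<psi> \<cdot> \<phi>\<^sub>1) \<longrightarrow>
        (\<exists>!t. t \<in> ext_Hom g l g' l' (Ide \<B> C) \<psi> \<and> t \<cdot> u = v))"

definition is_push_forward ::
    "'o \<Rightarrow> 'a \<Rightarrow> 'a \<Rightarrow> 'o \<Rightarrow> 'a \<Rightarrow> 'a \<Rightarrow> 'a \<Rightarrow> 'a \<Rightarrow> bool" where
  "is_push_forward C f k B' \<zeta> \<phi>\<^sub>1 g l \<longleftrightarrow> (\<exists>u. opcartesian_lifting C f k B' \<zeta> \<phi>\<^sub>1 g l u)"

section \<open>The group of automorphisms of the identity object and its action\<close>

text \<open>The chosen semidirect product extension, as a triple of projection, kernel and section.\<close>

definition semidirect :: "'o \<Rightarrow> 'o \<Rightarrow> 'a \<Rightarrow> 'a \<times> 'a \<times> 'a" where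
  "semidirect C B \<xi> = (SOME (f, k, s). associated_split_extension C B \<xi> f k s)"

definition sd_proj :: "'o \<Rightarrow> 'o \<Rightarrow> 'a \<Rightarrow> 'a" where
  "sd_proj C B \<xi> = fst (semidirect C B \<xi>)"

definition sd_ker :: "'o \<Rightarrow> 'o \<Rightarrow> 'a \<Rightarrow> 'a" where
  "sd_ker C B \<xi> = fst (snd (semidirect C B \<xi>))"

definition sd_section :: "'o \<Rightarrow> 'o \<Rightarrow> 'a \<Rightarrow> 'a" where
  "sd_section C B \<xi> = snd (snd (semidirect C B \<xi>))"

definition opext_pi1 :: "'o \<Rightarrow> 'o \<Rightarrow> 'a \<Rightarrow> 'a monoid" where
  "opext_pi1 C B \<xi> =
     (let f = sd_proj C B \<xi>; k = sd_ker C B \<xi>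
      in \<lparr>carrier = {\<gamma> \<in> ext_Hom f k f k (Ide \<B> C) (Ide \<B> B). is_iso \<B> \<gamma>},
          mult = (\<lambda>\<gamma> \<delta>. \<gamma> \<cdot> \<delta>), one = Ide \<B> (Dom \<B> f)\<rparr>)"

text \<open>The Baer sum of the identity object \<open>S\<close> and of an extension \<open>Y = (f, k)\<close> is a quotient
  \<open>S \<times>\<^sub>C Y \<rightarrow> S \<otimes> Y\<close> restricting to the addition \<open>B \<times> B \<rightarrow> B\<close> on kernels. The arrow \<open>m\<close> below is its
  composite with the unit isomorphism \<open>S \<otimes> Y \<cong> Y\<close>: it is over \<open>C\<close>, restricts to the addition on
  kernels, and \<open>m \<cdot> \<langle>s \<cdot> f, 1\<rangle> = 1\<close>, where \<open>s\<close> is the section of \<open>S\<close>.\<close>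

definition baer_unit :: "'o \<Rightarrow> 'o \<Rightarrow> 'a \<Rightarrow> 'a \<Rightarrow> 'a \<Rightarrow> 'a" where
  "baer_unit C B \<xi> f k =
     (let f\<^sub>S = sd_proj C B \<xi>; k\<^sub>S = sd_ker C B \<xi>; s = sd_section C B \<xi>
      in THE m. m \<in> Hom \<B> (Dom \<B> (pb1 f\<^sub>S f)) (Dom \<B> f) \<and>
           f \<cdot> m = f \<cdot> pb2 f\<^sub>S f \<and>
           m \<cdot> pbpair f\<^sub>S f k\<^sub>S (zero \<B> B (Dom \<B> f)) = k \<and>
           m \<cdot> pbpair f\<^sub>S f (zero \<B> B (Dom \<B> f\<^sub>S)) k = k \<and>
           m \<cdot> pbpair f\<^sub>S f (s \<cdot> f) (Ide \<B> (Dom \<B> f)) = Ide \<B> (Dom \<B> f))"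

text \<open>An automorphism \<open>\<gamma>\<close> of \<open>S\<close> acts on the arrows \<open>y : X \<rightarrow> Y\<close> of abelian extensions of \<open>C\<close>, with
  \<open>Y = (f, k)\<close> inducing \<open>\<xi>\<close>, by composing \<open>y\<close> with \<open>Y \<cong> S \<otimes> Y \<rightarrow> S \<otimes> Y \<cong> Y\<close>, where the middle arrow is
  \<open>\<gamma> \<otimes> 1\<close>. The inverse of the unit isomorphism comes from \<open>\<langle>s \<cdot> f, 1\<rangle>\<close>, so that the result is
  \<open>m \<cdot> \<langle>\<gamma> \<cdot> s \<cdot> f \<cdot> y, y\<rangle>\<close>.\<close>

definition opext_translate :: "'o \<Rightarrow> 'o \<Rightarrow> 'a \<Rightarrow> 'a \<Rightarrow> 'a \<Rightarrow> 'a \<Rightarrow> 'a \<Rightarrow> 'a" where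
  "opext_translate C B \<xi> f k \<gamma> y =
     baer_unit C B \<xi> f k \<cdot> pbpair (sd_proj C B \<xi>) f (\<gamma> \<cdot> sd_section C B \<xi> \<cdot> f \<cdot> y) y"

text \<open>The action on morphisms of extensions \<open>(f, k) \<rightarrow> (f', k')\<close> inducing \<open>(\<phi>\<^sub>0, \<phi>\<^sub>1)\<close>, which are
  identified with morphisms over \<open>C\<close> from \<open>(f, k)\<close> to the pullback of \<open>(f', k')\<close> along \<open>\<phi>\<^sub>0\<close>.\<close>

definition opext_pi1_action ::
    "'a \<Rightarrow> 'a \<Rightarrow> 'a \<Rightarrow> 'a \<Rightarrow> 'a \<Rightarrow> 'a \<Rightarrow> 'a \<Rightarrow> 'a \<Rightarrow> 'a \<Rightarrow> 'a" where
  "opext_pi1_action f k f' k' \<xi>' \<phi>\<^sub>0 \<phi>\<^sub>1 \<gamma> =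
     (\<lambda>e \<in> ext_Hom f k f' k' \<phi>\<^sub>0 \<phi>\<^sub>1.
        pb1 f' \<phi>\<^sub>0 \<cdot> opext_translate (Dom \<B> \<phi>\<^sub>0) (Dom \<B> k') (pull_action \<phi>\<^sub>0 (Dom \<B> k') \<xi>')
          (pb2 f' \<phi>\<^sub>0) (pull_ext_ker \<phi>\<^sub>0 f' k') \<gamma> (pbpair f' \<phi>\<^sub>0 e f))"

end

definition simply_transitive :: "('g, 'm) monoid_scheme \<Rightarrow> 'x set \<Rightarrow> ('g \<Rightarrow> 'x \<Rightarrow> 'x) \<Rightarrow> bool" where
  "simply_transitive \<Gamma> X act \<longleftrightarrow> group_action \<Gamma> X act \<and>
     (\<forall>x \<in> X. \<forall>y \<in> X. \<exists>!\<gamma>. \<gamma> \<in> carrier \<Gamma> \<and> act \<gamma> x = y)"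

end

theory Submission
  imports Defs
begin

text \<open>
  An abelian extension \<open>E\<close> of \<open>C\<close> by \<open>B\<close> that induces \<open>\<xi>\<close> is, over \<open>C\<close>, a torsor under the
  semidirect product \<open>S = B \<rtimes>\<^sub>\<xi> C\<close>, and both assertions are formal consequences of this.

  To obtain the torsor structure, compare \<open>S \<times>\<^sub>C E\<close> with the kernel pair \<open>E \<times>\<^sub>C E\<close>. Both are split
  extensions of \<open>E\<close> by \<open>B\<close>, and both belong to the conjugation action of \<open>E\<close> on \<open>B\<close>. A split extension
  is presented by its kernel and its section with the relations that the action imposes
  (\<open>split_extension_universal\<close>), so the two are isomorphic. Composed with a projection of the kernel
  pair, the isomorphism is a translation \<open>S \<times>\<^sub>C E \<rightarrow> E\<close>, free and transitive on generalised elements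
  (\<open>induced_translation\<close>). Kernel and section of a split epimorphism are jointly epic
  (\<open>split_joint_epi\<close>, an effect of protomodularity); this reduces associativity and naturality of
  translations to their values on \<open>B\<close> and on the zero section.

  Every morphism \<open>u : E \<rightarrow> G\<close> of abelian extensions of \<open>C\<close> is therefore opcartesian
  (\<open>opcartesian_extension\<close>): locally on \<open>C\<close> an element of \<open>G\<close> is a translate of \<open>u \<cdot> e\<close> with \<open>e\<close>
  in \<open>E\<close>, and equivariance dictates where it must go. A morphism \<open>E \<rightarrow> E'\<close> inducing
  \<open>(\<phi>\<^sub>0, \<phi>\<^sub>1)\<close> amounts to a morphism \<open>E \<rightarrow> \<phi>\<^sub>0\<^sup>*E'\<close> over \<open>C\<close> that restricts to \<open>\<phi>\<^sub>1\<close> on the kernels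
  (\<open>ext_Hom_pullback\<close>). Given one, \<open>\<phi>\<^sub>0\<^sup>*E'\<close> is itself a push forward of \<open>E\<close> along \<open>\<phi>\<^sub>1\<close>, hence
  isomorphic to any other; conversely the opcartesian arrow of a push forward can be composed with
  an isomorphism to \<open>\<phi>\<^sub>0\<^sup>*E'\<close>.

  Two morphisms \<open>E \<rightarrow> \<phi>\<^sub>0\<^sup>*E'\<close> with the same restriction to the kernels differ by the translation by an
  arrow from \<open>E\<close> to the semidirect product of \<open>\<phi>\<^sub>0\<^sup>*\<xi>'\<close> that vanishes on \<open>B\<close>, hence by a unique section
  of this semidirect product. Translations by sections are exactly its automorphisms over \<open>C\<close> and
  under \<open>B'\<close> (\<open>pi1_translation\<close>, \<open>pi1_of_section\<close>), which gives the simply transitive action.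
\<close>

section \<open>Composition, zero arrows and kernels\<close>

context category
begin

abbreviation arr where "arr f \<equiv> f \<in> Arr \<B>"
abbreviation src where "src \<equiv> Dom \<B>"
abbreviation tgt where "tgt \<equiv> Cod \<B>"
abbreviation ide where "ide \<equiv> Ide \<B>"
abbreviation pair where "pair \<equiv> pbpair \<B>"
abbreviation slice where "slice \<equiv> slice_Hom \<B>"

lemma arr_comp [simp]:
  assumes "arr f" "arr g" "src g = tgt f"
  shows "arr (g \<cdot> f)" "src (g \<cdot> f) = src f" "tgt (g \<cdot> f) = tgt g"
  using Comp_Hom[of f "src f" "tgt f" g "tgt g"] assms by (auto simp: Hom_def)

lemma comp_assoc [simp]:
  assumes "arr f" "arr g" "arr h" "src g = tgt f" "src h = tgt g"
  shows "(h \<cdot> g) \<cdot> f = h \<cdot> (g \<cdot> f)"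
  using Comp_assoc[of f "src f" "tgt f" g "tgt g" h "tgt h"] assms by (auto simp: Hom_def)

lemma ide_arr [simp]:
  assumes "X \<in> Obj \<B>"
  shows "arr (ide X)" "src (ide X) = X" "tgt (ide X) = X"
  using Ide_Hom[OF assms] by (auto simp: Hom_def)

lemma ide_comp [simp]:
  "arr f \<Longrightarrow> tgt f = X \<Longrightarrow> ide X \<cdot> f = f"
  "arr f \<Longrightarrow> src f = X \<Longrightarrow> f \<cdot> ide X = f"
  using Ide_left[of f "src f" "tgt f"] Ide_right[of f "src f" "tgt f"]
  by (auto simp: Hom_def)

lemmas obj_arr [simp] = Dom_Obj Cod_Obj

text \<open>Composites are kept associated to the right; this turns an equation between composites
  into a rewrite rule inside longer composites.\<close>

lemma comp_reassoc:
  assumes "g \<cdot> f = h" "arr f" "arr g" "src g = tgt f" "arr x" "tgt x = src f"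
  shows "g \<cdot> (f \<cdot> x) = h \<cdot> x"
  using comp_assoc[of x f g] assms by simp

lemma is_isoI:
  assumes "arr f" "arr g" "src g = tgt f" "tgt g = src f"
    "g \<cdot> f = ide (src f)" "f \<cdot> g = ide (tgt f)"
  shows "is_iso \<B> f"
  using assms by (auto simp: is_iso_def Hom_def)

lemma is_isoE:
  assumes "is_iso \<B> f"
  obtains g where "arr f" "arr g" "src g = tgt f" "tgt g = src f"
    "g \<cdot> f = ide (src f)" "f \<cdot> g = ide (tgt f)"
  using assms by (auto simp: is_iso_def Hom_def)

lemma is_iso_ide: "X \<in> Obj \<B> \<Longrightarrow> is_iso \<B> (ide X)"
  by (rule is_isoI[of _ "ide X"]) auto

lemma slice_Hom_iff: "x \<in> slice t f \<longleftrightarrow>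
    x \<in> Arr \<B> \<and> src x = src t \<and> tgt x = src f \<and> f \<cdot> x = t"
  by (auto simp: slice_Hom_def Hom_def)

end

context semi_abelian
begin

lemma zero_unique:
  assumes "is_zero_obj \<B> Z" "is_zero_obj \<B> Z'" "a \<in> Hom \<B> X Z" "b \<in> Hom \<B> Z Y"
    "a' \<in> Hom \<B> X Z'" "b' \<in> Hom \<B> Z' Y"
  shows "b \<cdot> a = b' \<cdot> a'"
proof -
  have Z: "Z \<in> Obj \<B>" "Z' \<in> Obj \<B>" "X \<in> Obj \<B>" "Y \<in> Obj \<B>"
    using assms by (auto simp: is_zero_obj_def is_initial_def Hom_def)
  obtain z where z: "z \<in> Hom \<B> Z Z'"
    using assms(1) Z(2) unfolding is_zero_obj_def is_initial_def by blast
  have "z \<cdot> a = a'"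
  proof -
    have "z \<cdot> a \<in> Hom \<B> X Z'" using z assms(3) by (auto simp: Hom_def)
    then show ?thesis using assms(2,5) Z(3) unfolding is_zero_obj_def is_terminal_def by blast
  qed
  moreover have "b' \<cdot> z = b"
  proof -
    have "b' \<cdot> z \<in> Hom \<B> Z Y" using z assms(6) by (auto simp: Hom_def)
    then show ?thesis using assms(1,4) Z(4) unfolding is_zero_obj_def is_initial_def by blast
  qed
  ultimately show ?thesis using comp_reassoc[of b' z b a] z assms(3,6) by (simp add: Hom_def)
qed

lemma zeroI:
  assumes "is_zero_obj \<B> Z" "a \<in> Hom \<B> X Z" "b \<in> Hom \<B> Z Y"
  shows "zero \<B> X Y = b \<cdot> a"
  unfolding zero_def using assms zero_unique by (intro the_equality) blast+

lemma zeroE: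
  assumes "X \<in> Obj \<B>" "Y \<in> Obj \<B>"
  obtains Z a b where "is_zero_obj \<B> Z" "a \<in> Hom \<B> X Z" "b \<in> Hom \<B> Z Y" "zero \<B> X Y = b \<cdot> a"
proof -
  obtain Z where Z: "is_zero_obj \<B> Z" using pointed by blast
  obtain a where "a \<in> Hom \<B> X Z"
    using Z assms(1) unfolding is_zero_obj_def is_terminal_def by blast
  moreover obtain b where "b \<in> Hom \<B> Z Y"
    using Z assms(2) unfolding is_zero_obj_def is_initial_def by blast
  ultimately show ?thesis using that Z zeroI by blast
qed

lemma zero_arr [simp]:
  assumes "X \<in> Obj \<B>" "Y \<in> Obj \<B>"
  shows "arr (zero \<B> X Y)" "src (zero \<B> X Y) = X" "tgt (zero \<B> X Y) = Y"
  by (rule zeroE[OF assms], auto simp: Hom_def)+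

lemma comp_zero [simp]:
  assumes "arr f" "src f = Y" "X \<in> Obj \<B>"
  shows "f \<cdot> zero \<B> X Y = zero \<B> X (tgt f)"
proof -
  have "Y \<in> Obj \<B>" using assms by auto
  then obtain Z a b where Z: "is_zero_obj \<B> Z" "a \<in> Hom \<B> X Z" "b \<in> Hom \<B> Z Y" "zero \<B> X Y = b \<cdot> a"
    using assms zeroE by metis
  then have "zero \<B> X (tgt f) = (f \<cdot> b) \<cdot> a"
    by (intro zeroI) (use assms in \<open>auto simp: Hom_def\<close>)
  then show ?thesis using Z assms by (auto simp: Hom_def)
qed

lemma zero_comp [simp]:
  assumes "arr f" "tgt f = Y" "X \<in> Obj \<B>"
  shows "zero \<B> Y X \<cdot> f = zero \<B> (src f) X"
proof -
  have "Y \<in> Obj \<B>" using assms by auto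
  then obtain Z a b where Z: "is_zero_obj \<B> Z" "a \<in> Hom \<B> Y Z" "b \<in> Hom \<B> Z X" "zero \<B> Y X = b \<cdot> a"
    using assms zeroE by metis
  then have "zero \<B> (src f) X = b \<cdot> (a \<cdot> f)"
    by (intro zeroI) (use assms in \<open>auto simp: Hom_def\<close>)
  then show ?thesis using Z assms by (auto simp: Hom_def)
qed

lemma kernel_arr:
  assumes "is_kernel \<B> k f"
  shows "arr k" "arr f" "tgt k = src f" "f \<cdot> k = zero \<B> (src k) (tgt f)"
  using assms by (auto simp: is_kernel_def Hom_def)

lemma kernel_factor:
  assumes "is_kernel \<B> k f" "arr x" "tgt x = src f" "f \<cdot> x = zero \<B> (src x) (tgt f)"
  obtains t where "arr t" "src t = src x" "tgt t = src k" "k \<cdot> t = x"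
proof -
  have "x \<in> Hom \<B> (src x) (src f)" using assms by (auto simp: Hom_def)
  then have "\<exists>t. t \<in> Hom \<B> (src x) (src k) \<and> k \<cdot> t = x"
    using assms unfolding is_kernel_def by blast
  then show ?thesis using that by (auto simp: Hom_def)
qed

lemma kernel_mono:
  assumes "is_kernel \<B> k f" "arr x" "arr y" "src x = src y"
    "tgt x = src k" "tgt y = src k" "k \<cdot> x = k \<cdot> y"
  shows "x = y"
proof -
  note ka = kernel_arr[OF assms(1)]
  have "k \<cdot> x \<in> Hom \<B> (src x) (src f)" using assms ka by (auto simp: Hom_def)
  moreover have "f \<cdot> (k \<cdot> x) = zero \<B> (src x) (tgt f)"
    using assms ka by (simp add: comp_reassoc[OF ka(4)])
  ultimately have "\<exists>!t. t \<in> Hom \<B> (src x) (src k) \<and> k \<cdot> t = k \<cdot> x"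
    using assms(1) unfolding is_kernel_def by blast
  then show ?thesis using assms by (auto simp: Hom_def)
qed

lemma is_kernelI:
  assumes "arr k" "arr f" "tgt k = src f" "f \<cdot> k = zero \<B> (src k) (tgt f)"
    and ex: "\<And>x. arr x \<Longrightarrow> tgt x = src f \<Longrightarrow> f \<cdot> x = zero \<B> (src x) (tgt f) \<Longrightarrow>
      \<exists>t. arr t \<and> src t = src x \<and> tgt t = src k \<and> k \<cdot> t = x"
    and un: "\<And>x y. arr x \<Longrightarrow> arr y \<Longrightarrow> src x = src y \<Longrightarrow> tgt x = src k \<Longrightarrow>
      tgt y = src k \<Longrightarrow> k \<cdot> x = k \<cdot> y \<Longrightarrow> x = y"
  shows "is_kernel \<B> k f"
  unfolding is_kernel_def
proof (intro conjI allI impI)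
  fix T x assume x: "x \<in> Hom \<B> T (src f) \<and> f \<cdot> x = zero \<B> T (tgt f)"
  then obtain t where "arr t" "src t = src x" "tgt t = src k" "k \<cdot> t = x"
    using ex[of x] by (auto simp: Hom_def)
  then show "\<exists>!t. t \<in> Hom \<B> T (src k) \<and> k \<cdot> t = x"
    using x un by (intro ex1I[of _ t]) (auto simp: Hom_def)
qed (use assms in \<open>auto simp: Hom_def\<close>)

section \<open>Pullbacks and equalizers\<close>

lemma pullback_arr:
  assumes "is_pullback \<B> f g p q"
  shows "arr f" "arr g" "tgt g = tgt f" "arr p" "arr q"
    "tgt p = src f" "tgt q = src g" "src q = src p" "f \<cdot> p = g \<cdot> q"
  using assms by (auto simp: is_pullback_def Hom_def)

lemma pullback_factor:
  assumes "is_pullback \<B> f g p q" "arr x" "arr y" "src x = src y"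
    "tgt x = src f" "tgt y = src g" "f \<cdot> x = g \<cdot> y"
  obtains t where "arr t" "src t = src y" "tgt t = src p" "p \<cdot> t = x" "q \<cdot> t = y"
proof -
  have "x \<in> Hom \<B> (src y) (src f)" "y \<in> Hom \<B> (src y) (src g)"
    using assms by (auto simp: Hom_def)
  then have "\<exists>t. t \<in> Hom \<B> (src y) (src p) \<and> p \<cdot> t = x \<and> q \<cdot> t = y"
    using assms unfolding is_pullback_def by blast
  then show ?thesis using that by (auto simp: Hom_def)
qed

lemma pullback_ext:
  assumes "is_pullback \<B> f g p q" "arr x" "arr y" "src x = src y"
    "tgt x = src p" "tgt y = src p" "p \<cdot> x = p \<cdot> y" "q \<cdot> x = q \<cdot> y"
  shows "x = y"
proof -
  note pa = pullback_arr[OF assms(1)]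
  have "p \<cdot> x \<in> Hom \<B> (src x) (src f)" "q \<cdot> x \<in> Hom \<B> (src x) (src g)"
    using assms pa by (auto simp: Hom_def)
  moreover have "f \<cdot> (p \<cdot> x) = g \<cdot> (q \<cdot> x)"
    using assms(2-) pa by (simp add: comp_reassoc[OF pa(9)])
  ultimately have "\<exists>!t. t \<in> Hom \<B> (src x) (src p) \<and> p \<cdot> t = p \<cdot> x \<and> q \<cdot> t = q \<cdot> x"
    using assms(1) unfolding is_pullback_def by blast
  then show ?thesis using assms by (auto simp: Hom_def)
qed

lemma is_pullbackI:
  assumes "arr f" "arr g" "tgt f = tgt g" "arr p" "arr q"
    "tgt p = src f" "tgt q = src g" "src q = src p" "f \<cdot> p = g \<cdot> q"
    and ex: "\<And>x y. arr x \<Longrightarrow> arr y \<Longrightarrow> src x = src y \<Longrightarrow> tgt x = src f \<Longrightarrow>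
      tgt y = src g \<Longrightarrow> f \<cdot> x = g \<cdot> y \<Longrightarrow>
      \<exists>t. arr t \<and> src t = src y \<and> tgt t = src p \<and> p \<cdot> t = x \<and> q \<cdot> t = y"
    and un: "\<And>x y. arr x \<Longrightarrow> arr y \<Longrightarrow> src x = src y \<Longrightarrow> tgt x = src p \<Longrightarrow>
      tgt y = src p \<Longrightarrow> p \<cdot> x = p \<cdot> y \<Longrightarrow> q \<cdot> x = q \<cdot> y \<Longrightarrow> x = y"
  shows "is_pullback \<B> f g p q"
  unfolding is_pullback_def
proof (intro conjI allI impI)
  fix T x y assume x: "x \<in> Hom \<B> T (src f) \<and> y \<in> Hom \<B> T (src g) \<and> f \<cdot> x = g \<cdot> y"
  then obtain t where "arr t" "src t = src y" "tgt t = src p" "p \<cdot> t = x" "q \<cdot> t = y"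
    using ex[of x y] by (auto simp: Hom_def)
  then show "\<exists>!t. t \<in> Hom \<B> T (src p) \<and> p \<cdot> t = x \<and> q \<cdot> t = y"
    using x un by (intro ex1I[of _ t]) (auto simp: Hom_def)
qed (use assms in \<open>auto simp: Hom_def\<close>)

lemma pb_pullback:
  assumes "arr f" "arr g" "tgt f = tgt g"
  shows "is_pullback \<B> f g (pb1 \<B> f g) (pb2 \<B> f g)"
proof -
  have "\<exists>pq. case pq of (p, q) \<Rightarrow> is_pullback \<B> f g p q" using pullbacks[OF assms] by auto
  then have "case (SOME (p, q). is_pullback \<B> f g p q) of (p, q) \<Rightarrow> is_pullback \<B> f g p q"
    by (rule someI_ex)
  then show ?thesis unfolding pb1_def pb2_def by (simp add: case_prod_beta)
qed

lemma pb_arr [simp]: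
  assumes "arr f" "arr g" "tgt f = tgt g"
  shows "arr (pb1 \<B> f g)" "arr (pb2 \<B> f g)" "tgt (pb1 \<B> f g) = src f"
    "tgt (pb2 \<B> f g) = src g" "src (pb2 \<B> f g) = src (pb1 \<B> f g)"
  using pullback_arr[OF pb_pullback[OF assms]] by auto

lemma pb_commute:
  assumes "arr f" "arr g" "tgt f = tgt g"
  shows "f \<cdot> pb1 \<B> f g = g \<cdot> pb2 \<B> f g"
  using pullback_arr[OF pb_pullback[OF assms]] by auto

lemma pb_ext:
  assumes "arr f" "arr g" "tgt f = tgt g" "arr x" "arr y" "src x = src y"
    "tgt x = src (pb1 \<B> f g)" "tgt y = src (pb1 \<B> f g)"
    "pb1 \<B> f g \<cdot> x = pb1 \<B> f g \<cdot> y" "pb2 \<B> f g \<cdot> x = pb2 \<B> f g \<cdot> y"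
  shows "x = y"
  using pullback_ext[OF pb_pullback[OF assms(1-3)]] assms by auto

lemma pbpair [simp]:
  assumes "arr f" "arr g" "tgt f = tgt g" "arr x" "arr y" "src x = src y"
    "tgt x = src f" "tgt y = src g" "f \<cdot> x = g \<cdot> y"
  shows "arr (pair f g x y)" "src (pair f g x y) = src y"
    "tgt (pair f g x y) = src (pb1 \<B> f g)"
    "pb1 \<B> f g \<cdot> pair f g x y = x" "pb2 \<B> f g \<cdot> pair f g x y = y"
proof -
  obtain t where t: "arr t" "src t = src y" "tgt t = src (pb1 \<B> f g)"
    "pb1 \<B> f g \<cdot> t = x" "pb2 \<B> f g \<cdot> t = y"
    using pullback_factor[OF pb_pullback[OF assms(1-3)] assms(4-9)] by blast
  have "pair f g x y = t" unfolding pbpair_def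
  proof (rule the_equality)
    fix u assume u: "u \<in> Hom \<B> (src x) (src (pb1 \<B> f g)) \<and>
      pb1 \<B> f g \<cdot> u = x \<and> pb2 \<B> f g \<cdot> u = y"
    show "u = t" by (rule pb_ext[OF assms(1-3)]) (use u t assms(6) in \<open>auto simp: Hom_def\<close>)
  qed (use t assms(6) in \<open>auto simp: Hom_def\<close>)
  with t show "arr (pair f g x y)" "src (pair f g x y) = src y"
    "tgt (pair f g x y) = src (pb1 \<B> f g)"
    "pb1 \<B> f g \<cdot> pair f g x y = x" "pb2 \<B> f g \<cdot> pair f g x y = y" by auto
qed

lemma pbpair_reassoc [simp]:
  assumes "arr f" "arr g" "tgt f = tgt g" "arr x" "arr y" "src x = src y"
    "tgt x = src f" "tgt y = src g" "f \<cdot> x = g \<cdot> y" "arr t" "tgt t = src y"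
  shows "pb1 \<B> f g \<cdot> pair f g x y \<cdot> t = x \<cdot> t" "pb2 \<B> f g \<cdot> pair f g x y \<cdot> t = y \<cdot> t"
  using comp_reassoc[OF pbpair(4)[OF assms(1-9)]] comp_reassoc[OF pbpair(5)[OF assms(1-9)]] assms by auto

lemma pbpair_comp:
  assumes "arr f" "arr g" "tgt f = tgt g" "arr x" "arr y" "src x = src y"
    "tgt x = src f" "tgt y = src g" "f \<cdot> x = g \<cdot> y" "arr t" "tgt t = src y"
  shows "pair f g x y \<cdot> t = pair f g (x \<cdot> t) (y \<cdot> t)"
proof -
  have "f \<cdot> x \<cdot> t = g \<cdot> y \<cdot> t" using comp_reassoc[OF assms(9)] assms by simp
  note this [simp]
  show ?thesis by (rule pb_ext[of f g]) (use assms in auto)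
qed

lemma pbpair_eta:
  assumes "arr f" "arr g" "tgt f = tgt g" "arr t" "tgt t = src (pb1 \<B> f g)"
  shows "pair f g (pb1 \<B> f g \<cdot> t) (pb2 \<B> f g \<cdot> t) = t"
proof -
  have "f \<cdot> pb1 \<B> f g \<cdot> t = g \<cdot> pb2 \<B> f g \<cdot> t"
    using comp_reassoc[OF pb_commute[OF assms(1-3)]] assms by simp
  note this [simp]
  show ?thesis by (rule pb_ext[of f g]) (use assms in auto)
qed

lemma zero_objE:
  obtains Z where "is_zero_obj \<B> Z" "Z \<in> Obj \<B>"
    "\<And>x. arr x \<Longrightarrow> tgt x = Z \<Longrightarrow> x = zero \<B> (src x) Z"
proof -
  obtain Z where Z: "is_zero_obj \<B> Z" using pointed by blast
  then have o: "Z \<in> Obj \<B>" by (auto simp: is_zero_obj_def is_initial_def)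
  have "x = zero \<B> (src x) Z" if x: "arr x" "tgt x = Z" for x
  proof -
    have "zero \<B> (src x) Z \<in> Hom \<B> (src x) Z" "x \<in> Hom \<B> (src x) Z" "src x \<in> Obj \<B>"
      using x o by (auto simp: Hom_def)
    then show ?thesis using Z unfolding is_zero_obj_def is_terminal_def by blast
  qed
  then show ?thesis using that Z o by blast
qed

lemma kernel_pullback:
  assumes "is_kernel \<B> k f"
    and Z: "Z \<in> Obj \<B>" "\<And>x. arr x \<Longrightarrow> tgt x = Z \<Longrightarrow> x = zero \<B> (src x) Z"
  shows "is_pullback \<B> f (zero \<B> Z (tgt f)) k (zero \<B> (src k) Z)"
proof -
  note ka = kernel_arr[OF assms(1)]
  show ?thesis
  proof (rule is_pullbackI)
    fix x y assume x: "arr x" "arr y" "src x = src y" "tgt x = src f"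
      "tgt y = src (zero \<B> Z (tgt f))" "f \<cdot> x = zero \<B> Z (tgt f) \<cdot> y"
    then have "f \<cdot> x = zero \<B> (src x) (tgt f)" using ka Z(1) by simp
    then obtain t where "arr t" "src t = src x" "tgt t = src k" "k \<cdot> t = x"
      using kernel_factor[OF assms(1)] x by metis
    moreover have "y = zero \<B> (src y) Z" using x Z ka by auto
    ultimately show "\<exists>t. arr t \<and> src t = src y \<and> tgt t = src k \<and> k \<cdot> t = x
        \<and> zero \<B> (src k) Z \<cdot> t = y" using x Z(1) by (intro exI[of _ t]) auto
  qed (use ka Z kernel_mono[OF assms(1)] in auto)
qed

lemma kernel_exists:
  assumes "arr f"
  shows "\<exists>k. is_kernel \<B> k f"
proof -
  obtain Z where Z: "is_zero_obj \<B> Z" "Z \<in> Obj \<B>"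
    "\<And>x. arr x \<Longrightarrow> tgt x = Z \<Longrightarrow> x = zero \<B> (src x) Z" using zero_objE by metis
  let ?z = "zero \<B> Z (tgt f)"
  have a: "arr (pb1 \<B> f ?z)" "arr (pb2 \<B> f ?z)" "tgt (pb1 \<B> f ?z) = src f"
    "tgt (pb2 \<B> f ?z) = Z" "src (pb2 \<B> f ?z) = src (pb1 \<B> f ?z)"
    using assms Z by auto
  have "is_kernel \<B> (pb1 \<B> f ?z) f"
  proof (rule is_kernelI)
    show "f \<cdot> pb1 \<B> f ?z = zero \<B> (src (pb1 \<B> f ?z)) (tgt f)"
      using pb_commute[of f ?z] assms Z a by simp
    fix x assume x: "arr x" "tgt x = src f" "f \<cdot> x = zero \<B> (src x) (tgt f)"
    show "\<exists>t. arr t \<and> src t = src x \<and> tgt t = src (pb1 \<B> f ?z) \<and> pb1 \<B> f ?z \<cdot> t = x"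
      by (rule exI[of _ "pair f ?z x (zero \<B> (src x) Z)"]) (use x assms Z in simp)
  next
    fix x y assume x: "arr x" "arr y" "src x = src y" "tgt x = src (pb1 \<B> f ?z)"
      "tgt y = src (pb1 \<B> f ?z)" "pb1 \<B> f ?z \<cdot> x = pb1 \<B> f ?z \<cdot> y"
    have "pb2 \<B> f ?z \<cdot> x = zero \<B> (src x) Z" "pb2 \<B> f ?z \<cdot> y = zero \<B> (src y) Z"
      using Z(3)[of "pb2 \<B> f ?z \<cdot> x"] Z(3)[of "pb2 \<B> f ?z \<cdot> y"] x a by auto
    note this [simp]
    show "x = y" by (rule pb_ext[of f ?z]) (use x assms(1) Z(2) in auto)
  qed (use a assms in auto)
  then show ?thesis by blast
qed

text \<open>The equalizer of \<open>x\<close> and \<open>y\<close> is the pullback of their graphs.\<close>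

lemma equalizer_exists:
  assumes "arr x" "arr y" "src y = src x" "tgt y = tgt x"
  obtains i where "arr i" "tgt i = src x" "x \<cdot> i = y \<cdot> i"
    "\<And>t. arr t \<Longrightarrow> tgt t = src x \<Longrightarrow> x \<cdot> t = y \<cdot> t \<Longrightarrow>
      \<exists>a. arr a \<and> src a = src t \<and> tgt a = src i \<and> i \<cdot> a = t"
    "\<And>a b. arr a \<Longrightarrow> arr b \<Longrightarrow> src a = src b \<Longrightarrow> tgt a = src i \<Longrightarrow> tgt b = src i \<Longrightarrow>
      i \<cdot> a = i \<cdot> b \<Longrightarrow> a = b"
proof -
  obtain Z where Z: "is_zero_obj \<B> Z" "Z \<in> Obj \<B>"
    "\<And>x. arr x \<Longrightarrow> tgt x = Z \<Longrightarrow> x = zero \<B> (src x) Z" using zero_objE by metis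
  define S X where "S = src x" and "X = tgt x"
  have o: "S \<in> Obj \<B>" "X \<in> Obj \<B>" "src x = S" "tgt x = X" "src y = S" "tgt y = X"
    using assms by (auto simp: S_def X_def)
  define f g where "f = zero \<B> S Z" and "g = zero \<B> X Z"
  have fg: "arr f" "arr g" "src f = S" "src g = X" "tgt f = Z" "tgt g = Z"
    unfolding f_def g_def using o Z by auto
  have fgc: "g \<cdot> z = f \<cdot> w" if "arr z" "arr w" "tgt z = X" "tgt w = S" "src z = src w" for z w
    using that Z o unfolding f_def g_def by auto
  define u v where "u = pair f g (ide S) x" and "v = pair f g (ide S) y"
  have "f \<cdot> ide S = g \<cdot> x" "f \<cdot> ide S = g \<cdot> y" 
    using fgc[of x "ide S"] fgc[of y "ide S"] assms o by simp_all
  then have uv: "arr u" "arr v" "src u = S" "src v = S" "tgt u = src (pb1 \<B> f g)"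
    "tgt v = src (pb1 \<B> f g)" "pb1 \<B> f g \<cdot> u = ide S" "pb2 \<B> f g \<cdot> u = x"
    "pb1 \<B> f g \<cdot> v = ide S" "pb2 \<B> f g \<cdot> v = y"
    unfolding u_def v_def using o fg assms by auto
  have pbl: "arr (pb1 \<B> f g)" "tgt (pb1 \<B> f g) = S" "arr (pb2 \<B> f g)"
    "src (pb2 \<B> f g) = src (pb1 \<B> f g)"
    using fg by auto
  have uvt: "pb1 \<B> f g \<cdot> u \<cdot> t = t" "pb2 \<B> f g \<cdot> u \<cdot> t = x \<cdot> t" "pb1 \<B> f g \<cdot> v \<cdot> t = t" "pb2 \<B> f g \<cdot> v \<cdot> t = y \<cdot> t"
    if "arr t" "tgt t = S" for t
    using comp_reassoc[OF uv(7)] comp_reassoc[OF uv(8)] comp_reassoc[OF uv(9)] comp_reassoc[OF uv(10)]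
      that uv pbl by auto
  define i j where "i = pb1 \<B> u v" and "j = pb2 \<B> u v"
  have ij: "arr i" "arr j" "tgt i = S" "tgt j = S" "src j = src i" "u \<cdot> i = v \<cdot> j"
    unfolding i_def j_def using uv pb_commute[of u v] by auto
  have eq: "i = j" using uvt[of i] uvt[of j] ij by simp
  show ?thesis
  proof (rule that[of i])
    show "x \<cdot> i = y \<cdot> i" using uvt[of i] uvt[of j] ij eq by simp
    fix t assume t: "arr t" "tgt t = src x" "x \<cdot> t = y \<cdot> t"
    have "u \<cdot> t = v \<cdot> t" by (rule pb_ext[of f g]) (use t uvt[of t] uv fg o in auto)
    then show "\<exists>a. arr a \<and> src a = src t \<and> tgt a = src i \<and> i \<cdot> a = t"
      using t uv o unfolding i_def by (intro exI[of _ "pair u v t t"]) auto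
  next
    fix a b assume "arr a" "arr b" "src a = src b" "tgt a = src i" "tgt b = src i" "i \<cdot> a = i \<cdot> b"
    note ab = this
    have "pb1 \<B> u v \<cdot> a = pb1 \<B> u v \<cdot> b" "pb2 \<B> u v \<cdot> a = pb2 \<B> u v \<cdot> b"
      using ab(6) eq unfolding i_def j_def by simp_all
    then show "a = b"
      using pb_ext[of u v a b] ab(1-5) uv(1-6) unfolding i_def by simp
  qed (use ij o in auto)
qed

section \<open>Regular epimorphisms\<close>

lemma is_coequalizerD:
  assumes "is_coequalizer \<B> a b q"
  shows "arr a" "arr b" "arr q" "src b = src a" "tgt b = tgt a" "src q = tgt a"
    "q \<cdot> a = q \<cdot> b"
  using assms by (auto simp: is_coequalizer_def Hom_def)

lemma coequalizer_factor:
  assumes "is_coequalizer \<B> a b q" "arr x" "src x = src q" "x \<cdot> a = x \<cdot> b"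
  obtains t where "arr t" "src t = tgt q" "tgt t = tgt x" "t \<cdot> q = x"
proof -
  have "x \<in> Hom \<B> (tgt a) (tgt x)" using assms is_coequalizerD[OF assms(1)] by (simp add: Hom_def)
  then have "\<exists>t. t \<in> Hom \<B> (tgt q) (tgt x) \<and> t \<cdot> q = x"
    using assms(1,4) unfolding is_coequalizer_def by blast
  then show ?thesis using that by (auto simp: Hom_def)
qed

lemma regular_epi_epi:
  assumes "is_regular_epi \<B> q" "arr x" "arr y" "src x = tgt q" "src y = tgt q"
    "x \<cdot> q = y \<cdot> q"
  shows "x = y"
proof -
  obtain a b where q: "is_coequalizer \<B> a b q" using assms(1) by (auto simp: is_regular_epi_def)
  note qa = is_coequalizerD[OF q]
  have "(x \<cdot> q) \<cdot> a = (x \<cdot> q) \<cdot> b" using qa assms(2,4) by simp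
  moreover have "x \<cdot> q \<in> Hom \<B> (tgt a) (tgt x)" using qa assms(2,4) by (simp add: Hom_def)
  ultimately have "\<exists>!t. t \<in> Hom \<B> (tgt q) (tgt x) \<and> t \<cdot> q = x \<cdot> q"
    using q unfolding is_coequalizer_def by blast
  moreover have "tgt y = tgt x"
    using arr_comp(3)[of q x] arr_comp(3)[of q y] assms qa(3) by metis
  ultimately show ?thesis using assms(2-6) by (auto simp: Hom_def)
qed

text \<open>Any pair that \<open>q\<close> coequalizes factors through the kernel pair of \<open>q\<close>.\<close>

lemma regular_epi_descent:
  assumes "is_regular_epi \<B> q" "arr x" "src x = src q" "x \<cdot> pb1 \<B> q q = x \<cdot> pb2 \<B> q q"
  obtains t where "arr t" "src t = tgt q" "tgt t = tgt x" "t \<cdot> q = x"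
proof -
  obtain a b where q: "is_coequalizer \<B> a b q" using assms(1) by (auto simp: is_regular_epi_def)
  note qa = is_coequalizerD[OF q]
  define r where "r = pair q q a b"
  have r: "arr r" "tgt r = src (pb1 \<B> q q)" "pb1 \<B> q q \<cdot> r = a" "pb2 \<B> q q \<cdot> r = b"
    unfolding r_def using qa by simp_all
  have "x \<cdot> a = x \<cdot> b"
    using comp_reassoc[OF assms(4), of r] r assms(2,3) qa(3) by simp
  then show ?thesis using coequalizer_factor[OF q assms(2,3)] that by blast
qed

lemma kernel_pair_coequalizer:
  assumes "arr f"
  obtains e where "is_regular_epi \<B> e" "arr e" "src e = src f"
    "\<And>a b. arr a \<Longrightarrow> arr b \<Longrightarrow> src a = src b \<Longrightarrow> tgt a = src f \<Longrightarrow> tgt b = src f \<Longrightarrow>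
      f \<cdot> a = f \<cdot> b \<Longrightarrow> e \<cdot> a = e \<cdot> b"
    "\<And>x. arr x \<Longrightarrow> src x = src f \<Longrightarrow> x \<cdot> pb1 \<B> f f = x \<cdot> pb2 \<B> f f \<Longrightarrow>
      \<exists>t. arr t \<and> src t = tgt e \<and> tgt t = tgt x \<and> t \<cdot> e = x"
proof -
  obtain e where e: "is_coequalizer \<B> (pb1 \<B> f f) (pb2 \<B> f f) e"
    using kernel_pair_coequalizers[OF pb_pullback] assms by blast
  note ea = is_coequalizerD[OF e]
  have De: "src e = src f" using ea(6) assms by simp
  show ?thesis
  proof (rule that[of e])
    show "is_regular_epi \<B> e" using e unfolding is_regular_epi_def by blast
    fix a b assume ab: "arr a" "arr b" "src a = src b" "tgt a = src f" "tgt b = src f"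
      "f \<cdot> a = f \<cdot> b"
    show "e \<cdot> a = e \<cdot> b"
      using comp_reassoc[OF ea(7), of "pair f f a b"] ab assms ea(3) De by simp
  next
    fix x assume "arr x" "src x = src f" "x \<cdot> pb1 \<B> f f = x \<cdot> pb2 \<B> f f"
    then show "\<exists>t. arr t \<and> src t = tgt e \<and> tgt t = tgt x \<and> t \<cdot> e = x"
      using coequalizer_factor[OF e, of x] De by metis
  qed (use ea De in auto)
qed

lemma regular_epi_pb2:
  assumes "arr f" "arr g" "tgt f = tgt g" "is_regular_epi \<B> f"
  shows "is_regular_epi \<B> (pb2 \<B> f g)"
  using regular_epi_stable[OF pb_pullback[OF assms(1-3)] assms(4)] .

lemma cokernel_arr:
  assumes "is_cokernel \<B> f k"
  shows "arr k" "arr f" "src f = tgt k" "f \<cdot> k = zero \<B> (src k) (tgt f)"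
  using assms by (auto simp: is_cokernel_def Hom_def)

lemma cokernel_factor:
  assumes "is_cokernel \<B> f k" "arr x" "src x = src f" "x \<cdot> k = zero \<B> (src k) (tgt x)"
  obtains t where "arr t" "src t = tgt f" "tgt t = tgt x" "t \<cdot> f = x"
proof -
  have "x \<in> Hom \<B> (tgt k) (tgt x)" using assms cokernel_arr[OF assms(1)] by (simp add: Hom_def)
  then have "\<exists>t. t \<in> Hom \<B> (tgt f) (tgt x) \<and> t \<cdot> f = x"
    using assms(1,4) unfolding is_cokernel_def by blast
  then show ?thesis using that by (auto simp: Hom_def)
qed

lemma cokernel_regular_epi:
  assumes "is_cokernel \<B> f k"
  shows "is_regular_epi \<B> f"
proof -
  note fa = cokernel_arr[OF assms]
  let ?z = "zero \<B> (src k) (tgt k)"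
  have "x \<cdot> ?z = zero \<B> (src k) T" if "x \<in> Hom \<B> (tgt k) T" for x T
    using that fa(1) by (auto simp: Hom_def)
  then have "is_coequalizer \<B> k ?z f"
    using assms fa unfolding is_coequalizer_def is_cokernel_def by (auto simp: Hom_def)
  then show ?thesis unfolding is_regular_epi_def by blast
qed

section \<open>Consequences of protomodularity\<close>

lemma point_arr:
  assumes "is_point \<B> f s"
  shows "arr f" "arr s" "src s = tgt f" "tgt s = src f" "f \<cdot> s = ide (tgt f)"
  using assms by (auto simp: is_point_def Hom_def)

lemma is_pointI:
  assumes "arr f" "arr s" "src s = tgt f" "tgt s = src f" "f \<cdot> s = ide (tgt f)"
  shows "is_point \<B> f s"
  using assms by (auto simp: is_point_def Hom_def)

text \<open>The split short five lemma is protomodularity for the change of base along \<open>0 \<rightarrow> C\<close>.\<close>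

lemma split_short_five:
  assumes "is_point \<B> f s" "is_point \<B> f' s'" "tgt f' = tgt f" "is_kernel \<B> k f" "is_kernel \<B> k' f'"
    "arr h" "src h = src f" "tgt h = src f'" "f' \<cdot> h = f" "h \<cdot> s = s'"
    "is_iso \<B> b" "src b = src k" "tgt b = src k'" "h \<cdot> k = k' \<cdot> b"
  shows "is_iso \<B> h"
proof -
  obtain Z where Z: "is_zero_obj \<B> Z" "Z \<in> Obj \<B>"
    "\<And>x. arr x \<Longrightarrow> tgt x = Z \<Longrightarrow> x = zero \<B> (src x) Z" using zero_objE by metis
  have b: "arr b" using assms(11) by (auto simp: is_iso_def)
  note ka = kernel_arr[OF assms(4)] kernel_arr[OF assms(5)]
  show ?thesis
  proof (rule protomodular[OF assms(1,2)])
    show "is_pullback \<B> f (zero \<B> Z (tgt f)) k (zero \<B> (src k) Z)"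
      using kernel_pullback[OF assms(4) Z(2,3)] .
    show "is_pullback \<B> f' (zero \<B> Z (tgt f)) k' (zero \<B> (src k') Z)"
      using kernel_pullback[OF assms(5) Z(2,3)] assms(3) by simp
    show "k' \<cdot> b = h \<cdot> k" using assms by simp
    show "zero \<B> (src k') Z \<cdot> b = zero \<B> (src k) Z" using assms b Z by simp
    show "b \<in> Hom \<B> (src k) (src k')" using assms b by (simp add: Hom_def)
    show "h \<in> Hom \<B> (src f) (src f')" using assms by (simp add: Hom_def)
  qed (use assms in auto)
qed

text \<open>The equalizer of two arrows that agree on the kernel and on the section is a point with the same
  kernel, hence everything.\<close>

lemma split_joint_epi:
  assumes "is_point \<B> f s" "is_kernel \<B> k f" "arr x" "arr y" "src x = src f" "src y = src f"
    "tgt x = tgt y" "x \<cdot> k = y \<cdot> k" "x \<cdot> s = y \<cdot> s"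
  shows "x = y"
proof -
  note fa = point_arr[OF assms(1)] note ka = kernel_arr[OF assms(2)]
  obtain i where i: "arr i" "tgt i = src x" "x \<cdot> i = y \<cdot> i"
    and fac: "\<And>t. arr t \<Longrightarrow> tgt t = src x \<Longrightarrow> x \<cdot> t = y \<cdot> t \<Longrightarrow>
      \<exists>a. arr a \<and> src a = src t \<and> tgt a = src i \<and> i \<cdot> a = t"
    and mono: "\<And>a b. arr a \<Longrightarrow> arr b \<Longrightarrow> src a = src b \<Longrightarrow> tgt a = src i \<Longrightarrow> tgt b = src i \<Longrightarrow>
      i \<cdot> a = i \<cdot> b \<Longrightarrow> a = b"
    by (rule equalizer_exists[OF assms(3,4)]) (simp_all add: assms(5-7))
  have Ci: "tgt i = src f" using i assms by simp
  obtain s' where s': "arr s'" "src s' = src s" "tgt s' = src i" "i \<cdot> s' = s"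
    using fac[of s] fa assms by auto
  obtain k' where k': "arr k'" "src k' = src k" "tgt k' = src i" "i \<cdot> k' = k"
    using fac[of k] ka assms by auto
  have p: "is_point \<B> (f \<cdot> i) s'"
    using fa i Ci s' by (intro is_pointI) simp_all
  have kk: "is_kernel \<B> k' (f \<cdot> i)"
  proof (rule is_kernelI)
    fix z assume z: "arr z" "tgt z = src (f \<cdot> i)" "(f \<cdot> i) \<cdot> z = zero \<B> (src z) (tgt (f \<cdot> i))"
    then have "f \<cdot> (i \<cdot> z) = zero \<B> (src (i \<cdot> z)) (tgt f)" "arr (i \<cdot> z)" "tgt (i \<cdot> z) = src f"
      using i Ci fa by simp_all
    then obtain t where t: "arr t" "src t = src (i \<cdot> z)" "tgt t = src k" "k \<cdot> t = i \<cdot> z"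
      using kernel_factor[OF assms(2), of "i \<cdot> z"] by metis
    have "k' \<cdot> t = z"
      by (rule mono) (use comp_reassoc[OF k'(4), of t] t z i Ci k' fa in simp_all)
    then show "\<exists>t. arr t \<and> src t = src z \<and> tgt t = src k' \<and> k' \<cdot> t = z"
      using t z i Ci fa k' by (intro exI[of _ t]) simp
  next
    fix z w assume z: "arr z" "arr w" "src z = src w" "tgt z = src k'" "tgt w = src k'" "k' \<cdot> z = k' \<cdot> w"
    show "z = w"
      by (rule kernel_mono[OF assms(2)])
        (use z k' comp_reassoc[OF k'(4), of z] comp_reassoc[OF k'(4), of w] i in simp_all)
  qed (use k' i Ci fa ka in simp_all)
  have kd: "src k \<in> Obj \<B>" using ka by simp
  have "is_iso \<B> i"
    by (rule split_short_five[OF p assms(1) _ kk assms(2) _ _ _ _ _ is_iso_ide[OF kd]])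
      (use i Ci fa s' k' ka kd in simp_all)
  then obtain j where j: "arr j" "src j = tgt i" "tgt j = src i" "i \<cdot> j = ide (tgt i)"
    by (rule is_isoE)
  show ?thesis using comp_reassoc[OF i(3), of j] i Ci j assms(3-7) by simp
qed

text \<open>This and the next lemma make a split extension over any object over \<open>C\<close> out of one over \<open>C\<close>,
  without changing the kernel object, so that joint epicness is available over every base.\<close>

lemma kernel_pb2:
  assumes "is_kernel \<B> k f" "arr v" "tgt v = tgt f" "B = src k" "X = src v"
  shows "is_kernel \<B> (pair f v k (zero \<B> B X)) (pb2 \<B> f v)"
proof -
  note ka = kernel_arr[OF assms(1)]
  have o: "B \<in> Obj \<B>" "X \<in> Obj \<B>" using assms ka by simp_all
  define l where "l = pair f v k (zero \<B> B X)"
  have e: "f \<cdot> k = v \<cdot> zero \<B> B X" using ka assms by simp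
  have l: "arr l" "src l = B" "tgt l = src (pb1 \<B> f v)" "pb1 \<B> f v \<cdot> l = k"
    "pb2 \<B> f v \<cdot> l = zero \<B> B X"
    unfolding l_def using ka assms o e by simp_all
  have l': "pb1 \<B> f v \<cdot> l \<cdot> t = k \<cdot> t" "pb2 \<B> f v \<cdot> l \<cdot> t = zero \<B> (src t) X"
    if "arr t" "tgt t = B" for t
    using comp_reassoc[OF l(4), of t] comp_reassoc[OF l(5), of t] that l ka assms o by simp_all
  have "is_kernel \<B> l (pb2 \<B> f v)"
  proof (rule is_kernelI)
    fix x assume x: "arr x" "tgt x = src (pb2 \<B> f v)"
      "pb2 \<B> f v \<cdot> x = zero \<B> (src x) (tgt (pb2 \<B> f v))"
    have "f \<cdot> (pb1 \<B> f v \<cdot> x) = zero \<B> (src (pb1 \<B> f v \<cdot> x)) (tgt f)"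
      using comp_reassoc[OF pb_commute[of f v], of x] x ka assms by simp
    then obtain t where t: "arr t" "src t = src (pb1 \<B> f v \<cdot> x)" "tgt t = src k" "k \<cdot> t = pb1 \<B> f v \<cdot> x"
      using kernel_factor[OF assms(1), of "pb1 \<B> f v \<cdot> x"] x ka assms(2,3)
      by (metis arr_comp(1,3) pb_arr(1,3,5))
    have "l \<cdot> t = x" by (rule pb_ext[of f v]) (use x t l l' ka assms in simp_all)
    then show "\<exists>t. arr t \<and> src t = src x \<and> tgt t = src l \<and> l \<cdot> t = x"
      using t x l ka assms by (intro exI[of _ t]) simp
  next
    fix x y assume x: "arr x" "arr y" "src x = src y" "tgt x = src l" "tgt y = src l" "l \<cdot> x = l \<cdot> y"
    show "x = y" by (rule kernel_mono[OF assms(1)]) (use x l l'(1)[of x] l'(1)[of y] assms in simp_all)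
  qed (use l ka assms in simp_all)
  then show ?thesis by (simp add: l_def)
qed

lemma point_pb2:
  assumes "is_point \<B> f s" "arr v" "tgt v = tgt f" "X = src v"
  shows "is_point \<B> (pb2 \<B> f v) (pair f v (s \<cdot> v) (ide X))"
proof -
  note fa = point_arr[OF assms(1)]
  have "f \<cdot> s \<cdot> v = v" using comp_reassoc[OF fa(5), of v] fa assms by simp
  then show ?thesis using fa assms by (intro is_pointI) simp_all
qed

text \<open>The kernel pair of \<open>q\<close> is a split extension with kernel \<open>\<langle>j, 0\<rangle>\<close> and section the diagonal. If
  \<open>x \<cdot> j = 0\<close>, then the composites of \<open>x\<close> with the two projections agree on both, so \<open>x\<close> descends
  along \<open>q\<close>.\<close>

lemma regular_epi_cokernel:
  assumes "is_regular_epi \<B> q" "is_kernel \<B> j q"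
  shows "is_cokernel \<B> q j"
  unfolding is_cokernel_def
proof (intro conjI allI impI)
  note ka = kernel_arr[OF assms(2)]
  show "arr j" "q \<in> Hom \<B> (tgt j) (tgt q)" "q \<cdot> j = zero \<B> (src j) (tgt q)"
    using ka by (auto simp: Hom_def)
  fix T x assume "x \<in> Hom \<B> (tgt j) T \<and> x \<cdot> j = zero \<B> (src j) T"
  then have x: "arr x" "src x = src q" "tgt x = T" "x \<cdot> j = zero \<B> (src j) T"
    using ka by (auto simp: Hom_def)
  have p: "is_point \<B> (pb2 \<B> q q) (pair q q (ide (src q)) (ide (src q)))"
    using ka by (intro is_pointI) simp_all
  have jz: "q \<cdot> j = q \<cdot> zero \<B> (src j) (src q)" using ka by simp
  have "x \<cdot> pb1 \<B> q q = x \<cdot> pb2 \<B> q q"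
    by (rule split_joint_epi[OF p kernel_pb2[OF assms(2) ka(2) refl refl refl]])
      (use x ka jz in simp_all)
  then obtain t where t: "arr t" "src t = tgt q" "tgt t = T" "t \<cdot> q = x"
    using regular_epi_descent[OF assms(1), of x] x by metis
  show "\<exists>!t. t \<in> Hom \<B> (tgt q) T \<and> t \<cdot> q = x"
  proof (rule ex1I[of _ t])
    fix u assume "u \<in> Hom \<B> (tgt q) T \<and> u \<cdot> q = x"
    then show "u = t" using t regular_epi_epi[OF assms(1), of u t] by (simp add: Hom_def)
  qed (use t in \<open>simp add: Hom_def\<close>)
qed

section \<open>Internal actions and split extensions\<close>

lemma inl_inr_coproduct:
  assumes "X \<in> Obj \<B>" "Y \<in> Obj \<B>"
  shows "is_coproduct \<B> X Y (inl \<B> X Y) (inr \<B> X Y)"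
proof -
  have "\<exists>ij. case ij of (i, j) \<Rightarrow> is_coproduct \<B> X Y i j" using coproducts[OF assms] by auto
  then have "case (SOME (i, j). is_coproduct \<B> X Y i j) of (i, j) \<Rightarrow> is_coproduct \<B> X Y i j"
    by (rule someI_ex)
  then show ?thesis unfolding inl_def inr_def by (simp add: case_prod_beta)
qed

lemma inl_inr_arr [simp]:
  assumes "X \<in> Obj \<B>" "Y \<in> Obj \<B>"
  shows "arr (inl \<B> X Y)" "arr (inr \<B> X Y)" "src (inl \<B> X Y) = X" "src (inr \<B> X Y) = Y"
    "tgt (inr \<B> X Y) = tgt (inl \<B> X Y)"
  using inl_inr_coproduct[OF assms] by (auto simp: is_coproduct_def Hom_def)

lemma copair_ext:
  assumes "X \<in> Obj \<B>" "Y \<in> Obj \<B>" "arr x" "arr y" "src x = tgt (inl \<B> X Y)"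
    "src y = tgt (inl \<B> X Y)" "x \<cdot> inl \<B> X Y = y \<cdot> inl \<B> X Y" "x \<cdot> inr \<B> X Y = y \<cdot> inr \<B> X Y"
  shows "x = y"
proof -
  have C: "tgt y = tgt x"
    using arr_comp(3)[of "inl \<B> X Y" x] arr_comp(3)[of "inl \<B> X Y" y] assms by simp
  have "x \<cdot> inl \<B> X Y \<in> Hom \<B> X (tgt x)" "x \<cdot> inr \<B> X Y \<in> Hom \<B> Y (tgt x)"
    using assms(1-5) by (simp_all add: Hom_def)
  then have "\<exists>!t. t \<in> Hom \<B> (tgt (inl \<B> X Y)) (tgt x) \<and> t \<cdot> inl \<B> X Y = x \<cdot> inl \<B> X Y \<and>
      t \<cdot> inr \<B> X Y = x \<cdot> inr \<B> X Y"
    using inl_inr_coproduct[OF assms(1,2)] unfolding is_coproduct_def by blast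
  moreover have "x \<in> Hom \<B> (tgt (inl \<B> X Y)) (tgt x)" "y \<in> Hom \<B> (tgt (inl \<B> X Y)) (tgt x)"
    using assms(3-6) C by (simp_all add: Hom_def)
  ultimately show ?thesis using assms(7,8) by metis
qed

lemma copair_all:
  assumes "arr x" "arr y" "tgt y = tgt x" "src x = X" "src y = Y"
  shows "copair \<B> x y \<in> Hom \<B> (tgt (inl \<B> X Y)) (tgt x) \<and>
    copair \<B> x y \<cdot> inl \<B> X Y = x \<and> copair \<B> x y \<cdot> inr \<B> X Y = y"
proof -
  have o: "X \<in> Obj \<B>" "Y \<in> Obj \<B>" using assms by auto
  have "x \<in> Hom \<B> X (tgt x)" "y \<in> Hom \<B> Y (tgt x)" using assms by (simp_all add: Hom_def)
  then have "\<exists>!t. t \<in> Hom \<B> (tgt (inl \<B> X Y)) (tgt x) \<and> t \<cdot> inl \<B> X Y = x \<and> t \<cdot> inr \<B> X Y = y"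
    using inl_inr_coproduct[OF o] unfolding is_coproduct_def by blast
  then show ?thesis unfolding copair_def assms(4,5) by (rule theI')
qed

lemma copair [simp]:
  assumes "arr x" "arr y" "tgt y = tgt x"
  shows "arr (copair \<B> x y)" "src (copair \<B> x y) = tgt (inl \<B> (src x) (src y))"
    "tgt (copair \<B> x y) = tgt x"
    "src x = X \<Longrightarrow> src y = Y \<Longrightarrow> copair \<B> x y \<cdot> inl \<B> X Y = x"
    "src x = X \<Longrightarrow> src y = Y \<Longrightarrow> copair \<B> x y \<cdot> inr \<B> X Y = y"
  using copair_all[OF assms] by (auto simp: Hom_def)

lemma copair_reassoc [simp]:
  assumes "arr x" "arr y" "tgt y = tgt x" "src x = X" "src y = Y" "arr t"
  shows "tgt t = X \<Longrightarrow> copair \<B> x y \<cdot> inl \<B> X Y \<cdot> t = x \<cdot> t"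
    "tgt t = Y \<Longrightarrow> copair \<B> x y \<cdot> inr \<B> X Y \<cdot> t = y \<cdot> t"
  using comp_reassoc[OF copair(4)[OF assms(1-5)]] comp_reassoc[OF copair(5)[OF assms(1-5)]] assms
  by auto

lemma comp_copair:
  assumes "arr x" "arr y" "tgt y = tgt x" "arr z" "src z = tgt x"
  shows "z \<cdot> copair \<B> x y = copair \<B> (z \<cdot> x) (z \<cdot> y)"
  by (rule copair_ext[of "src x" "src y"]) (use assms in simp_all)

lemma comp_copair_reassoc:
  assumes "arr x" "arr y" "tgt y = tgt x" "arr z" "src z = tgt x"
    "arr t" "tgt t = tgt (inl \<B> (src x) (src y))"
  shows "z \<cdot> copair \<B> x y \<cdot> t = copair \<B> (z \<cdot> x) (z \<cdot> y) \<cdot> t"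
  using comp_reassoc[OF comp_copair[OF assms(1-5)], of t] assms by simp

lemma kappa_kernel:
  assumes "C \<in> Obj \<B>" "B \<in> Obj \<B>"
  shows "is_kernel \<B> (kappa \<B> C B) (copair \<B> (ide C) (zero \<B> B C))"
  unfolding kappa_def by (rule someI_ex, rule kernel_exists) (use assms in simp)

lemma kappa_arr [simp]:
  assumes "C \<in> Obj \<B>" "B \<in> Obj \<B>"
  shows "arr (kappa \<B> C B)" "src (kappa \<B> C B) = flat \<B> C B" "flat \<B> C B \<in> Obj \<B>"
    "tgt (kappa \<B> C B) = tgt (inl \<B> C B)"
    "copair \<B> (ide C) (zero \<B> B C) \<cdot> kappa \<B> C B = zero \<B> (flat \<B> C B) C"
proof -
  note k = kernel_arr[OF kappa_kernel[OF assms]]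
  show 1: "arr (kappa \<B> C B)" and 2: "src (kappa \<B> C B) = flat \<B> C B" using k by (auto simp: flat_def)
  then show "flat \<B> C B \<in> Obj \<B>" using Dom_Obj[OF 1] by simp
  show "tgt (kappa \<B> C B) = tgt (inl \<B> C B)"
    "copair \<B> (ide C) (zero \<B> B C) \<cdot> kappa \<B> C B = zero \<B> (flat \<B> C B) C"
    using k assms 2 by simp_all
qed

lemma kappa_mono:
  assumes "C \<in> Obj \<B>" "B \<in> Obj \<B>" "arr x" "arr y" "src x = src y"
    "tgt x = flat \<B> C B" "tgt y = flat \<B> C B" "kappa \<B> C B \<cdot> x = kappa \<B> C B \<cdot> y"
  shows "x = y"
  by (rule kernel_mono[OF kappa_kernel[OF assms(1,2)]]) (use assms in simp_all)

lemma kappa_factor: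
  assumes "C \<in> Obj \<B>" "B \<in> Obj \<B>" "arr x" "tgt x = tgt (inl \<B> C B)"
    "copair \<B> (ide C) (zero \<B> B C) \<cdot> x = zero \<B> (src x) C"
  shows "(THE t. t \<in> Hom \<B> (src x) (flat \<B> C B) \<and> kappa \<B> C B \<cdot> t = x) \<in> Hom \<B> (src x) (flat \<B> C B)"
    "kappa \<B> C B \<cdot> (THE t. t \<in> Hom \<B> (src x) (flat \<B> C B) \<and> kappa \<B> C B \<cdot> t = x) = x"
proof -
  have "\<exists>!t. t \<in> Hom \<B> (src x) (flat \<B> C B) \<and> kappa \<B> C B \<cdot> t = x"
  proof -
    have "x \<in> Hom \<B> (src x) (src (copair \<B> (ide C) (zero \<B> B C)))"
      "tgt (copair \<B> (ide C) (zero \<B> B C)) = C"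
      using assms by (simp_all add: Hom_def)
    then show ?thesis
      using kappa_kernel[OF assms(1,2)] assms(5) unfolding is_kernel_def kappa_arr(2)[OF assms(1,2)]
      by auto
  qed
  from theI'[OF this]
  show "(THE t. t \<in> Hom \<B> (src x) (flat \<B> C B) \<and> kappa \<B> C B \<cdot> t = x) \<in> Hom \<B> (src x) (flat \<B> C B)"
    "kappa \<B> C B \<cdot> (THE t. t \<in> Hom \<B> (src x) (flat \<B> C B) \<and> kappa \<B> C B \<cdot> t = x) = x" by auto
qed

lemma flat_map_all:
  assumes "arr \<phi>\<^sub>0" "arr \<phi>\<^sub>1" "src \<phi>\<^sub>0 = C" "src \<phi>\<^sub>1 = B" "tgt \<phi>\<^sub>0 = C'" "tgt \<phi>\<^sub>1 = B'"
  shows "flat_map \<B> \<phi>\<^sub>0 \<phi>\<^sub>1 \<in> Hom \<B> (flat \<B> C B) (flat \<B> C' B') \<and>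
    kappa \<B> C' B' \<cdot> flat_map \<B> \<phi>\<^sub>0 \<phi>\<^sub>1 =
      copair \<B> (inl \<B> C' B' \<cdot> \<phi>\<^sub>0) (inr \<B> C' B' \<cdot> \<phi>\<^sub>1) \<cdot> kappa \<B> C B"
proof -
  have o: "C \<in> Obj \<B>" "B \<in> Obj \<B>" "C' \<in> Obj \<B>" "B' \<in> Obj \<B>"
    using assms by auto
  let ?m = "copair \<B> (inl \<B> C' B' \<cdot> \<phi>\<^sub>0) (inr \<B> C' B' \<cdot> \<phi>\<^sub>1) \<cdot> kappa \<B> C B"
  have m: "arr ?m" "tgt ?m = tgt (inl \<B> C' B')" "src ?m = flat \<B> C B"
    using o assms by simp_all
  have e: "copair \<B> \<phi>\<^sub>0 (zero \<B> B C') = \<phi>\<^sub>0 \<cdot> copair \<B> (ide C) (zero \<B> B C)"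
    using o assms by (simp add: comp_copair)
  have "copair \<B> (ide C') (zero \<B> B' C') \<cdot> ?m = zero \<B> (src ?m) C'"
    using o assms by (simp add: comp_copair_reassoc e)
  note t = kappa_factor[OF o(3,4) m(1,2) this]
  then show ?thesis unfolding flat_map_def assms(3-6) m(3) by auto
qed

lemma flat_map [simp]:
  assumes "arr \<phi>\<^sub>0" "arr \<phi>\<^sub>1"
  shows "arr (flat_map \<B> \<phi>\<^sub>0 \<phi>\<^sub>1)" "src (flat_map \<B> \<phi>\<^sub>0 \<phi>\<^sub>1) = flat \<B> (src \<phi>\<^sub>0) (src \<phi>\<^sub>1)"
    "tgt (flat_map \<B> \<phi>\<^sub>0 \<phi>\<^sub>1) = flat \<B> (tgt \<phi>\<^sub>0) (tgt \<phi>\<^sub>1)"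
    "tgt \<phi>\<^sub>0 = C \<Longrightarrow> tgt \<phi>\<^sub>1 = B \<Longrightarrow> kappa \<B> C B \<cdot> flat_map \<B> \<phi>\<^sub>0 \<phi>\<^sub>1 =
      copair \<B> (inl \<B> C B \<cdot> \<phi>\<^sub>0) (inr \<B> C B \<cdot> \<phi>\<^sub>1) \<cdot> kappa \<B> (src \<phi>\<^sub>0) (src \<phi>\<^sub>1)"
  using flat_map_all[OF assms refl refl refl refl] by (auto simp: Hom_def)

text \<open>Restriction of an arrow out of \<open>C + B\<close> along \<open>\<phi>\<^sub>0 \<flat> \<phi>\<^sub>1\<close>, on which all computations with
  actions rest.\<close>

lemma copair_kappa_flat_map:
  assumes "arr \<phi>\<^sub>0" "arr \<phi>\<^sub>1" "arr x" "arr y" "tgt y = tgt x"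
    "src x = tgt \<phi>\<^sub>0" "src y = tgt \<phi>\<^sub>1" "C = tgt \<phi>\<^sub>0" "B = tgt \<phi>\<^sub>1"
  shows "copair \<B> x y \<cdot> kappa \<B> C B \<cdot> flat_map \<B> \<phi>\<^sub>0 \<phi>\<^sub>1 =
      copair \<B> (x \<cdot> \<phi>\<^sub>0) (y \<cdot> \<phi>\<^sub>1) \<cdot> kappa \<B> (src \<phi>\<^sub>0) (src \<phi>\<^sub>1)"
  using assms by (simp add: comp_copair_reassoc)

lemma flat_map_comp:
  assumes "arr \<phi>\<^sub>0" "arr \<phi>\<^sub>1" "arr \<psi>\<^sub>0" "arr \<psi>\<^sub>1" "src \<psi>\<^sub>0 = tgt \<phi>\<^sub>0" "src \<psi>\<^sub>1 = tgt \<phi>\<^sub>1"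
  shows "flat_map \<B> \<psi>\<^sub>0 \<psi>\<^sub>1 \<cdot> flat_map \<B> \<phi>\<^sub>0 \<phi>\<^sub>1 = flat_map \<B> (\<psi>\<^sub>0 \<cdot> \<phi>\<^sub>0) (\<psi>\<^sub>1 \<cdot> \<phi>\<^sub>1)"
proof (rule kappa_mono[of "tgt \<psi>\<^sub>0" "tgt \<psi>\<^sub>1"])
  show "kappa \<B> (tgt \<psi>\<^sub>0) (tgt \<psi>\<^sub>1) \<cdot> flat_map \<B> \<psi>\<^sub>0 \<psi>\<^sub>1 \<cdot> flat_map \<B> \<phi>\<^sub>0 \<phi>\<^sub>1 =
      kappa \<B> (tgt \<psi>\<^sub>0) (tgt \<psi>\<^sub>1) \<cdot> flat_map \<B> (\<psi>\<^sub>0 \<cdot> \<phi>\<^sub>0) (\<psi>\<^sub>1 \<cdot> \<phi>\<^sub>1)"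
    using assms comp_reassoc[OF flat_map(4)[OF assms(3,4) refl refl], of "flat_map \<B> \<phi>\<^sub>0 \<phi>\<^sub>1"]
    by (simp add: copair_kappa_flat_map del: flat_map(4)) (simp add: flat_map(4))
qed (use assms in simp_all)

lemma flat_unit [simp]:
  assumes "C \<in> Obj \<B>" "B \<in> Obj \<B>"
  shows "arr (flat_unit \<B> C B)" "src (flat_unit \<B> C B) = B" "tgt (flat_unit \<B> C B) = flat \<B> C B"
    "kappa \<B> C B \<cdot> flat_unit \<B> C B = inr \<B> C B"
  using kappa_factor[OF assms, of "inr \<B> C B"] assms by (auto simp: flat_unit_def Hom_def)

lemma flat_mult [simp]:
  assumes "C \<in> Obj \<B>" "B \<in> Obj \<B>"
  shows "arr (flat_mult \<B> C B)" "src (flat_mult \<B> C B) = flat \<B> C (flat \<B> C B)"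
    "tgt (flat_mult \<B> C B) = flat \<B> C B"
    "kappa \<B> C B \<cdot> flat_mult \<B> C B =
      copair \<B> (inl \<B> C B) (kappa \<B> C B) \<cdot> kappa \<B> C (flat \<B> C B)"
  using kappa_factor[OF assms, of "copair \<B> (inl \<B> C B) (kappa \<B> C B) \<cdot> kappa \<B> C (flat \<B> C B)"] assms
  by (auto simp: flat_mult_def Hom_def comp_copair_reassoc)

lemma associatedD:
  assumes "associated_split_extension \<B> C B \<xi> f k s"
  shows "is_point \<B> f s" "is_kernel \<B> k f" "tgt f = C" "src k = B" "k \<cdot> \<xi> = copair \<B> s k \<cdot> kappa \<B> C B"
    "C \<in> Obj \<B>" "B \<in> Obj \<B>" "arr f" "arr k" "arr s" "tgt k = src f" "tgt s = src f"
    "src s = C" "f \<cdot> s = ide C" "f \<cdot> k = zero \<B> B C"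
  using assms point_arr[of f s] kernel_arr[of k f] by (auto simp: associated_split_extension_def)

lemma internal_actionD:
  assumes "internal_action \<B> C B \<xi>"
  shows "C \<in> Obj \<B>" "B \<in> Obj \<B>" "arr \<xi>" "src \<xi> = flat \<B> C B" "tgt \<xi> = B"
  using assms by (auto simp: internal_action_def Hom_def)

text \<open>As \<open>k\<close> is a monomorphism, the axioms of an algebra for the monad \<open>C \<flat> (-)\<close> may be checked after
  composing with it, where they compare restrictions of \<open>[s, k\<close>].\<close>

lemma associated_internal_action:
  assumes "associated_split_extension \<B> C B \<xi> f k s" "arr \<xi>" "src \<xi> = flat \<B> C B" "tgt \<xi> = B"
  shows "internal_action \<B> C B \<xi>"
  unfolding internal_action_def
proof (intro conjI)
  note a = associatedD[OF assms(1)]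
  have r: "k \<cdot> \<xi> \<cdot> t = copair \<B> s k \<cdot> kappa \<B> C B \<cdot> t" if "arr t" "tgt t = flat \<B> C B" for t
    using comp_reassoc[OF a(5), of t] that a assms by simp
  show "\<xi> \<in> Hom \<B> (flat \<B> C B) B" using assms by (simp add: Hom_def)
  show "\<xi> \<cdot> flat_unit \<B> C B = ide B"
    by (rule kernel_mono[OF a(2)]) (use a assms r[of "flat_unit \<B> C B"] in simp_all)
  have "k \<cdot> \<xi> \<cdot> flat_mult \<B> C B = copair \<B> s (k \<cdot> \<xi>) \<cdot> kappa \<B> C (flat \<B> C B)"
    using a assms by (simp add: r comp_copair_reassoc)
  moreover have "k \<cdot> \<xi> \<cdot> flat_map \<B> (ide C) \<xi> = copair \<B> s (k \<cdot> \<xi>) \<cdot> kappa \<B> C (flat \<B> C B)"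
    using a(1-4,6-) assms by (subst r) (simp_all add: copair_kappa_flat_map del: flat_map(4))
  ultimately show "\<xi> \<cdot> flat_mult \<B> C B = \<xi> \<cdot> flat_map \<B> (ide C) \<xi>"
    by (intro kernel_mono[OF a(2), of "\<xi> \<cdot> flat_mult \<B> C B"]) (use a(1-4,6-) assms in simp_all)
qed (use associatedD[OF assms(1)] in auto)

text \<open>A split extension is generated by its section and its kernel, subject to the relations given
  by the action. To map it to another point \<open>X\<close> over \<open>C\<close>, take the regular image \<open>I\<close> of \<open>C + B\<close> in
  \<open>S \<times>\<^sub>C X\<close>. On kernels over \<open>C\<close>, \<open>C \<flat> B \<rightarrow> S \<times>\<^sub>C X\<close> factors through \<open>\<xi>\<close>, so that \<open>I \<rightarrow> S\<close> is an
  isomorphism by the split short five lemma, and \<open>I\<close> is the graph of the required arrow.\<close>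

lemma split_extension_universal:
  assumes "associated_split_extension \<B> C B \<xi> f k s" "arr \<xi>" "src \<xi> = flat \<B> C B" "tgt \<xi> = B"
    and "is_point \<B> g a" "tgt g = C" "arr b" "src b = B" "tgt b = src g" "g \<cdot> b = zero \<B> B C"
    and rel: "copair \<B> a b \<cdot> kappa \<B> C B = b \<cdot> \<xi>"
  obtains h where "arr h" "src h = src f" "tgt h = src g" "g \<cdot> h = f" "h \<cdot> s = a" "h \<cdot> k = b"
proof -
  note sa = associatedD[OF assms(1)] note ga = point_arr[OF assms(5)]
  have fga: "f \<cdot> s = g \<cdot> a" "f \<cdot> k = g \<cdot> b" using sa ga assms by simp_all
  \<comment> \<open>\<open>e : C + B \<rightarrow> I\<close> is the regular image of \<open>\<rho>\<close>, with projections \<open>p\<close> and \<open>r\<close> from \<open>I\<close> to \<open>S\<close> and \<open>X\<close>\<close>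
  define \<rho> where "\<rho> = copair \<B> (pair f g s a) (pair f g k b)"
  have \<rho>: "arr \<rho>" "src \<rho> = tgt (inl \<B> C B)" "tgt \<rho> = src (pb1 \<B> f g)"
    "pb1 \<B> f g \<cdot> \<rho> = copair \<B> s k" "pb2 \<B> f g \<cdot> \<rho> = copair \<B> a b"
    unfolding \<rho>_def using sa(3,4,6-13) ga fga assms by (simp_all add: comp_copair)
  obtain e where e: "is_regular_epi \<B> e" "arr e" "src e = src \<rho>"
    and e_eq: "\<And>a b. arr a \<Longrightarrow> arr b \<Longrightarrow> src a = src b \<Longrightarrow> tgt a = src \<rho> \<Longrightarrow> tgt b = src \<rho> \<Longrightarrow>
      \<rho> \<cdot> a = \<rho> \<cdot> b \<Longrightarrow> e \<cdot> a = e \<cdot> b"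
    and e_fac: "\<And>x. arr x \<Longrightarrow> src x = src \<rho> \<Longrightarrow> x \<cdot> pb1 \<B> \<rho> \<rho> = x \<cdot> pb2 \<B> \<rho> \<rho> \<Longrightarrow>
      \<exists>t. arr t \<and> src t = tgt e \<and> tgt t = tgt x \<and> t \<cdot> e = x"
    by (rule kernel_pair_coequalizer[OF \<rho>(1)]) blast
  obtain i where i: "arr i" "src i = tgt e" "tgt i = tgt \<rho>" "i \<cdot> e = \<rho>"
    using e_fac[OF \<rho>(1)] pb_commute[OF \<rho>(1,1)] by auto
  define p r where "p = pb1 \<B> f g \<cdot> i" and "r = pb2 \<B> f g \<cdot> i"
  have fg: "arr f" "arr g" "tgt f = tgt g" using sa ga assms by simp_all
  have p: "arr p" "src p = tgt e" "tgt p = src f" "p \<cdot> e = copair \<B> s k"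
    unfolding p_def using i e fg \<rho> by simp_all
  have r: "arr r" "src r = tgt e" "tgt r = src g" "r \<cdot> e = copair \<B> a b"
    unfolding r_def using i e fg \<rho> by simp_all
  have fp: "f \<cdot> p = g \<cdot> r"
    unfolding p_def r_def using comp_reassoc[OF pb_commute[OF fg], of i] i fg \<rho> by simp
  have p': "p \<cdot> e \<cdot> t = copair \<B> s k \<cdot> t" "r \<cdot> e \<cdot> t = copair \<B> a b \<cdot> t"
    if "arr t" "tgt t = tgt (inl \<B> C B)" for t
    using comp_reassoc[OF p(4), of t] comp_reassoc[OF r(4), of t] p r e \<rho> that by simp_all
  define w where "w = f \<cdot> p"
  have w: "arr w" "src w = tgt e" "tgt w = C" "w \<cdot> e = copair \<B> (ide C) (zero \<B> B C)"
    unfolding w_def using p sa(3,4,6-15) e \<rho> by (simp_all add: comp_copair)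
  have w': "w \<cdot> e \<cdot> t = copair \<B> (ide C) (zero \<B> B C) \<cdot> t"
    if "arr t" "tgt t = tgt (inl \<B> C B)" for t
    using comp_reassoc[OF w(4), of t] w e \<rho> that by simp
  have wp: "is_point \<B> w (e \<cdot> inl \<B> C B)"
    using w w' e \<rho> sa by (intro is_pointI) simp_all
  \<comment> \<open>\<open>l : K \<rightarrow> I\<close> is the kernel of the projection \<open>w\<close> to \<open>C\<close>; \<open>d : C \<flat> B \<rightarrow> K\<close> and \<open>c : K \<rightarrow> B\<close> are the
    restrictions of \<open>e\<close> and \<open>p\<close>; as a pullback of \<open>e\<close>, \<open>d\<close> is again a regular epimorphism\<close>
  obtain l where l: "is_kernel \<B> l w" using kernel_exists[OF w(1)] by blast
  note la = kernel_arr[OF l]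
  let ?\<kappa> = "kappa \<B> C B" and ?\<eta> = "flat_unit \<B> C B"
  have "w \<cdot> e \<cdot> ?\<kappa> = zero \<B> (src (e \<cdot> ?\<kappa>)) (tgt w)" using w' w e \<rho> sa by simp
  then obtain d where d: "arr d" "src d = src (e \<cdot> ?\<kappa>)" "tgt d = src l" "l \<cdot> d = e \<cdot> ?\<kappa>"
    by (rule kernel_factor[OF l, rotated 2]) (use w e \<rho> sa in simp_all)
  have Dd: "src d = flat \<B> C B" using d e \<rho> sa by simp
  have d': "l \<cdot> d \<cdot> t = e \<cdot> ?\<kappa> \<cdot> t" if "arr t" "tgt t = flat \<B> C B" for t
    using comp_reassoc[OF d(4), of t] d Dd la that e \<rho> sa(6-7) by simp
  have "is_pullback \<B> e l ?\<kappa> d"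
  proof (rule is_pullbackI)
    fix x y assume x: "arr x" "arr y" "src x = src y" "tgt x = src e" "tgt y = src l"
      "e \<cdot> x = l \<cdot> y"
    have "w \<cdot> l \<cdot> y = zero \<B> (src y) C" using comp_reassoc[OF la(4), of y] x la w sa(6) by simp
    then have "copair \<B> (ide C) (zero \<B> B C) \<cdot> x = zero \<B> (src x) (tgt (copair \<B> (ide C) (zero \<B> B C)))"
      using w'[of x] x e \<rho> sa(6,7) by simp
    then obtain t where t: "arr t" "src t = src x" "tgt t = src ?\<kappa>" "?\<kappa> \<cdot> t = x"
      by (rule kernel_factor[OF kappa_kernel[OF sa(6,7)], rotated 2]) (use x e \<rho> sa(6,7) in simp_all)
    have "d \<cdot> t = y"
      by (rule kernel_mono[OF l]) (use t x d Dd d' sa(6,7) in simp_all)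
    then show "\<exists>t. arr t \<and> src t = src y \<and> tgt t = src ?\<kappa> \<and> ?\<kappa> \<cdot> t = x \<and> d \<cdot> t = y"
      using t x by (intro exI[of _ t]) simp
  next
    fix x y assume "arr x" "arr y" "src x = src y" "tgt x = src ?\<kappa>" "tgt y = src ?\<kappa>"
      "?\<kappa> \<cdot> x = ?\<kappa> \<cdot> y"
    then show "x = y" using kappa_mono[OF sa(6,7), of x y] sa(6,7) by simp
  qed (use e \<rho> la w sa(6,7) d Dd in simp_all)
  then have d_epi: "is_regular_epi \<B> d" using regular_epi_stable e(1) by blast
  have "f \<cdot> p \<cdot> l = zero \<B> (src (p \<cdot> l)) (tgt f)"
    using la(4) la p w sa(3,8) unfolding w_def by simp
  then obtain c where c: "arr c" "src c = src (p \<cdot> l)" "tgt c = src k" "k \<cdot> c = p \<cdot> l"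
    by (rule kernel_factor[OF sa(2), rotated 2]) (use p la w in simp_all)
  have c: "arr c" "src c = src l" "tgt c = B" "k \<cdot> c = p \<cdot> l"
    using c p la w sa by simp_all
  have c': "k \<cdot> c \<cdot> t = p \<cdot> l \<cdot> t" if "arr t" "tgt t = src l" for t
    using comp_reassoc[OF c(4), of t] c sa(4,9) p la w that by simp
  have cd: "c \<cdot> d = \<xi>"
    by (rule kernel_mono[OF sa(2)]) (use c c' d Dd assms(2-4) sa p' e \<rho> in simp_all)
  have cd\<eta>: "c \<cdot> d \<cdot> ?\<eta> = ide B"
    by (rule kernel_mono[OF sa(2)]) (use c c' d Dd d' sa p' e \<rho> in simp_all)
  \<comment> \<open>by the relation imposed by the action, \<open>\<rho>\<close>, hence \<open>e\<close>, does not distinguish \<open>inr \<cdot> \<xi>\<close> from \<open>\<kappa>\<close>;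
    so \<open>d\<close> factors through \<open>\<xi>\<close>, and \<open>c\<close> is invertible\<close>
  have "e \<cdot> inr \<B> C B \<cdot> \<xi> = e \<cdot> ?\<kappa>"
  proof (rule e_eq)
    have "pb1 \<B> f g \<cdot> \<rho> \<cdot> t = copair \<B> s k \<cdot> t" "pb2 \<B> f g \<cdot> \<rho> \<cdot> t = copair \<B> a b \<cdot> t"
      if "arr t" "tgt t = tgt (inl \<B> C B)" for t
      using comp_reassoc[OF \<rho>(4), of t] comp_reassoc[OF \<rho>(5), of t] \<rho>(1-3) fg that by simp_all
    then show "\<rho> \<cdot> inr \<B> C B \<cdot> \<xi> = \<rho> \<cdot> ?\<kappa>"
      by (intro pb_ext[OF fg, of "\<rho> \<cdot> inr \<B> C B \<cdot> \<xi>"]) (use \<rho>(1-3) sa assms ga in simp_all)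
  qed (use \<rho>(1-3) sa assms in simp_all)
  then have "d \<cdot> ?\<eta> \<cdot> \<xi> = d"
    by (intro kernel_mono[OF l, of "d \<cdot> ?\<eta> \<cdot> \<xi>"])
      (use d Dd d' sa(6,7) assms comp_reassoc[OF flat_unit(4)[OF sa(6,7)], of \<xi>] in simp_all)
  then have "d \<cdot> ?\<eta> \<cdot> c = ide (src l)"
    by (intro regular_epi_epi[OF d_epi, of "d \<cdot> ?\<eta> \<cdot> c"]) (use d Dd sa(6,7) c cd la in simp_all)
  then have "is_iso \<B> c"
    using cd\<eta> c d Dd sa(6,7) by (intro is_isoI[of c "d \<cdot> ?\<eta>"]) simp_all
  then have "is_iso \<B> p"
    by (intro split_short_five[OF wp sa(1) _ l sa(2), of p c])
      (use w w_def p p' c sa la e \<rho> in simp_all)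
  then obtain j where j: "arr j" "src j = tgt p" "tgt j = src p" "j \<cdot> p = ide (src p)"
      "p \<cdot> j = ide (tgt p)"
    by (rule is_isoE)
  have j': "j \<cdot> p \<cdot> t = t" if "arr t" "tgt t = src p" for t
    using comp_reassoc[OF j(4), of t] j p that by simp
  have js: "j \<cdot> s = e \<cdot> inl \<B> C B" "j \<cdot> k = e \<cdot> inr \<B> C B"
    using j'[of "e \<cdot> inl \<B> C B"] j'[of "e \<cdot> inr \<B> C B"] p' p e \<rho> sa(3,4,6-13) by simp_all
  show ?thesis
  proof (rule that[of "r \<cdot> j"])
    show "g \<cdot> r \<cdot> j = f" using comp_reassoc[OF fp[symmetric], of j] j p r ga sa(8) by simp
    show "(r \<cdot> j) \<cdot> s = a" "(r \<cdot> j) \<cdot> k = b"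
      using js j p r p' e \<rho> sa ga assms by simp_all
  qed (use r j p in simp_all)
qed

end

section \<open>Change of base for internal structures\<close>

lemma comm_group_transport:
  assumes "comm_group G" "inj_on h A" "h ` A = carrier G" "e \<in> A" "h e = \<one>\<^bsub>G\<^esub>"
    and cl: "\<And>x y. x \<in> A \<Longrightarrow> y \<in> A \<Longrightarrow> m x y \<in> A"
    and hom: "\<And>x y. x \<in> A \<Longrightarrow> y \<in> A \<Longrightarrow> h (m x y) = h x \<otimes>\<^bsub>G\<^esub> h y"
  shows "comm_group \<lparr>carrier = A, mult = m, one = e\<rparr>"
proof -
  interpret G: comm_group G by fact
  have hA: "h x \<in> carrier G" if "x \<in> A" for x using assms(3) that by blast
  have inj: "x = y" if "h x = h y" "x \<in> A" "y \<in> A" for x y using assms(2) that by (auto dest: inj_onD)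
  show ?thesis
  proof (rule comm_groupI, simp_all add: cl assms(4))
    show "m (m x y) z = m x (m y z)" if "x \<in> A" "y \<in> A" "z \<in> A" for x y z
      by (rule inj) (use that hA in \<open>simp_all add: cl hom G.m_assoc\<close>)
    show "m x y = m y x" if "x \<in> A" "y \<in> A" for x y
      by (rule inj) (use that hA in \<open>simp_all add: cl hom G.m_comm\<close>)
    show "m e x = x" if "x \<in> A" for x
      by (rule inj) (use that hA assms(4,5) in \<open>simp_all add: cl hom\<close>)
    fix x assume x: "x \<in> A"
    obtain y where y: "y \<in> A" "h y = inv\<^bsub>G\<^esub> (h x)"
      using assms(3) G.inv_closed[OF hA[OF x]] by (metis imageE)
    have "m y x = e" by (rule inj) (use x y hA assms(4,5) in \<open>simp_all add: cl hom\<close>)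
    then show "\<exists>y\<in>A. m y x = e" using y by blast
  qed
qed

context semi_abelian
begin

text \<open>By the universal property of a pullback square with projections \<open>p\<close> and \<open>q\<close>, composition with
  \<open>p\<close> is a bijection from the arrows \<open>t \<rightarrow> q\<close> over \<open>C\<close> to the arrows \<open>\<phi> \<cdot> t \<rightarrow> f'\<close> over \<open>C'\<close>, so that
  structures on the hom-sets into \<open>f'\<close> transfer to \<open>q\<close>. Isomorphisms over \<open>C\<close> are the special case
  \<open>\<phi> = 1\<close>.\<close>

lemma slice_change_of_base:
  assumes "is_pullback \<B> f' \<phi> p q" "arr t" "tgt t = src \<phi>"
  shows "x \<in> slice t q \<Longrightarrow> p \<cdot> x \<in> slice (\<phi> \<cdot> t) f'"
    "x \<in> slice t q \<Longrightarrow> y \<in> slice t q \<Longrightarrow> p \<cdot> x = p \<cdot> y \<Longrightarrow> x = y"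
    "z \<in> slice (\<phi> \<cdot> t) f' \<Longrightarrow> \<exists>x. x \<in> slice t q \<and> p \<cdot> x = z"
proof -
  note pa = pullback_arr[OF assms(1)]
  show "p \<cdot> x \<in> slice (\<phi> \<cdot> t) f'" if "x \<in> slice t q"
    using that pa assms comp_reassoc[OF pa(9), of x] by (auto simp: slice_Hom_iff)
  show "x = y" if "x \<in> slice t q" "y \<in> slice t q" "p \<cdot> x = p \<cdot> y"
    by (rule pullback_ext[OF assms(1)]) (use that pa in \<open>simp_all add: slice_Hom_iff\<close>)
  assume "z \<in> slice (\<phi> \<cdot> t) f'"
  then have z: "arr z" "src z = src t" "tgt z = src f'" "f' \<cdot> z = \<phi> \<cdot> t"
    using assms pa by (simp_all add: slice_Hom_iff)
  obtain x where "arr x" "src x = src t" "tgt x = src p" "p \<cdot> x = z" "q \<cdot> x = t"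
    by (rule pullback_factor[OF assms(1) z(1) assms(2) z(2,3) assms(3) z(4)])
  then show "\<exists>x. x \<in> slice t q \<and> p \<cdot> x = z" using pa by (auto simp: slice_Hom_iff)
qed

lemma slice_HomD:
  assumes "x \<in> slice t f"
  shows "arr x" "src x = src t" "tgt x = src f" "f \<cdot> x = t"
  using assms by (simp_all add: slice_Hom_iff)

lemma slice_mult_closed:
  assumes "arr f" "m \<in> slice (f \<cdot> pb1 \<B> f f) f" "x \<in> slice t f" "y \<in> slice t f"
  shows "m \<cdot> pair f f x y \<in> slice t f"
proof -
  note m = slice_HomD[OF assms(2)] note x = slice_HomD[OF assms(3)] slice_HomD[OF assms(4)]
  have "f \<cdot> m \<cdot> pair f f x y = f \<cdot> pb1 \<B> f f \<cdot> pair f f x y"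
    using comp_reassoc[OF m(4), of "pair f f x y"] m x assms(1) by simp
  then show ?thesis using m x assms(1) by (simp add: slice_Hom_iff)
qed

lemma slice_abelian_group_change_of_base:
  assumes "is_pullback \<B> f' \<phi> p q" "slice_abelian_group \<B> f' s' m'"
    and "is_point \<B> q s" "p \<cdot> s = s' \<cdot> \<phi>"
  shows "\<exists>m. slice_abelian_group \<B> q s m"
proof -
  note pa = pullback_arr[OF assms(1)] note s = point_arr[OF assms(3)]
  have Cq: "tgt q = src \<phi>" using pa by simp
  have m': "m' \<in> slice (f' \<cdot> pb1 \<B> f' f') f'" and s': "is_point \<B> f' s'"
    using assms(2) by (auto simp: slice_abelian_group_def)
  note s' = point_arr[OF s'] note m'a = slice_HomD[OF m']
  define t where "t = q \<cdot> pb1 \<B> q q"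
  have t: "arr t" "tgt t = src \<phi>" "src t = src (pb1 \<B> q q)" using pa by (simp_all add: t_def)
  have pq: "pb1 \<B> q q \<in> slice t q" "pb2 \<B> q q \<in> slice t q"
    using pa t pb_commute[of q q] by (simp_all add: slice_Hom_iff t_def)
  note x12 = pq[THEN slice_change_of_base(1)[OF assms(1) t(1,2)]]
  obtain m where m: "m \<in> slice t q"
    and pm: "p \<cdot> m = m' \<cdot> pair f' f' (p \<cdot> pb1 \<B> q q) (p \<cdot> pb2 \<B> q q)"
    using slice_change_of_base(3)[OF assms(1) t(1,2) slice_mult_closed[OF pa(1) m' x12]] by blast
  note ma = slice_HomD[OF m]
  have op: "m \<cdot> pair q q x y \<in> slice u q"
    "p \<cdot> m \<cdot> pair q q x y = m' \<cdot> pair f' f' (p \<cdot> x) (p \<cdot> y)"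
    if "x \<in> slice u q" "y \<in> slice u q" for u x y
  proof -
    note x = slice_HomD[OF that(1)] slice_HomD[OF that(2)]
    show "m \<cdot> pair q q x y \<in> slice u q"
      using slice_mult_closed[OF pa(5) _ that] m unfolding t_def .
    have "p \<cdot> m \<cdot> pair q q x y =
        m' \<cdot> pair f' f' (p \<cdot> pb1 \<B> q q) (p \<cdot> pb2 \<B> q q) \<cdot> pair q q x y"
      using comp_reassoc[OF pm, of "pair q q x y"] x ma m'a pa(1-8) t slice_HomD[OF x12(1)] slice_HomD[OF x12(2)]
      by simp
    also have "pair f' f' (p \<cdot> pb1 \<B> q q) (p \<cdot> pb2 \<B> q q) \<cdot> pair q q x y =
        pair f' f' (p \<cdot> x) (p \<cdot> y)"
      using x pa(1-8) t slice_HomD[OF x12(1)] slice_HomD[OF x12(2)]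
      by (simp add: pbpair_comp)
    finally show "p \<cdot> m \<cdot> pair q q x y = m' \<cdot> pair f' f' (p \<cdot> x) (p \<cdot> y)" .
  qed
  have "slice_abelian_group \<B> q s m"
    unfolding slice_abelian_group_def
  proof (intro conjI ballI impI)
    show "m \<in> slice (q \<cdot> pb1 \<B> q q) q" using m by (simp add: t_def)
    fix u assume u: "arr u" "tgt u = tgt q"
    have u': "tgt u = src \<phi>" using u Cq by simp
    note cb = slice_change_of_base[OF assms(1) u(1) u']
    show "comm_group \<lparr>carrier = slice u q, mult = (\<lambda>x y. m \<cdot> pair q q x y), one = s \<cdot> u\<rparr>"
    proof (rule comm_group_transport[where h = "\<lambda>x. p \<cdot> x"])
      show "comm_group \<lparr>carrier = slice (\<phi> \<cdot> u) f',
          mult = (\<lambda>x y. m' \<cdot> pair f' f' x y), one = s' \<cdot> \<phi> \<cdot> u\<rparr>"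
        using assms(2) u u' pa unfolding slice_abelian_group_def by simp
      show "inj_on (\<lambda>x. p \<cdot> x) (slice u q)" using cb(2) by (auto intro: inj_onI)
      show "(\<lambda>x. p \<cdot> x) ` slice u q = carrier \<lparr>carrier = slice (\<phi> \<cdot> u) f',
          mult = (\<lambda>x y. m' \<cdot> pair f' f' x y), one = s' \<cdot> \<phi> \<cdot> u\<rparr>"
        using cb(1,3) by fastforce
      show "s \<cdot> u \<in> slice u q"
        using s u comp_reassoc[OF s(5), of u] by (simp add: slice_Hom_iff)
      show "p \<cdot> s \<cdot> u = \<one>\<^bsub>\<lparr>carrier = slice (\<phi> \<cdot> u) f',
          mult = (\<lambda>x y. m' \<cdot> pair f' f' x y), one = s' \<cdot> \<phi> \<cdot> u\<rparr>\<^esub>"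
        using comp_reassoc[OF assms(4), of u] s s' u u' pa by simp
    qed (use op in auto)
  qed fact
  then show ?thesis by blast
qed

lemma autonomous_maltsev_change_of_base:
  assumes "is_pullback \<B> f' \<phi> p q" "autonomous_maltsev \<B> f'"
  shows "autonomous_maltsev \<B> q"
proof -
  note pa = pullback_arr[OF assms(1)]
  have Cq: "tgt q = src \<phi>" using pa by simp
  obtain c' w\<^sub>1' w\<^sub>2' w\<^sub>3' \<theta>' where c': "slice_cube \<B> f' c' w\<^sub>1' w\<^sub>2' w\<^sub>3'" and \<theta>': "\<theta>' \<in> slice c' f'"
    and mal: "\<forall>t \<in> Arr \<B>. tgt t = tgt f' \<longrightarrow>
       (let \<mu> = (\<lambda>x y z. \<theta>' \<cdot> (THE u. u \<in> slice t c' \<and> w\<^sub>1' \<cdot> u = x \<and> w\<^sub>2' \<cdot> u = y \<and> w\<^sub>3' \<cdot> u = z));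
            H = slice t f'
        in (\<forall>x \<in> H. \<forall>y \<in> H. \<mu> x x y = y \<and> \<mu> x y y = x) \<and>
           (\<forall>x\<^sub>1 x\<^sub>2 x\<^sub>3 y\<^sub>1 y\<^sub>2 y\<^sub>3 z\<^sub>1 z\<^sub>2 z\<^sub>3. {x\<^sub>1, x\<^sub>2, x\<^sub>3, y\<^sub>1, y\<^sub>2, y\<^sub>3, z\<^sub>1, z\<^sub>2, z\<^sub>3} \<subseteq> H \<longrightarrow>
              \<mu> (\<mu> x\<^sub>1 x\<^sub>2 x\<^sub>3) (\<mu> y\<^sub>1 y\<^sub>2 y\<^sub>3) (\<mu> z\<^sub>1 z\<^sub>2 z\<^sub>3) =
              \<mu> (\<mu> x\<^sub>1 y\<^sub>1 z\<^sub>1) (\<mu> x\<^sub>2 y\<^sub>2 z\<^sub>2) (\<mu> x\<^sub>3 y\<^sub>3 z\<^sub>3)))"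
    using assms(2) unfolding autonomous_maltsev_def by blast
  have c'a: "arr c'" "tgt c' = tgt f'" "w\<^sub>1' \<in> slice c' f'" "w\<^sub>2' \<in> slice c' f'"
    "w\<^sub>3' \<in> slice c' f'"
    and cube': "\<And>t x y z. arr t \<Longrightarrow> tgt t = tgt f' \<Longrightarrow> x \<in> slice t f' \<Longrightarrow> y \<in> slice t f' \<Longrightarrow>
       z \<in> slice t f' \<Longrightarrow> \<exists>!u. u \<in> slice t c' \<and> w\<^sub>1' \<cdot> u = x \<and> w\<^sub>2' \<cdot> u = y \<and> w\<^sub>3' \<cdot> u = z"
    using c' unfolding slice_cube_def by auto
  define c \<gamma> where "c = pb2 \<B> c' \<phi>" and "\<gamma> = pb1 \<B> c' \<phi>"
  have cp: "is_pullback \<B> c' \<phi> \<gamma> c" unfolding c_def \<gamma>_def using c'a pa by (intro pb_pullback) simp_all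
  note ca = pullback_arr[OF cp]
  have lift: "\<exists>w. w \<in> slice c q \<and> p \<cdot> w = w' \<cdot> \<gamma>" if "w' \<in> slice c' f'" for w'
  proof -
    have "w' \<cdot> \<gamma> \<in> slice (\<phi> \<cdot> c) f'"
      using slice_HomD[OF that] ca comp_reassoc[OF slice_HomD(4)[OF that], of \<gamma>] pa by (simp add: slice_Hom_iff)
    then show ?thesis using slice_change_of_base(3)[OF assms(1) ca(5,7)] by blast
  qed
  obtain w\<^sub>1 w\<^sub>2 w\<^sub>3 \<theta> where w: "w\<^sub>1 \<in> slice c q" "p \<cdot> w\<^sub>1 = w\<^sub>1' \<cdot> \<gamma>" "w\<^sub>2 \<in> slice c q" "p \<cdot> w\<^sub>2 = w\<^sub>2' \<cdot> \<gamma>"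
    "w\<^sub>3 \<in> slice c q" "p \<cdot> w\<^sub>3 = w\<^sub>3' \<cdot> \<gamma>" and \<theta>: "\<theta> \<in> slice c q" "p \<cdot> \<theta> = \<theta>' \<cdot> \<gamma>"
    using lift c'a \<theta>' by metis
  have comp: "v \<cdot> u \<in> slice t q" "p \<cdot> v \<cdot> u = v' \<cdot> \<gamma> \<cdot> u"
    if "v \<in> slice c q" "v' \<in> slice c' f'" "p \<cdot> v = v' \<cdot> \<gamma>" "u \<in> slice t c" for u v v' t
  proof -
    note v = slice_HomD[OF that(1)] slice_HomD[OF that(2)] slice_HomD[OF that(4)]
    show "v \<cdot> u \<in> slice t q" using comp_reassoc[OF v(4), of u] v pa ca by (simp add: slice_Hom_iff)
    show "p \<cdot> v \<cdot> u = v' \<cdot> \<gamma> \<cdot> u" using comp_reassoc[OF that(3), of u] v pa ca by simp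
  qed
  have cube: "\<exists>!u. u \<in> slice t c \<and> w\<^sub>1 \<cdot> u = x \<and> w\<^sub>2 \<cdot> u = y \<and> w\<^sub>3 \<cdot> u = z"
    and op: "\<theta> \<cdot> (THE u. u \<in> slice t c \<and> w\<^sub>1 \<cdot> u = x \<and> w\<^sub>2 \<cdot> u = y \<and> w\<^sub>3 \<cdot> u = z) \<in> slice t q"
      "p \<cdot> \<theta> \<cdot> (THE u. u \<in> slice t c \<and> w\<^sub>1 \<cdot> u = x \<and> w\<^sub>2 \<cdot> u = y \<and> w\<^sub>3 \<cdot> u = z) =
       \<theta>' \<cdot> (THE u. u \<in> slice (\<phi> \<cdot> t) c' \<and> w\<^sub>1' \<cdot> u = p \<cdot> x \<and> w\<^sub>2' \<cdot> u = p \<cdot> y \<and> w\<^sub>3' \<cdot> u = p \<cdot> z)"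
    if t: "arr t" "tgt t = tgt q" and x: "x \<in> slice t q" "y \<in> slice t q" "z \<in> slice t q"
    for t x y z
  proof -
    have t': "tgt t = src \<phi>" "arr (\<phi> \<cdot> t)" "tgt (\<phi> \<cdot> t) = tgt f'" using t Cq pa by simp_all
    note cb = slice_change_of_base[OF assms(1) t(1) t'(1)] note cc = slice_change_of_base[OF cp t(1) t'(1)]
    note ex' = cube'[OF t'(2,3) x[THEN cb(1)]]
    then obtain u' where u': "u' \<in> slice (\<phi> \<cdot> t) c'" "w\<^sub>1' \<cdot> u' = p \<cdot> x" "w\<^sub>2' \<cdot> u' = p \<cdot> y" "w\<^sub>3' \<cdot> u' = p \<cdot> z"
      by blast
    obtain u where u: "u \<in> slice t c" "\<gamma> \<cdot> u = u'" using cc(3)[OF u'(1)] by blast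
    have P: "w\<^sub>1 \<cdot> v = x \<and> w\<^sub>2 \<cdot> v = y \<and> w\<^sub>3 \<cdot> v = z \<longleftrightarrow> v = u" if v: "v \<in> slice t c" for v
    proof -
      have "w\<^sub>1 \<cdot> v = x \<longleftrightarrow> w\<^sub>1' \<cdot> \<gamma> \<cdot> v = p \<cdot> x" "w\<^sub>2 \<cdot> v = y \<longleftrightarrow> w\<^sub>2' \<cdot> \<gamma> \<cdot> v = p \<cdot> y"
        "w\<^sub>3 \<cdot> v = z \<longleftrightarrow> w\<^sub>3' \<cdot> \<gamma> \<cdot> v = p \<cdot> z"
        using cb(2)[OF comp(1)[OF w(1) c'a(3) w(2) v] x(1)] comp(2)[OF w(1) c'a(3) w(2) v]
          cb(2)[OF comp(1)[OF w(3) c'a(4) w(4) v] x(2)] comp(2)[OF w(3) c'a(4) w(4) v]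
          cb(2)[OF comp(1)[OF w(5) c'a(5) w(6) v] x(3)] comp(2)[OF w(5) c'a(5) w(6) v]
        by metis+
      moreover have "\<gamma> \<cdot> v = u' \<longleftrightarrow> v = u" using cc(2)[OF v u(1)] u(2) by auto
      ultimately show ?thesis using ex' u' cc(1)[OF v] by blast
    qed
    then show "\<exists>!u. u \<in> slice t c \<and> w\<^sub>1 \<cdot> u = x \<and> w\<^sub>2 \<cdot> u = y \<and> w\<^sub>3 \<cdot> u = z"
      using u(1) by blast
    have T: "(THE u. u \<in> slice t c \<and> w\<^sub>1 \<cdot> u = x \<and> w\<^sub>2 \<cdot> u = y \<and> w\<^sub>3 \<cdot> u = z) = u"
      using P u(1) by (intro the_equality) blast+
    have T': "(THE u. u \<in> slice (\<phi> \<cdot> t) c' \<and> w\<^sub>1' \<cdot> u = p \<cdot> x \<and> w\<^sub>2' \<cdot> u = p \<cdot> y \<and> w\<^sub>3' \<cdot> u = p \<cdot> z) = u'"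
      using ex' u' by (intro the_equality) blast+
    show "\<theta> \<cdot> (THE u. u \<in> slice t c \<and> w\<^sub>1 \<cdot> u = x \<and> w\<^sub>2 \<cdot> u = y \<and> w\<^sub>3 \<cdot> u = z) \<in> slice t q"
      "p \<cdot> \<theta> \<cdot> (THE u. u \<in> slice t c \<and> w\<^sub>1 \<cdot> u = x \<and> w\<^sub>2 \<cdot> u = y \<and> w\<^sub>3 \<cdot> u = z) =
       \<theta>' \<cdot> (THE u. u \<in> slice (\<phi> \<cdot> t) c' \<and> w\<^sub>1' \<cdot> u = p \<cdot> x \<and> w\<^sub>2' \<cdot> u = p \<cdot> y \<and> w\<^sub>3' \<cdot> u = p \<cdot> z)"
      unfolding T T' using comp[OF \<theta>(1) \<theta>' \<theta>(2) u(1)] u(2) by simp_all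
  qed
  show ?thesis
    unfolding autonomous_maltsev_def
  proof (rule exI[of _ c], rule exI[of _ w\<^sub>1], rule exI[of _ w\<^sub>2], rule exI[of _ w\<^sub>3], rule exI[of _ \<theta>],
      intro conjI ballI impI)
    show "slice_cube \<B> q c w\<^sub>1 w\<^sub>2 w\<^sub>3"
      unfolding slice_cube_def using ca pa Cq w cube by auto
    show "\<theta> \<in> slice c q" by fact
    fix t assume t: "arr t" "tgt t = tgt q"
    have t': "tgt t = src \<phi>" "arr (\<phi> \<cdot> t)" "tgt (\<phi> \<cdot> t) = tgt f'" using t Cq pa by simp_all
    note cb = slice_change_of_base[OF assms(1) t(1) t'(1)]
    define \<mu> where "\<mu> = (\<lambda>x y z. \<theta> \<cdot> (THE u. u \<in> slice t c \<and> w\<^sub>1 \<cdot> u = x \<and> w\<^sub>2 \<cdot> u = y \<and> w\<^sub>3 \<cdot> u = z))"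
    define \<mu>' where "\<mu>' = (\<lambda>x y z. \<theta>' \<cdot> (THE u. u \<in> slice (\<phi> \<cdot> t) c' \<and> w\<^sub>1' \<cdot> u = x \<and> w\<^sub>2' \<cdot> u = y \<and> w\<^sub>3' \<cdot> u = z))"
    let ?H = "slice t q" let ?H' = "slice (\<phi> \<cdot> t) f'"
    have cl: "\<mu> x y z \<in> ?H" "p \<cdot> \<mu> x y z = \<mu>' (p \<cdot> x) (p \<cdot> y) (p \<cdot> z)"
      if "x \<in> ?H" "y \<in> ?H" "z \<in> ?H" for x y z
      using op[OF t that] unfolding \<mu>_def \<mu>'_def by auto
    have mal': "(\<forall>x \<in> ?H'. \<forall>y \<in> ?H'. \<mu>' x x y = y \<and> \<mu>' x y y = x) \<and>
           (\<forall>x\<^sub>1 x\<^sub>2 x\<^sub>3 y\<^sub>1 y\<^sub>2 y\<^sub>3 z\<^sub>1 z\<^sub>2 z\<^sub>3. {x\<^sub>1, x\<^sub>2, x\<^sub>3, y\<^sub>1, y\<^sub>2, y\<^sub>3, z\<^sub>1, z\<^sub>2, z\<^sub>3} \<subseteq> ?H' \<longrightarrow>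
              \<mu>' (\<mu>' x\<^sub>1 x\<^sub>2 x\<^sub>3) (\<mu>' y\<^sub>1 y\<^sub>2 y\<^sub>3) (\<mu>' z\<^sub>1 z\<^sub>2 z\<^sub>3) =
              \<mu>' (\<mu>' x\<^sub>1 y\<^sub>1 z\<^sub>1) (\<mu>' x\<^sub>2 y\<^sub>2 z\<^sub>2) (\<mu>' x\<^sub>3 y\<^sub>3 z\<^sub>3))"
      using mal[rule_format, OF t'(2,3)] unfolding \<mu>'_def Let_def .
    have 1: "\<mu> x x y = y \<and> \<mu> x y y = x" if x: "x \<in> ?H" "y \<in> ?H" for x y
      using cb(2)[OF cl(1)[OF x(1,1,2)] x(2)] cb(2)[OF cl(1)[OF x(1,2,2)] x(1)]
        cl(2)[OF x(1,1,2)] cl(2)[OF x(1,2,2)] mal' cb(1)[OF x(1)] cb(1)[OF x(2)] by simp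
    have 2: "\<mu> (\<mu> x\<^sub>1 x\<^sub>2 x\<^sub>3) (\<mu> y\<^sub>1 y\<^sub>2 y\<^sub>3) (\<mu> z\<^sub>1 z\<^sub>2 z\<^sub>3) = \<mu> (\<mu> x\<^sub>1 y\<^sub>1 z\<^sub>1) (\<mu> x\<^sub>2 y\<^sub>2 z\<^sub>2) (\<mu> x\<^sub>3 y\<^sub>3 z\<^sub>3)"
      if x: "{x\<^sub>1, x\<^sub>2, x\<^sub>3, y\<^sub>1, y\<^sub>2, y\<^sub>3, z\<^sub>1, z\<^sub>2, z\<^sub>3} \<subseteq> ?H" for x\<^sub>1 x\<^sub>2 x\<^sub>3 y\<^sub>1 y\<^sub>2 y\<^sub>3 z\<^sub>1 z\<^sub>2 z\<^sub>3
    proof (rule cb(2))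
      show "\<mu> (\<mu> x\<^sub>1 x\<^sub>2 x\<^sub>3) (\<mu> y\<^sub>1 y\<^sub>2 y\<^sub>3) (\<mu> z\<^sub>1 z\<^sub>2 z\<^sub>3) \<in> ?H" "\<mu> (\<mu> x\<^sub>1 y\<^sub>1 z\<^sub>1) (\<mu> x\<^sub>2 y\<^sub>2 z\<^sub>2) (\<mu> x\<^sub>3 y\<^sub>3 z\<^sub>3) \<in> ?H"
        using x by (simp_all add: cl(1))
      have "{p \<cdot> x\<^sub>1, p \<cdot> x\<^sub>2, p \<cdot> x\<^sub>3, p \<cdot> y\<^sub>1, p \<cdot> y\<^sub>2, p \<cdot> y\<^sub>3, p \<cdot> z\<^sub>1, p \<cdot> z\<^sub>2, p \<cdot> z\<^sub>3} \<subseteq> ?H'"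
        using x cb(1) by simp
      note conjunct2[OF mal', rule_format, OF this]
      then show "p \<cdot> \<mu> (\<mu> x\<^sub>1 x\<^sub>2 x\<^sub>3) (\<mu> y\<^sub>1 y\<^sub>2 y\<^sub>3) (\<mu> z\<^sub>1 z\<^sub>2 z\<^sub>3) =
          p \<cdot> \<mu> (\<mu> x\<^sub>1 y\<^sub>1 z\<^sub>1) (\<mu> x\<^sub>2 y\<^sub>2 z\<^sub>2) (\<mu> x\<^sub>3 y\<^sub>3 z\<^sub>3)"
        using x by (simp add: cl)
    qed
    show "let \<mu> = (\<lambda>x y z. \<theta> \<cdot> (THE u. u \<in> slice t c \<and> w\<^sub>1 \<cdot> u = x \<and> w\<^sub>2 \<cdot> u = y \<and> w\<^sub>3 \<cdot> u = z));
            H = slice t q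
        in (\<forall>x \<in> H. \<forall>y \<in> H. \<mu> x x y = y \<and> \<mu> x y y = x) \<and>
           (\<forall>x\<^sub>1 x\<^sub>2 x\<^sub>3 y\<^sub>1 y\<^sub>2 y\<^sub>3 z\<^sub>1 z\<^sub>2 z\<^sub>3. {x\<^sub>1, x\<^sub>2, x\<^sub>3, y\<^sub>1, y\<^sub>2, y\<^sub>3, z\<^sub>1, z\<^sub>2, z\<^sub>3} \<subseteq> H \<longrightarrow>
              \<mu> (\<mu> x\<^sub>1 x\<^sub>2 x\<^sub>3) (\<mu> y\<^sub>1 y\<^sub>2 y\<^sub>3) (\<mu> z\<^sub>1 z\<^sub>2 z\<^sub>3) =
              \<mu> (\<mu> x\<^sub>1 y\<^sub>1 z\<^sub>1) (\<mu> x\<^sub>2 y\<^sub>2 z\<^sub>2) (\<mu> x\<^sub>3 y\<^sub>3 z\<^sub>3))"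
      unfolding Let_def \<mu>_def[symmetric] using 1 2 by blast
  qed
qed

section \<open>Translations\<close>

text \<open>An extension with projection \<open>f\<close> and kernel \<open>k\<close> on which the split extension \<open>S\<close>, with projection
  \<open>p\<close>, kernel \<open>i\<close> and section \<open>s\<close>, acts by \<open>m : S \<times>\<^sub>C E \<rightarrow> E\<close>; on generalised elements \<open>\<sigma>\<close> of \<open>S\<close>
  and \<open>x\<close> of \<open>E\<close> over the same element of \<open>C\<close>, the translate of \<open>x\<close> by \<open>\<sigma>\<close> is \<open>m \<cdot> \<langle>\<sigma>, x\<rangle>\<close>.
  Besides being over \<open>C\<close>, only the values of \<open>m\<close> on the section and on the kernel of \<open>S \<times>\<^sub>C E \<rightarrow> E\<close>
  are prescribed: as these are jointly epic, the laws of an action follow once \<open>S\<close> acts on itself.\<close>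

definition translation where
  "translation p i s f k m \<longleftrightarrow>
     is_point \<B> p s \<and> is_kernel \<B> i p \<and> arr f \<and> tgt f = tgt p \<and>
     m \<in> Arr \<B> \<and> src m = src (pb1 \<B> p f) \<and> tgt m = src f \<and> f \<cdot> m = f \<cdot> pb2 \<B> p f \<and>
     m \<cdot> pair p f i (zero \<B> (src i) (src f)) = k \<and>
     m \<cdot> pair p f (s \<cdot> f) (ide (src f)) = ide (src f)"

definition free_transitive where
  "free_transitive p f m \<longleftrightarrow> (\<forall>t x y. x \<in> slice t f \<longrightarrow> y \<in> slice t f \<longrightarrow>
     (\<exists>!\<sigma>. \<sigma> \<in> slice t p \<and> m \<cdot> pair p f \<sigma> x = y))"

lemma slice_comp:
  assumes "x \<in> slice t f" "arr f" "arr a" "tgt a = src t"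
  shows "x \<cdot> a \<in> slice (t \<cdot> a) f"
proof -
  note x = slice_HomD[OF assms(1)]
  have "arr t" using arr_comp(1)[of x f] x assms(2) by simp
  then show ?thesis using x assms(2-) comp_reassoc[of f x t a] by (simp add: slice_Hom_iff)
qed

lemma slice_trans:
  assumes "x \<in> slice t f" "h \<in> slice f g" "arr g"
  shows "h \<cdot> x \<in> slice t g"
  using slice_HomD[OF assms(1)] slice_HomD[OF assms(2)] assms(3) comp_reassoc[of g h f x]
  by (simp add: slice_Hom_iff)

lemma translationD:
  assumes "translation p i s f k m"
  shows "is_point \<B> p s" "is_kernel \<B> i p" "arr p" "arr i" "arr s" "tgt i = src p"
    "tgt s = src p" "src s = tgt p" "p \<cdot> s = ide (tgt p)" "p \<cdot> i = zero \<B> (src i) (tgt p)"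
    "arr f" "tgt f = tgt p" "arr m" "src m = src (pb1 \<B> p f)" "tgt m = src f"
    "f \<cdot> m = f \<cdot> pb2 \<B> p f"
    "m \<cdot> pair p f i (zero \<B> (src i) (src f)) = k"
    "m \<cdot> pair p f (s \<cdot> f) (ide (src f)) = ide (src f)"
  using assms point_arr[of p s] kernel_arr[of i p] by (auto simp: translation_def)

text \<open>\<open>S \<times>\<^sub>C X \<rightarrow> X\<close> is again a split extension with kernel \<open>B\<close>.\<close>

lemma pb_joint_epi:
  assumes "is_point \<B> p s" "is_kernel \<B> i p" "arr v" "tgt v = tgt p"
    "arr x" "arr y" "src x = src (pb1 \<B> p v)" "src y = src (pb1 \<B> p v)" "tgt x = tgt y"
    "x \<cdot> pair p v i (zero \<B> (src i) (src v)) = y \<cdot> pair p v i (zero \<B> (src i) (src v))"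
    "x \<cdot> pair p v (s \<cdot> v) (ide (src v)) = y \<cdot> pair p v (s \<cdot> v) (ide (src v))"
  shows "x = y"
proof (rule split_joint_epi)
  show "is_point \<B> (pb2 \<B> p v) (pair p v (s \<cdot> v) (ide (src v)))"
    using point_pb2[OF assms(1,3,4)] by simp
  show "is_kernel \<B> (pair p v i (zero \<B> (src i) (src v))) (pb2 \<B> p v)"
    using kernel_pb2[OF assms(2-4)] by simp
qed (use assms(5-) pb_arr[OF point_arr(1)[OF assms(1)] assms(3)] assms(4) in auto)

lemma translate:
  assumes "translation p i s f k m" "\<sigma> \<in> slice t p" "x \<in> slice t f"
  shows translate_slice: "m \<cdot> pair p f \<sigma> x \<in> slice t f"
    and translate_comp: "arr a \<Longrightarrow> tgt a = src t \<Longrightarrow>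
      (m \<cdot> pair p f \<sigma> x) \<cdot> a = m \<cdot> pair p f (\<sigma> \<cdot> a) (x \<cdot> a)"
proof -
  note T = translationD[OF assms(1)] note x = slice_HomD[OF assms(2)] slice_HomD[OF assms(3)]
  have P: "arr (pair p f \<sigma> x)" "tgt (pair p f \<sigma> x) = src (pb1 \<B> p f)"
    "src (pair p f \<sigma> x) = src t" "pb2 \<B> p f \<cdot> pair p f \<sigma> x = x"
    using T x by simp_all
  show "m \<cdot> pair p f \<sigma> x \<in> slice t f"
    using comp_reassoc[OF T(16), of "pair p f \<sigma> x"] P T(3,11-15) x by (simp add: slice_Hom_iff)
  show "(m \<cdot> pair p f \<sigma> x) \<cdot> a = m \<cdot> pair p f (\<sigma> \<cdot> a) (x \<cdot> a)" if "arr a" "tgt a = src t"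
  proof -
    have "(m \<cdot> pair p f \<sigma> x) \<cdot> a = m \<cdot> pair p f \<sigma> x \<cdot> a" using P T(13,14) that by simp
    also have "pair p f \<sigma> x \<cdot> a = pair p f (\<sigma> \<cdot> a) (x \<cdot> a)"
      using T x that by (intro pbpair_comp) simp_all
    finally show ?thesis .
  qed
qed

lemma translate_unit:
  assumes "translation p i s f k m" "x \<in> slice t f"
  shows "m \<cdot> pair p f (s \<cdot> t) x = x"
proof -
  note T = translationD[OF assms(1)] note x = slice_HomD[OF assms(2)]
  have e: "p \<cdot> s \<cdot> f = f" using comp_reassoc[OF T(9), of f] T by simp
  have "pair p f (s \<cdot> t) x = pair p f (s \<cdot> f) (ide (src f)) \<cdot> x"
    using T(3-12) x e by (subst pbpair_comp) simp_all
  moreover have "m \<cdot> pair p f (s \<cdot> f) (ide (src f)) \<cdot> x = x"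
    using comp_reassoc[OF T(18), of x] T(3-15) x e by simp
  ultimately show ?thesis by simp
qed

text \<open>The two sides come from arrows \<open>S \<times>\<^sub>C E \<rightarrow> E'\<close>. On the section of \<open>S \<times>\<^sub>C E \<rightarrow> E\<close> both are \<open>u\<close>, and on
  its kernel both are \<open>k' \<cdot> b\<close>.\<close>

lemma translate_natural:
  assumes "translation p i s f k m" "translation p' i' s' f' k' m'"
    and h: "h \<in> slice p p'" "h \<cdot> s = s'" "h \<cdot> i = i' \<cdot> b" "arr b" "src b = src i" "tgt b = src i'"
    and u: "u \<in> slice f f'" "u \<cdot> k = k' \<cdot> b"
    and x: "\<sigma> \<in> slice t p" "x \<in> slice t f"
  shows "u \<cdot> m \<cdot> pair p f \<sigma> x = m' \<cdot> pair p' f' (h \<cdot> \<sigma>) (u \<cdot> x)"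
proof -
  note T = translationD[OF assms(1)] note T' = translationD[OF assms(2)]
  note ha = slice_HomD[OF h(1)] note ua = slice_HomD[OF u(1)] note xa = slice_HomD[OF x(1)] slice_HomD[OF x(2)]
  have Cp: "tgt p' = tgt p" using ha T' by (metis arr_comp(3))
  let ?P = "pb1 \<B> p f" and ?Q = "pb2 \<B> p f"
  define t0 where "t0 = p \<cdot> ?P"
  have P: "?P \<in> slice t0 p" "?Q \<in> slice t0 f"
    using T pb_commute[of p f] unfolding t0_def by (simp_all add: slice_Hom_iff)
  have P': "h \<cdot> ?P \<in> slice t0 p'" "u \<cdot> ?Q \<in> slice t0 f'"
    using slice_trans[OF P(1) h(1) T'(3)] slice_trans[OF P(2) u(1) T'(11)] .
  note M' = translate_slice[OF assms(2) P']
  have t0: "arr t0" "src t0 = src ?P" using T by (simp_all add: t0_def)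
  have tr: "(m' \<cdot> pair p' f' (h \<cdot> ?P) (u \<cdot> ?Q)) \<cdot> a =
      m' \<cdot> pair p' f' (h \<cdot> ?P \<cdot> a) (u \<cdot> ?Q \<cdot> a)" if "arr a" "tgt a = src ?P" for a
    using translate_comp[OF assms(2) P' that(1)] that ha ua T(3-12) t0 by simp
  have e: "p \<cdot> s \<cdot> f = f" using comp_reassoc[OF T(9), of f] T by simp
  let ?B = "src i"
  have oB: "?B \<in> Obj \<B>" using T(4) by simp
  have "u \<cdot> m = m' \<cdot> pair p' f' (h \<cdot> ?P) (u \<cdot> ?Q)"
  proof (rule pb_joint_epi[OF T(1,2,11,12)])
    let ?z = "zero \<B> ?B (src f)"
    have "m' \<cdot> pair p' f' (i' \<cdot> b) (zero \<B> ?B (src f')) = k' \<cdot> b"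
    proof -
      have z: "p' \<cdot> i' = f' \<cdot> zero \<B> (src i') (src f')" "src i' \<in> Obj \<B>" using T' by simp_all
      have "pair p' f' (i' \<cdot> b) (zero \<B> ?B (src f')) =
          pair p' f' i' (zero \<B> (src i') (src f')) \<cdot> b"
        using T'(3-12) h z by (subst pbpair_comp) simp_all
      then show ?thesis
        using comp_reassoc[OF T'(17), of b] T'(3,4,6,11-15) h z by simp
    qed
    then show "(u \<cdot> m) \<cdot> pair p f i ?z =
        (m' \<cdot> pair p' f' (h \<cdot> ?P) (u \<cdot> ?Q)) \<cdot> pair p f i ?z"
      using T ua h u oB by (simp add: tr)
    have "m' \<cdot> pair p' f' (s' \<cdot> f) u = u"
      using translate_unit[OF assms(2) u(1)] .
    moreover have "h \<cdot> s \<cdot> f = s' \<cdot> f" using comp_reassoc[OF h(2), of f] T ha by simp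
    ultimately show "(u \<cdot> m) \<cdot> pair p f (s \<cdot> f) (ide (src f)) =
        (m' \<cdot> pair p' f' (h \<cdot> ?P) (u \<cdot> ?Q)) \<cdot> pair p f (s \<cdot> f) (ide (src f))"
      using T ua e by (simp add: tr)
  qed (use T T' ua slice_HomD[OF M'] t0 in simp_all)
  then show ?thesis
    using comp_reassoc[of u m _ "pair p f \<sigma> x"] tr[of "pair p f \<sigma> x"] T xa ua by simp
qed

text \<open>Both sides define arrows \<open>S \<times>\<^sub>C (S \<times>\<^sub>C E) \<rightarrow> E\<close>, which agree on the section and on the kernel
  of the projection that forgets the first factor.\<close>

lemma translate_assoc:
  assumes "translation p i s f k m" "translation p i s p i a"
    and x: "\<sigma> \<in> slice t p" "\<tau> \<in> slice t p" "x \<in> slice t f"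
  shows "m \<cdot> pair p f \<sigma> (m \<cdot> pair p f \<tau> x) = m \<cdot> pair p f (a \<cdot> pair p p \<sigma> \<tau>) x"
proof -
  note T = translationD[OF assms(1)] note A = translationD[OF assms(2)]
  let ?P = "pb1 \<B> p f" and ?Q = "pb2 \<B> p f"
  define v where "v = p \<cdot> ?P"
  have v: "arr v" "src v = src ?P" "tgt v = tgt p" using T by (simp_all add: v_def)
  have PQ: "?P \<in> slice v p" "?Q \<in> slice v f"
    using T pb_commute[of p f] unfolding v_def by (simp_all add: slice_Hom_iff)
  let ?R = "pb1 \<B> p v" and ?W = "pb2 \<B> p v"
  define w where "w = p \<cdot> ?R"
  have w: "arr w" "src w = src ?R" "tgt w = tgt p" using T v by (simp_all add: w_def)
  have R: "?R \<in> slice w p" and W: "v \<cdot> ?W = w" "arr ?W" "tgt ?W = src v" "src ?W = src w"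
    using T v pb_commute[of p v] unfolding w_def by (simp_all add: slice_Hom_iff)
  have PW: "?P \<cdot> ?W \<in> slice w p" "?Q \<cdot> ?W \<in> slice w f"
    using slice_comp[OF PQ(1) T(3) W(2,3)] slice_comp[OF PQ(2) T(11) W(2,3)] W(1) by simp_all
  define L where "L = m \<cdot> pair p f ?R (m \<cdot> pair p f (?P \<cdot> ?W) (?Q \<cdot> ?W))"
  define N where "N = m \<cdot> pair p f (a \<cdot> pair p p ?R (?P \<cdot> ?W)) (?Q \<cdot> ?W)"
  have L: "L \<in> slice w f"
    unfolding L_def by (intro translate_slice[OF assms(1)] R PW)
  have N: "N \<in> slice w f"
    unfolding N_def by (intro translate_slice[OF assms(1)] translate_slice[OF assms(2)] R PW)
  have red: "L \<cdot> pair p v \<alpha> (pair p f \<beta> y) = m \<cdot> pair p f \<alpha> (m \<cdot> pair p f \<beta> y)"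
    "N \<cdot> pair p v \<alpha> (pair p f \<beta> y) = m \<cdot> pair p f (a \<cdot> pair p p \<alpha> \<beta>) y"
    if "\<alpha> \<in> slice r p" "\<beta> \<in> slice r p" "y \<in> slice r f" for \<alpha> \<beta> y r
  proof -
    note xs = slice_HomD[OF that(1)] slice_HomD[OF that(2)] slice_HomD[OF that(3)]
    let ?b = "pair p f \<beta> y" let ?c = "pair p v \<alpha> ?b"
    have b: "arr ?b" "src ?b = src r" "tgt ?b = src ?P" "?P \<cdot> ?b = \<beta>" "?Q \<cdot> ?b = y"
      using xs T by simp_all
    have vb: "p \<cdot> \<alpha> = v \<cdot> ?b" using b xs T by (simp add: v_def)
    have c: "arr ?c" "src ?c = src r" "tgt ?c = src ?R" "?R \<cdot> ?c = \<alpha>" "?W \<cdot> ?c = ?b"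
      using b xs T v vb by simp_all
    have cw: "tgt ?c = src w" using c w by simp
    have e: "(?P \<cdot> ?W) \<cdot> ?c = \<beta>" "(?Q \<cdot> ?W) \<cdot> ?c = y"
      using comp_assoc[OF c(1) W(2), of ?P] comp_assoc[OF c(1) W(2), of ?Q] b c W slice_HomD[OF PQ(1)]
        slice_HomD[OF PQ(2)] by (simp_all only: cw)
    have 1: "(m \<cdot> pair p f (?P \<cdot> ?W) (?Q \<cdot> ?W)) \<cdot> ?c = m \<cdot> pair p f \<beta> y"
      unfolding translate_comp[OF assms(1) PW c(1) cw] e ..
    have 2: "(a \<cdot> pair p p ?R (?P \<cdot> ?W)) \<cdot> ?c = a \<cdot> pair p p \<alpha> \<beta>"
      unfolding translate_comp[OF assms(2) R PW(1) c(1) cw] e c(4) ..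
    show "L \<cdot> ?c = m \<cdot> pair p f \<alpha> (m \<cdot> pair p f \<beta> y)"
      unfolding L_def translate_comp[OF assms(1) R translate_slice[OF assms(1) PW] c(1) cw] 1 c(4) ..
    show "N \<cdot> ?c = m \<cdot> pair p f (a \<cdot> pair p p \<alpha> \<beta>) y"
      unfolding N_def translate_comp[OF assms(1) translate_slice[OF assms(2) R PW(1)] PW(2) c(1) cw] 2 e(2) ..
  qed
  have e: "p \<cdot> s \<cdot> f = f" "p \<cdot> s \<cdot> v = v" using comp_reassoc[OF T(9)] T v by simp_all
  let ?B = "src i"
  have oB: "?B \<in> Obj \<B>" using T(4) by simp
  have "L = N"
  proof (rule pb_joint_epi[OF T(1,2) v(1,3)])
    let ?z = "zero \<B> ?B (tgt p)"
    have z: "i \<in> slice ?z p" "s \<cdot> ?z \<in> slice ?z p" "zero \<B> ?B (src f) \<in> slice ?z f"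
      using T oB by (simp_all add: slice_Hom_iff)
    have ze: "zero \<B> ?B (src v) = pair p f (s \<cdot> ?z) (zero \<B> ?B (src f))"
      by (rule pb_ext[of p f]) (use T oB v in simp_all)
    have u1: "m \<cdot> pair p f (s \<cdot> ?z) (zero \<B> ?B (src f)) = zero \<B> ?B (src f)"
      by (rule translate_unit[OF assms(1) z(3)])
    have u2: "a \<cdot> pair p p i (s \<cdot> ?z) = i" using A(17) T oB by simp
    show "L \<cdot> pair p v i (zero \<B> ?B (src v)) = N \<cdot> pair p v i (zero \<B> ?B (src v))"
      unfolding ze red[OF z] u1 u2 ..
    have s: "s \<cdot> v \<in> slice v p" using T v e by (simp add: slice_Hom_iff)
    have ide: "ide (src v) = pair p f ?P ?Q"
      by (rule pb_ext[of p f]) (use T v pb_commute[of p f] in simp_all)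
    show "L \<cdot> pair p v (s \<cdot> v) (ide (src v)) = N \<cdot> pair p v (s \<cdot> v) (ide (src v))"
      unfolding ide red[OF s PQ] translate_unit[OF assms(1) translate_slice[OF assms(1) PQ]]
        translate_unit[OF assms(2) PQ(1)] ..
  qed (use slice_HomD[OF L] slice_HomD[OF N] w in simp_all)
  then show ?thesis using red[OF x] by simp
qed

lemma translate_right_unit:
  assumes "translation p i s p i a" "\<sigma> \<in> slice t p"
  shows "a \<cdot> pair p p \<sigma> (s \<cdot> t) = \<sigma>"
proof -
  note A = translationD[OF assms(1)] note x = slice_HomD[OF assms(2)]
  let ?I = "ide (src p)"
  have e: "p \<cdot> s \<cdot> p = p" using comp_reassoc[OF A(9), of p] A by simp
  have I: "?I \<in> slice p p" "s \<cdot> p \<in> slice p p" using A e by (simp_all add: slice_Hom_iff)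
  note M = translate_slice[OF assms(1) I] note tc = translate_comp[OF assms(1) I]
  have "a \<cdot> pair p p ?I (s \<cdot> p) = ?I"
  proof (rule split_joint_epi[OF A(1,2)])
    have "?I \<cdot> i = i" "(s \<cdot> p) \<cdot> i = zero \<B> (src i) (src p)" using A(3-10) by simp_all
    then show "(a \<cdot> pair p p ?I (s \<cdot> p)) \<cdot> i = ?I \<cdot> i"
      unfolding tc[OF A(4,6)] using A(17) by simp
    have "s \<in> slice (ide (tgt p)) p" using A by (simp add: slice_Hom_iff)
    note translate_unit[OF assms(1) this]
    moreover have "?I \<cdot> s = s" "(s \<cdot> p) \<cdot> s = s" "s \<cdot> ide (tgt p) = s" using A(3-10) by simp_all
    ultimately show "(a \<cdot> pair p p ?I (s \<cdot> p)) \<cdot> s = ?I \<cdot> s"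
      unfolding tc[OF A(5,7)] by simp
  qed (use A(3) slice_HomD[OF M] in simp_all)
  then show ?thesis using translate_comp[OF assms(1) I x(1)] x A by simp
qed

lemma translate_cancel:
  assumes "free_transitive p f m" "x \<in> slice t f" "\<sigma> \<in> slice t p" "\<tau> \<in> slice t p"
    "m \<cdot> pair p f \<sigma> x = m \<cdot> pair p f \<tau> x" "m \<cdot> pair p f \<sigma> x \<in> slice t f"
  shows "\<sigma> = \<tau>"
  using assms unfolding free_transitive_def by metis

section \<open>The translations of an abelian extension\<close>

lemma conjugation:
  assumes "is_kernel \<B> k f" "src k = B" "src f = E"
  shows "arr (conjugation \<B> k)" "src (conjugation \<B> k) = flat \<B> E B" "tgt (conjugation \<B> k) = B"
    "k \<cdot> conjugation \<B> k = copair \<B> (ide E) k \<cdot> kappa \<B> E B"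
proof -
  note ka = kernel_arr[OF assms(1)]
  have o: "E \<in> Obj \<B>" "B \<in> Obj \<B>" "tgt k = E" using ka assms by auto
  let ?x = "copair \<B> (ide E) k \<cdot> kappa \<B> E B"
  have e: "copair \<B> f (zero \<B> B (tgt f)) = f \<cdot> copair \<B> (ide E) (zero \<B> B E)"
    using o ka assms by (simp add: comp_copair)
  have x: "arr ?x" "tgt ?x = src f" "src ?x = flat \<B> E B" using o ka assms by simp_all
  have "f \<cdot> ?x = zero \<B> (src ?x) (tgt f)"
    using o ka assms by (simp add: comp_copair_reassoc e)
  then have "f \<cdot> ?x = zero \<B> (flat \<B> E B) (tgt f)" unfolding x(3) .
  moreover have "?x \<in> Hom \<B> (flat \<B> E B) (src f)" using x by (simp add: Hom_def)
  ultimately have "\<exists>!t. t \<in> Hom \<B> (flat \<B> E B) (src k) \<and> k \<cdot> t = ?x"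
    using assms(1) unfolding is_kernel_def by blast
  note t = theI'[OF this]
  have c: "conjugation \<B> k = (THE t. t \<in> Hom \<B> (flat \<B> E B) (src k) \<and> k \<cdot> t = ?x)"
    unfolding conjugation_def o(3) assms(2) ..
  show "arr (conjugation \<B> k)" "src (conjugation \<B> k) = flat \<B> E B" "tgt (conjugation \<B> k) = B"
    "k \<cdot> conjugation \<B> k = ?x"
    using t unfolding c[symmetric] by (simp_all add: Hom_def assms(2))
qed

text \<open>The new action is a restriction of \<open>\<xi>\<close> because \<open>[s \<cdot> v, k] = [s, k] \<cdot> (v + 1)\<close>.\<close>

lemma associated_pb2:
  assumes "associated_split_extension \<B> C B \<xi> f k s" "arr \<xi>" "src \<xi> = flat \<B> C B" "tgt \<xi> = B"
    and v: "arr v" "src v = X" "tgt v = C"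
  shows "associated_split_extension \<B> X B (\<xi> \<cdot> flat_map \<B> v (ide B)) (pb2 \<B> f v)
    (pair f v k (zero \<B> B X)) (pair f v (s \<cdot> v) (ide X))"
proof -
  note a = associatedD[OF assms(1)]
  have X: "X \<in> Obj \<B>" using v by auto
  have e: "f \<cdot> s \<cdot> v = v" using comp_reassoc[OF a(14), of v] a v by simp
  let ?l = "pair f v k (zero \<B> B X)" and ?r = "pair f v (s \<cdot> v) (ide X)"
  have r: "arr ?r" "src ?r = X" "tgt ?r = src (pb1 \<B> f v)" "pb1 \<B> f v \<cdot> ?r = s \<cdot> v" "pb2 \<B> f v \<cdot> ?r = ide X"
    using a v X e by simp_all
  have l: "arr ?l" "src ?l = B" "tgt ?l = src (pb1 \<B> f v)" "pb1 \<B> f v \<cdot> ?l = k" "pb2 \<B> f v \<cdot> ?l = zero \<B> B X"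
    using a v X e by simp_all
  have l': "pb1 \<B> f v \<cdot> ?l \<cdot> x = k \<cdot> x" "pb2 \<B> f v \<cdot> ?l \<cdot> x = zero \<B> (src x) X" if "arr x" "tgt x = B" for x
    using comp_reassoc[OF l(4), of x] comp_reassoc[OF l(5), of x] that l a v X by simp_all
  have "k \<cdot> \<xi> \<cdot> flat_map \<B> v (ide B) = copair \<B> (s \<cdot> v) k \<cdot> kappa \<B> X B"
    using comp_reassoc[OF a(5), of "flat_map \<B> v (ide B)"] a assms v
    by (simp add: copair_kappa_flat_map del: flat_map(4))
  note this [simp]
  have "?l \<cdot> \<xi> \<cdot> flat_map \<B> v (ide B) = copair \<B> ?r ?l \<cdot> kappa \<B> X B"
  proof (rule pb_ext[of f v])
    have c: "arr (\<xi> \<cdot> flat_map \<B> v (ide B))" "tgt (\<xi> \<cdot> flat_map \<B> v (ide B)) = B"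
      "src (\<xi> \<cdot> flat_map \<B> v (ide B)) = flat \<B> X B"
      using a assms(2-) X by simp_all
    show "pb1 \<B> f v \<cdot> ?l \<cdot> \<xi> \<cdot> flat_map \<B> v (ide B) = pb1 \<B> f v \<cdot> copair \<B> ?r ?l \<cdot> kappa \<B> X B"
      using l'(1)[OF c(1,2)] r l a(3,6-8) v X by (simp add: comp_copair_reassoc)
    show "pb2 \<B> f v \<cdot> ?l \<cdot> \<xi> \<cdot> flat_map \<B> v (ide B) = pb2 \<B> f v \<cdot> copair \<B> ?r ?l \<cdot> kappa \<B> X B"
      using l'(2)[OF c(1,2)] c r l a(3,6-8) v X by (simp add: comp_copair_reassoc)
    show "arr (?l \<cdot> \<xi> \<cdot> flat_map \<B> v (ide B))" "arr (copair \<B> ?r ?l \<cdot> kappa \<B> X B)"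
      "src (?l \<cdot> \<xi> \<cdot> flat_map \<B> v (ide B)) = src (copair \<B> ?r ?l \<cdot> kappa \<B> X B)"
      "tgt (?l \<cdot> \<xi> \<cdot> flat_map \<B> v (ide B)) = src (pb1 \<B> f v)"
      "tgt (copair \<B> ?r ?l \<cdot> kappa \<B> X B) = src (pb1 \<B> f v)"
      using c l(1-3) r(1-3) X a(7) by simp_all
  qed (use a v in simp_all)
  moreover have "is_point \<B> (pb2 \<B> f v) ?r" using point_pb2[OF a(1) v(1)] a v by simp
  moreover have "is_kernel \<B> ?l (pb2 \<B> f v)" using kernel_pb2[OF a(2) v(1)] a v by simp
  ultimately show ?thesis
    using l a v unfolding associated_split_extension_def by simp
qed

text \<open>\<open>S \<times>\<^sub>C E\<close> and the kernel pair \<open>E \<times>\<^sub>C E\<close> are split extensions of \<open>E\<close> by \<open>B\<close>, the second with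
  section the diagonal. The action of \<open>E\<close> associated with the second one is conjugation, which by
  assumption is the restriction of \<open>\<xi>\<close>, the action associated with the first one. So they are
  isomorphic; the other projection of the kernel pair gives the translation.\<close>

lemma induced_translation:
  assumes "associated_split_extension \<B> C B \<xi> p i s" "arr \<xi>" "src \<xi> = flat \<B> C B" "tgt \<xi> = B"
    and "is_kernel \<B> k f" "src k = B" "tgt f = C" "\<xi> \<cdot> flat_map \<B> f (ide B) = conjugation \<B> k"
  shows "\<exists>m. translation p i s f k m \<and> free_transitive p f m"
proof -
  note a = associatedD[OF assms(1)] note ka = kernel_arr[OF assms(5)]
  define E where "E = src f"
  have E: "E \<in> Obj \<B>" "src f = E" using ka by (simp_all add: E_def)
  note \<chi> = conjugation[OF assms(5,6) E(2)]
  let ?l = "pair p f i (zero \<B> B E)" and ?r = "pair p f (s \<cdot> f) (ide E)"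
  let ?a = "pair f f (ide E) (ide E)" and ?b = "pair f f k (zero \<B> B E)"
  have as: "associated_split_extension \<B> E B (conjugation \<B> k) (pb2 \<B> p f) ?l ?r"
    using associated_pb2[OF assms(1-4) ka(2) E(2) assms(7)] assms(8) by simp
  have e: "p \<cdot> s \<cdot> f = f" using comp_reassoc[OF a(14), of f] a ka assms by simp
  have pf: "arr p" "arr f" "tgt p = tgt f" using a ka assms by simp_all
  have aa: "arr ?a" "src ?a = E" "tgt ?a = src (pb1 \<B> f f)" "pb1 \<B> f f \<cdot> ?a = ide E"
    "pb2 \<B> f f \<cdot> ?a = ide E" using E pf by simp_all
  have ba: "arr ?b" "src ?b = B" "tgt ?b = src (pb1 \<B> f f)" "pb1 \<B> f f \<cdot> ?b = k"
    "pb2 \<B> f f \<cdot> ?b = zero \<B> B E" using E pf ka assms a by simp_all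
  have pa: "is_point \<B> (pb2 \<B> f f) ?a" using aa E pf by (intro is_pointI) simp_all
  have kb: "is_kernel \<B> ?b (pb2 \<B> f f)" using kernel_pb2[OF assms(5) ka(2)] E assms by simp
  have b': "pb1 \<B> f f \<cdot> ?b \<cdot> x = k \<cdot> x" "pb2 \<B> f f \<cdot> ?b \<cdot> x = zero \<B> (src x) E" if "arr x" "tgt x = B" for x
    using comp_reassoc[OF ba(4), of x] comp_reassoc[OF ba(5), of x] that ba E pf by simp_all
  have rel: "copair \<B> ?a ?b \<cdot> kappa \<B> E B = ?b \<cdot> conjugation \<B> k"
  proof (rule pb_ext[OF pf(2,2) refl])
    have K: "arr (kappa \<B> E B)" "src (kappa \<B> E B) = flat \<B> E B" "tgt (kappa \<B> E B) = tgt (inl \<B> E B)"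
      using E a(7) by simp_all
    show "pb1 \<B> f f \<cdot> copair \<B> ?a ?b \<cdot> kappa \<B> E B = pb1 \<B> f f \<cdot> ?b \<cdot> conjugation \<B> k"
      using b'(1)[OF \<chi>(1,3)] \<chi>(4) aa ba K E pf by (simp add: comp_copair_reassoc)
    show "pb2 \<B> f f \<cdot> copair \<B> ?a ?b \<cdot> kappa \<B> E B = pb2 \<B> f f \<cdot> ?b \<cdot> conjugation \<B> k"
      using b'(2)[OF \<chi>(1,3)] \<chi>(2) aa ba K E pf a(7) by (simp add: comp_copair_reassoc)
    show "arr (copair \<B> ?a ?b \<cdot> kappa \<B> E B)" "arr (?b \<cdot> conjugation \<B> k)"
      "src (copair \<B> ?a ?b \<cdot> kappa \<B> E B) = src (?b \<cdot> conjugation \<B> k)"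
      "tgt (copair \<B> ?a ?b \<cdot> kappa \<B> E B) = src (pb1 \<B> f f)"
      "tgt (?b \<cdot> conjugation \<B> k) = src (pb1 \<B> f f)"
      using \<chi>(1-3) aa(1-3) ba(1-3) K by simp_all
  qed
  obtain h where h: "arr h" "src h = src (pb2 \<B> p f)" "tgt h = src (pb2 \<B> f f)"
    "pb2 \<B> f f \<cdot> h = pb2 \<B> p f" "h \<cdot> ?r = ?a" "h \<cdot> ?l = ?b"
    by (rule split_extension_universal[OF as \<chi>(1-3) pa _ ba(1,2) _ ba(5) rel]) (use E pf ba in auto)
  note as' = associatedD[OF as]
  have "is_iso \<B> h"
    by (rule split_short_five[OF as'(1) pa _ as'(2) kb _ _ _ _ _ is_iso_ide[OF a(7)]])
      (use h as'(3,4) ba pf E a(7) in simp_all)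
  then obtain j where j: "arr j" "src j = tgt h" "tgt j = src h" "j \<cdot> h = ide (src h)"
      "h \<cdot> j = ide (tgt h)"
    by (rule is_isoE)
  define m where "m = pb1 \<B> f f \<cdot> h"
  have m: "arr m" "src m = src (pb1 \<B> p f)" "tgt m = E"
    unfolding m_def using h pf E by simp_all
  have fm: "f \<cdot> m = f \<cdot> pb2 \<B> p f"
    using comp_reassoc[OF pb_commute[OF pf(2,2) refl], of h] h pf unfolding m_def by simp
  have la: "arr ?l" "tgt ?l = src (pb1 \<B> p f)" "arr ?r" "tgt ?r = src (pb1 \<B> p f)"
    using as'(8-12) pf by simp_all
  have tr: "translation p i s f k m"
    unfolding translation_def E(2) a(4)
    using a(1,2) pf m fm la h aa ba by (simp add: m_def)
  have "free_transitive p f m"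
    unfolding free_transitive_def
  proof (intro allI impI)
    fix t x y assume xy: "x \<in> slice t f" "y \<in> slice t f"
    note x = slice_HomD[OF xy(1)] note y = slice_HomD[OF xy(2)]
    have hp: "h \<cdot> pair p f \<sigma> x = pair f f (m \<cdot> pair p f \<sigma> x) x" if \<sigma>: "\<sigma> \<in> slice t p" for \<sigma>
    proof (rule pb_ext[OF pf(2,2) refl])
      note s = slice_HomD[OF \<sigma>]
      have q: "arr (pair p f \<sigma> x)" "tgt (pair p f \<sigma> x) = src (pb1 \<B> p f)"
        "src (pair p f \<sigma> x) = src t" "pb2 \<B> p f \<cdot> pair p f \<sigma> x = x"
        using s x pf by simp_all
      note sl = slice_HomD[OF translate_slice[OF tr \<sigma> xy(1)]]
      show "pb1 \<B> f f \<cdot> h \<cdot> pair p f \<sigma> x = pb1 \<B> f f \<cdot> pair f f (m \<cdot> pair p f \<sigma> x) x"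
        using q sl x pf h by (simp add: m_def)
      show "pb2 \<B> f f \<cdot> h \<cdot> pair p f \<sigma> x = pb2 \<B> f f \<cdot> pair f f (m \<cdot> pair p f \<sigma> x) x"
        using q sl x pf h comp_reassoc[OF h(4), of "pair p f \<sigma> x"] by simp
      show "arr (h \<cdot> pair p f \<sigma> x)" "tgt (h \<cdot> pair p f \<sigma> x) = src (pb1 \<B> f f)"
        using q h pf by simp_all
      show "arr (pair f f (m \<cdot> pair p f \<sigma> x) x)"
        "tgt (pair f f (m \<cdot> pair p f \<sigma> x) x) = src (pb1 \<B> f f)"
        "src (h \<cdot> pair p f \<sigma> x) = src (pair f f (m \<cdot> pair p f \<sigma> x) x)"
        using q h pf sl x by simp_all
    qed
    let ?c = "pair f f y x"
    have c: "arr ?c" "tgt ?c = src (pb1 \<B> f f)" "src ?c = src t" "pb1 \<B> f f \<cdot> ?c = y" "pb2 \<B> f f \<cdot> ?c = x"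
      using x y pf by simp_all
    have Cj: "tgt h = src (pb1 \<B> f f)" "src h = src (pb1 \<B> p f)" using h pf by simp_all
    have hj: "h \<cdot> j \<cdot> ?c = ?c" using comp_reassoc[OF j(5), of ?c] j h(1-3) c pf by simp
    define \<sigma> where "\<sigma> = pb1 \<B> p f \<cdot> j \<cdot> ?c"
    have p2: "pb2 \<B> p f \<cdot> j \<cdot> ?c = x"
      using comp_reassoc[OF h(4), of "j \<cdot> ?c"] hj c j h(1-3) pf by simp
    have s: "\<sigma> \<in> slice t p"
      using comp_reassoc[OF pb_commute[OF pf], of "j \<cdot> ?c"] p2 c j Cj pf x unfolding \<sigma>_def
      by (simp add: slice_Hom_iff)
    have "pair p f \<sigma> x = j \<cdot> ?c"
      using pbpair_eta[OF pf, of "j \<cdot> ?c"] p2 j c Cj unfolding \<sigma>_def by simp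
    then have "m \<cdot> pair p f \<sigma> x = y"
      using hj c j h(1) Cj pf unfolding m_def by simp
    moreover have "\<tau> = \<sigma>" if "\<tau> \<in> slice t p" "m \<cdot> pair p f \<tau> x = y" for \<tau>
    proof -
      have "h \<cdot> pair p f \<tau> x = ?c" using hp[OF that(1)] that(2) by simp
      moreover have "j \<cdot> h \<cdot> pair p f \<tau> x = pair p f \<tau> x"
        using comp_reassoc[OF j(4), of "pair p f \<tau> x"] j h(1) Cj slice_HomD[OF that(1)] x pf by simp
      ultimately show ?thesis
        using slice_HomD[OF that(1)] x pf unfolding \<sigma>_def by simp
    qed
    ultimately show "\<exists>!\<sigma>. \<sigma> \<in> slice t p \<and> m \<cdot> pair p f \<sigma> x = y" using s by blast
  qed
  then show ?thesis using tr by blast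
qed

lemma iso_pullback:
  assumes "is_iso \<B> i" "arr f" "src f = tgt i" "tgt f = C"
  shows "is_pullback \<B> f (ide C) i (f \<cdot> i)"
proof -
  obtain j where j: "arr i" "arr j" "src j = tgt i" "tgt j = src i"
    "j \<cdot> i = ide (src i)" "i \<cdot> j = ide (tgt i)"
    using assms(1) by (rule is_isoE)
  have C: "C \<in> Obj \<B>" using assms by auto
  show ?thesis
  proof (rule is_pullbackI)
    fix x y assume x: "arr x" "arr y" "src x = src y" "tgt x = src f"
      "tgt y = src (ide C)" "f \<cdot> x = ide C \<cdot> y"
    have "i \<cdot> j \<cdot> x = x" using comp_reassoc[OF j(6), of x] j x assms by simp
    then show "\<exists>t. arr t \<and> src t = src y \<and> tgt t = src i \<and> i \<cdot> t = x \<and> (f \<cdot> i) \<cdot> t = y"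
      using x j assms C by (intro exI[of _ "j \<cdot> x"]) simp
  next
    fix x y assume x: "arr x" "arr y" "src x = src y" "tgt x = src i" "tgt y = src i"
      "i \<cdot> x = i \<cdot> y"
    have "j \<cdot> i \<cdot> x = x" "j \<cdot> i \<cdot> y = y"
      using comp_reassoc[OF j(5), of x] comp_reassoc[OF j(5), of y] j(1-5) x(1-5) by simp_all
    then show "x = y" unfolding x(6) by (metis)
  qed (use j assms C in simp_all)
qed

lemma flat_map_ide:
  assumes "C \<in> Obj \<B>" "B \<in> Obj \<B>"
  shows "flat_map \<B> (ide C) (ide B) = ide (flat \<B> C B)"
proof (rule kappa_mono[OF assms])
  have "copair \<B> (inl \<B> C B) (inr \<B> C B) = ide (tgt (inl \<B> C B))"
    by (rule copair_ext[OF assms]) (use assms in simp_all)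
  then show "kappa \<B> C B \<cdot> flat_map \<B> (ide C) (ide B) = kappa \<B> C B \<cdot> ide (flat \<B> C B)"
    using assms by simp
qed (use assms in simp_all)

lemma abelian_actionD:
  assumes "abelian_action \<B> C B \<xi>"
  shows "C \<in> Obj \<B>" "B \<in> Obj \<B>" "arr \<xi>" "src \<xi> = flat \<B> C B" "tgt \<xi> = B"
  using assms internal_actionD by (auto simp: abelian_action_def)

lemma semidirect_associated:
  assumes "abelian_action \<B> C B \<xi>"
  shows "associated_split_extension \<B> C B \<xi> (sd_proj \<B> C B \<xi>) (sd_ker \<B> C B \<xi>) (sd_section \<B> C B \<xi>)"
proof -
  have "\<exists>e. case e of (f, k, s) \<Rightarrow> associated_split_extension \<B> C B \<xi> f k s"
    using assms unfolding abelian_action_def by auto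
  then have "case semidirect \<B> C B \<xi> of (f, k, s) \<Rightarrow> associated_split_extension \<B> C B \<xi> f k s"
    unfolding semidirect_def by (rule someI_ex)
  then show ?thesis unfolding sd_proj_def sd_ker_def sd_section_def by (simp add: case_prod_beta)
qed

text \<open>Functoriality of the semidirect product, for a fixed acting object.\<close>

lemma split_extension_map:
  assumes "associated_split_extension \<B> C B \<xi> p i s" "arr \<xi>" "src \<xi> = flat \<B> C B" "tgt \<xi> = B"
    and "associated_split_extension \<B> C B' \<xi>' p' i' s'" "arr \<xi>'" "src \<xi>' = flat \<B> C B'" "tgt \<xi>' = B'"
    and "arr \<psi>" "src \<psi> = B" "tgt \<psi> = B'" "\<psi> \<cdot> \<xi> = \<xi>' \<cdot> flat_map \<B> (ide C) \<psi>"
  obtains h where "h \<in> slice p p'" "h \<cdot> s = s'" "h \<cdot> i = i' \<cdot> \<psi>"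
proof -
  note a = associatedD[OF assms(1)] note a' = associatedD[OF assms(5)]
  have "i' \<cdot> \<psi> \<cdot> \<xi> = copair \<B> s' i' \<cdot> kappa \<B> C B' \<cdot> flat_map \<B> (ide C) \<psi>"
    using comp_reassoc[OF a'(5), of "flat_map \<B> (ide C) \<psi>"] a'(4,6-13) assms by simp
  also have "\<dots> = copair \<B> s' (i' \<cdot> \<psi>) \<cdot> kappa \<B> C B"
    using a'(4,6-13) a(6,7) assms(9-11) by (simp add: copair_kappa_flat_map del: flat_map(4))
  finally have rel: "copair \<B> s' (i' \<cdot> \<psi>) \<cdot> kappa \<B> C B = (i' \<cdot> \<psi>) \<cdot> \<xi>"
    using a' assms by simp
  have b: "arr (i' \<cdot> \<psi>)" "src (i' \<cdot> \<psi>) = B" "tgt (i' \<cdot> \<psi>) = src p'" "p' \<cdot> i' \<cdot> \<psi> = zero \<B> B C"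
    using a' assms comp_reassoc[OF a'(15), of \<psi>] by simp_all
  obtain h where "arr h" "src h = src p" "tgt h = src p'" "p' \<cdot> h = p" "h \<cdot> s = s'" "h \<cdot> i = i' \<cdot> \<psi>"
    by (rule split_extension_universal[OF assms(1-4) a'(1,3) b rel])
  then show ?thesis using that by (simp add: slice_Hom_iff)
qed

text \<open>The addition of a split extension that is a group over \<open>C\<close> is a translation of the extension by
  itself: the conditions on a translation are instances of the unit laws.\<close>

lemma slice_abelian_group_translation:
  assumes "slice_abelian_group \<B> p s m" "is_kernel \<B> i p"
  shows "translation p i s p i m"
proof -
  note ka = kernel_arr[OF assms(2)]
  have p: "is_point \<B> p s" and m: "m \<in> slice (p \<cdot> pb1 \<B> p p) p"
    using assms(1) by (auto simp: slice_abelian_group_def)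
  note pa = point_arr[OF p] note ma = slice_HomD[OF m]
  have grp: "comm_group \<lparr>carrier = slice t p, mult = (\<lambda>x y. m \<cdot> pair p p x y), one = s \<cdot> t\<rparr>"
    if "arr t" "tgt t = tgt p" for t
    using assms(1) that by (simp add: slice_abelian_group_def)
  let ?I = "ide (src p)" and ?z = "zero \<B> (src i) (tgt p)"
  have "?I \<in> slice p p" using pa by (simp add: slice_Hom_iff)
  then have u: "m \<cdot> pair p p (s \<cdot> p) ?I = ?I"
    using monoid.l_one[OF group.is_monoid[OF comm_group.axioms(2)[OF grp[of p]]]] pa by simp
  have "i \<in> slice ?z p" using ka by (simp add: slice_Hom_iff)
  then have "m \<cdot> pair p p i (s \<cdot> ?z) = i"
    using monoid.r_one[OF group.is_monoid[OF comm_group.axioms(2)[OF grp[of ?z]]]] pa ka by simp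
  then have k: "m \<cdot> pair p p i (zero \<B> (src i) (src p)) = i" using pa ka by simp
  have "src (p \<cdot> pb1 \<B> p p) = src (pb1 \<B> p p)" using pa by simp
  then show ?thesis
    unfolding translation_def using p assms(2) pa(1) ma u k pb_commute[of p p] by simp
qed

text \<open>An abelian action comes with a group structure on some associated split extension. The chosen
  semidirect product is isomorphic to it over \<open>C\<close>, and thus carries a group structure as well.\<close>

lemma semidirect_translation:
  assumes "abelian_action \<B> C B \<xi>" "p = sd_proj \<B> C B \<xi>" "i = sd_ker \<B> C B \<xi>" "s = sd_section \<B> C B \<xi>"
  shows "\<exists>a. translation p i s p i a"
proof -
  have as: "associated_split_extension \<B> C B \<xi> p i s" using semidirect_associated[OF assms(1)] assms by simp
  note xi = abelian_actionD[OF assms(1)]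
  obtain p' i' s' m' where as': "associated_split_extension \<B> C B \<xi> p' i' s'" and m': "slice_abelian_group \<B> p' s' m'"
    using assms(1) unfolding abelian_action_def by blast
  note a = associatedD[OF as] note a' = associatedD[OF as']
  have "ide B \<cdot> \<xi> = \<xi> \<cdot> flat_map \<B> (ide C) (ide B)"
    using xi by (simp add: flat_map_ide)
  then obtain h where h: "h \<in> slice p p'" "h \<cdot> s = s'" "h \<cdot> i = i' \<cdot> ide B"
    by (rule split_extension_map[OF as xi(3-5) as' xi(3-5), rotated 3]) (use xi in simp_all)
  note ha = slice_HomD[OF h(1)]
  have "is_iso \<B> h"
    by (rule split_short_five[OF a(1) a'(1) _ a(2) a'(2) _ _ _ _ _ is_iso_ide[OF xi(2)]])
      (use ha h a(3,4) a'(3,4) xi in simp_all)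
  from iso_pullback[OF this a'(8)] have "is_pullback \<B> p' (ide C) h p" using ha a'(3) by simp
  then obtain m where "slice_abelian_group \<B> p s m"
    using slice_abelian_group_change_of_base[OF _ m' a(1)] h(2) a' by fastforce
  then show ?thesis using slice_abelian_group_translation[OF _ a(2)] by blast
qed

lemma opextD:
  assumes "opext \<B> C B \<xi> f k"
  shows "arr f" "arr k" "tgt k = src f" "src k = B" "tgt f = C" "f \<cdot> k = zero \<B> B C"
    "is_kernel \<B> k f" "is_cokernel \<B> f k" "is_regular_epi \<B> f"
    "abelian_action \<B> C B \<xi>" "\<xi> \<cdot> flat_map \<B> f (ide B) = conjugation \<B> k" "C \<in> Obj \<B>" "B \<in> Obj \<B>"
proof -
  show k: "is_kernel \<B> k f" and q: "is_cokernel \<B> f k" and e: "src k = B" "tgt f = C"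
    using assms by (auto simp: opext_def abelian_extension_def extension_def)
  show "abelian_action \<B> C B \<xi>" "\<xi> \<cdot> flat_map \<B> f (ide B) = conjugation \<B> k"
    using assms e by (auto simp: opext_def induces_def)
  show "is_regular_epi \<B> f" using cokernel_regular_epi[OF q] .
  show "arr f" "arr k" "tgt k = src f" "f \<cdot> k = zero \<B> B C" "C \<in> Obj \<B>" "B \<in> Obj \<B>"
    using kernel_arr[OF k] e by auto
qed

lemma opext_translation:
  assumes "opext \<B> C B \<xi> f k" "p = sd_proj \<B> C B \<xi>" "i = sd_ker \<B> C B \<xi>" "s = sd_section \<B> C B \<xi>"
  obtains m where "translation p i s f k m" "free_transitive p f m"
proof -
  note o = opextD[OF assms(1)]
  show ?thesis
    using induced_translation[OF semidirect_associated[OF o(10)] abelian_actionD(3-5)[OF o(10)] o(7,4,5,11)]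
      that assms(2-) by blast
qed

text \<open>The value of the Baer unit on the kernel of \<open>E\<close> follows from the unit law, so a translation has all
  the properties by which the Baer unit is described; only one arrow can have them, since kernel and
  section of \<open>S \<times>\<^sub>C E \<rightarrow> E\<close> are jointly epic.\<close>

lemma baer_unit_eq:
  assumes "translation (sd_proj \<B> C B \<xi>) (sd_ker \<B> C B \<xi>) (sd_section \<B> C B \<xi>) f k m"
    and k: "src (sd_ker \<B> C B \<xi>) = B" "arr k" "src k = B" "tgt k = src f" "f \<cdot> k = zero \<B> B (tgt f)"
  shows "baer_unit \<B> C B \<xi> f k = m"
proof -
  define p i s where "p = sd_proj \<B> C B \<xi>" and "i = sd_ker \<B> C B \<xi>" and "s = sd_section \<B> C B \<xi>"
  note D = p_def[symmetric] i_def[symmetric] s_def[symmetric]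
  have tr: "translation p i s f k m" using assms(1) unfolding D .
  note T = translationD[OF tr]
  have i: "src i = B" "B \<in> Obj \<B>" using k T(4) unfolding D by auto
  have z: "k \<in> slice (zero \<B> B (tgt f)) f" using k i T(11) by (simp add: slice_Hom_iff)
  have "m \<cdot> pair p f (s \<cdot> zero \<B> B (tgt f)) k = k" by (rule translate_unit[OF tr z])
  then have mk: "m \<cdot> pair p f (zero \<B> B (src p)) k = k" using T i by simp
  show ?thesis
    unfolding baer_unit_def Let_def D
  proof (rule the_equality)
    show "m \<in> Hom \<B> (src (pb1 \<B> p f)) (src f) \<and> f \<cdot> m = f \<cdot> pb2 \<B> p f \<and>
      m \<cdot> pair p f i (zero \<B> B (src f)) = k \<and> m \<cdot> pair p f (zero \<B> B (src p)) k = k \<and>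
      m \<cdot> pair p f (s \<cdot> f) (ide (src f)) = ide (src f)"
      using T(13-18) mk i(1) by (simp add: Hom_def)
  next
    fix n assume n: "n \<in> Hom \<B> (src (pb1 \<B> p f)) (src f) \<and> f \<cdot> n = f \<cdot> pb2 \<B> p f \<and>
      n \<cdot> pair p f i (zero \<B> B (src f)) = k \<and> n \<cdot> pair p f (zero \<B> B (src p)) k = k \<and>
      n \<cdot> pair p f (s \<cdot> f) (ide (src f)) = ide (src f)"
    show "n = m"
      by (rule pb_joint_epi[OF T(1,2,11,12)]) (use n T(13-18) i(1) in \<open>simp_all add: Hom_def\<close>)
  qed
qed

section \<open>Pulling back an abelian extension\<close>

text \<open>The pulled back action \<open>\<zeta>\<close> is associated with the pulled back semidirect product, to which the
  group structure transfers, as the Mal'tsev operation transfers to \<open>q\<close>. That \<open>\<zeta>\<close> restricts to the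
  conjugation of \<open>\<phi>\<^sup>*E'\<close> on \<open>B'\<close> is checked after the jointly monic projections to \<open>E'\<close> and \<open>C\<close>: the
  former turns the claim into the one about conjugation in \<open>E'\<close>, the latter kills both sides.\<close>

lemma opext_pullback:
  assumes "opext \<B> C' B' \<xi>' f' k'" "\<phi> \<in> Hom \<B> C C'"
  shows "opext \<B> C B' (pull_action \<B> \<phi> B' \<xi>') (pb2 \<B> f' \<phi>) (pull_ext_ker \<B> \<phi> f' k')"
proof -
  note o = opextD[OF assms(1)] note xi = abelian_actionD[OF o(10)]
  have \<phi>: "arr \<phi>" "src \<phi> = C" "tgt \<phi> = C'" "C \<in> Obj \<B>" using assms(2) by (auto simp: Hom_def)
  have fg: "arr f'" "arr \<phi>" "tgt f' = tgt \<phi>" using o \<phi> by simp_all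
  define p q j \<zeta> where "p = pb1 \<B> f' \<phi>" and "q = pb2 \<B> f' \<phi>" and "j = pull_ext_ker \<B> \<phi> f' k'"
    and "\<zeta> = pull_action \<B> \<phi> B' \<xi>'"
  have \<zeta>: "\<zeta> = \<xi>' \<cdot> flat_map \<B> \<phi> (ide B')" by (simp add: \<zeta>_def pull_action_def)
  have \<zeta>a: "arr \<zeta>" "src \<zeta> = flat \<B> C B'" "tgt \<zeta> = B'" unfolding \<zeta> using xi \<phi> by simp_all
  have pb: "is_pullback \<B> f' \<phi> p q" unfolding p_def q_def using fg by (rule pb_pullback)
  note pa = pullback_arr[OF pb]
  have j: "j = pair f' \<phi> k' (zero \<B> B' C)" unfolding j_def pull_ext_ker_def using o \<phi> by simp
  have ja: "arr j" "src j = B'" "tgt j = src p" "p \<cdot> j = k'" "q \<cdot> j = zero \<B> B' C"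
    unfolding j p_def q_def using o \<phi> fg by simp_all
  have kj: "is_kernel \<B> j q" unfolding j q_def using kernel_pb2[OF o(7) fg(2)] o \<phi> by simp
  have q: "is_regular_epi \<B> q" unfolding q_def by (rule regular_epi_pb2[OF fg o(9)])
  have ext: "abelian_extension \<B> C B' q j"
    unfolding abelian_extension_def extension_def
    using ja(2) pa \<phi>(2) kj regular_epi_cokernel[OF q kj] o(5)
      autonomous_maltsev_change_of_base[OF pb] assms(1)
    by (simp add: opext_def abelian_extension_def)
  have act: "abelian_action \<B> C B' \<zeta>"
  proof -
    obtain P I S m where as: "associated_split_extension \<B> C' B' \<xi>' P I S" and m: "slice_abelian_group \<B> P S m"
      using o(10) unfolding abelian_action_def by blast
    note a = associatedD[OF as]
    note as' = associated_pb2[OF as xi(3-5) \<phi>(1-3), folded \<zeta>]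
    have "P \<cdot> S \<cdot> \<phi> = \<phi>" using comp_reassoc[OF a(14), of \<phi>] a \<phi> by simp
    then have "pb1 \<B> P \<phi> \<cdot> pair P \<phi> (S \<cdot> \<phi>) (ide C) = S \<cdot> \<phi>" using a \<phi> by simp
    moreover have "is_pullback \<B> P \<phi> (pb1 \<B> P \<phi>) (pb2 \<B> P \<phi>)" using a \<phi> by (intro pb_pullback) simp_all
    ultimately obtain m' where "slice_abelian_group \<B> (pb2 \<B> P \<phi>) (pair P \<phi> (S \<cdot> \<phi>) (ide C)) m'"
      using slice_abelian_group_change_of_base[OF _ m associatedD(1)[OF as']] by blast
    then show ?thesis
      unfolding abelian_action_def using associated_internal_action[OF as' \<zeta>a] as' by blast
  qed
  define E where "E = src p"
  have E: "E \<in> Obj \<B>" "src p = E" "src q = E" using pa by (simp_all add: E_def)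
  note \<chi> = conjugation[OF kj ja(2) E(3)] note \<chi>' = conjugation[OF o(7,4) refl]
  have "\<zeta> \<cdot> flat_map \<B> q (ide B') = conjugation \<B> j"
  proof (rule kernel_mono[OF kj])
    have "\<zeta> \<cdot> flat_map \<B> q (ide B') = \<xi>' \<cdot> flat_map \<B> f' (ide B') \<cdot> flat_map \<B> p (ide B')"
      unfolding \<zeta> using xi \<phi> pa o by (simp add: flat_map_comp)
    also have "\<dots> = conjugation \<B> k' \<cdot> flat_map \<B> p (ide B')"
      using comp_reassoc[OF o(11), of "flat_map \<B> p (ide B')"] xi o pa by simp
    finally have c: "\<zeta> \<cdot> flat_map \<B> q (ide B') = conjugation \<B> k' \<cdot> flat_map \<B> p (ide B')" .
    have Cc: "arr (conjugation \<B> k' \<cdot> flat_map \<B> p (ide B'))"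
      "src (conjugation \<B> k' \<cdot> flat_map \<B> p (ide B')) = flat \<B> E B'"
      "tgt (conjugation \<B> k' \<cdot> flat_map \<B> p (ide B')) = B'"
      using \<chi>' pa o E by simp_all
    have K: "arr (kappa \<B> E B')" "src (kappa \<B> E B') = flat \<B> E B'" "tgt (kappa \<B> E B') = tgt (inl \<B> E B')"
      using E o by simp_all
    have Kc: "arr (copair \<B> (ide E) j \<cdot> kappa \<B> E B')"
      "src (copair \<B> (ide E) j \<cdot> kappa \<B> E B') = flat \<B> E B'"
      "tgt (copair \<B> (ide E) j \<cdot> kappa \<B> E B') = E"
      using K E ja by simp_all
    have 1: "p \<cdot> j \<cdot> conjugation \<B> k' \<cdot> flat_map \<B> p (ide B') = p \<cdot> copair \<B> (ide E) j \<cdot> kappa \<B> E B'"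
    proof -
      have "p \<cdot> j \<cdot> conjugation \<B> k' \<cdot> flat_map \<B> p (ide B') = k' \<cdot> conjugation \<B> k' \<cdot> flat_map \<B> p (ide B')"
        using comp_reassoc[OF ja(4), of "conjugation \<B> k' \<cdot> flat_map \<B> p (ide B')"] ja(1-3) pa(4) Cc by simp
      also have "\<dots> = copair \<B> (ide (src f')) k' \<cdot> kappa \<B> (src f') B' \<cdot> flat_map \<B> p (ide B')"
        using comp_reassoc[OF \<chi>'(4), of "flat_map \<B> p (ide B')"] \<chi>'(1-3) pa o by simp
      also have "\<dots> = copair \<B> p k' \<cdot> kappa \<B> E B'"
        using pa o E by (simp add: copair_kappa_flat_map del: flat_map(4))
      also have "\<dots> = p \<cdot> copair \<B> (ide E) j \<cdot> kappa \<B> E B'"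
        using pa ja E K by (simp add: comp_copair_reassoc)
      finally show ?thesis .
    qed
    have 2: "q \<cdot> j \<cdot> conjugation \<B> k' \<cdot> flat_map \<B> p (ide B') = q \<cdot> copair \<B> (ide E) j \<cdot> kappa \<B> E B'"
    proof -
      have "q \<cdot> j \<cdot> conjugation \<B> k' \<cdot> flat_map \<B> p (ide B') = zero \<B> (flat \<B> E B') C"
        using comp_reassoc[OF ja(5), of "conjugation \<B> k' \<cdot> flat_map \<B> p (ide B')"] ja(1-3) pa Cc \<phi> E by simp
      also have "\<dots> = q \<cdot> copair \<B> (ide E) (zero \<B> B' E) \<cdot> kappa \<B> E B'"
        using E o(13) pa \<phi> by simp
      also have "\<dots> = copair \<B> q (zero \<B> B' C) \<cdot> kappa \<B> E B'"
        using E o(13) pa \<phi> K by (simp add: comp_copair_reassoc del: kappa_arr(5))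
      also have "\<dots> = q \<cdot> copair \<B> (ide E) j \<cdot> kappa \<B> E B'"
        using pa ja E K \<phi> by (simp add: comp_copair_reassoc)
      finally show ?thesis .
    qed
    show "j \<cdot> \<zeta> \<cdot> flat_map \<B> q (ide B') = j \<cdot> conjugation \<B> j"
      unfolding c \<chi>(4)
      by (rule pullback_ext[OF pb _ _ _ _ _ 1 2]) (use Cc Kc ja E in simp_all)
    show "arr (\<zeta> \<cdot> flat_map \<B> q (ide B'))" "src (\<zeta> \<cdot> flat_map \<B> q (ide B')) = src (conjugation \<B> j)"
      "tgt (\<zeta> \<cdot> flat_map \<B> q (ide B')) = src j"
      unfolding c using Cc \<chi> ja by simp_all
  qed (use \<chi> ja in simp_all)
  then have "induces \<B> q j \<zeta>"
    unfolding induces_def using act pa ja \<phi> by simp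
  then show ?thesis using ext unfolding opext_def p_def q_def j_def \<zeta>_def by blast
qed

section \<open>Opcartesian morphisms\<close>

lemma ext_Hom_over:
  assumes "arr f" "tgt f = C"
  shows "e \<in> ext_Hom \<B> f k g l (ide C) \<psi> \<longleftrightarrow> e \<in> slice f g \<and> e \<cdot> k = l \<cdot> \<psi>"
  using assms by (auto simp: ext_Hom_def slice_Hom_def)

text \<open>Locally on \<open>C\<close>, that is after choosing a generalised element \<open>e\<close> of \<open>E\<close>, each \<open>x\<close> in \<open>G\<close> over
  the same element of \<open>C\<close> is the translate of \<open>u \<cdot> e\<close> by a unique \<open>\<sigma>\<close>. So an arrow \<open>t\<close> with
  \<open>t \<cdot> u = v\<close> that restricts to \<open>\<psi>\<close> on the kernels must send \<open>x\<close> to the translate of \<open>v \<cdot> e\<close> by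
  the image of \<open>\<sigma>\<close>. This does not depend on the choice of \<open>e\<close>, hence descends from \<open>E \<times>\<^sub>C G\<close> along the
  regular epimorphism \<open>E \<times>\<^sub>C G \<rightarrow> G\<close>.\<close>

lemma opcartesian_extension:
  assumes "opext \<B> C B \<xi> f k" "opext \<B> C B' \<zeta> g l" "opext \<B> C D \<omega> g' l'"
    and \<phi>: "arr \<phi>" "src \<phi> = B" "tgt \<phi> = B'" "\<phi> \<cdot> \<xi> = \<zeta> \<cdot> flat_map \<B> (ide C) \<phi>"
    and \<psi>: "arr \<psi>" "src \<psi> = B'" "tgt \<psi> = D" "\<psi> \<cdot> \<zeta> = \<omega> \<cdot> flat_map \<B> (ide C) \<psi>"
    and u: "u \<in> slice f g" "u \<cdot> k = l \<cdot> \<phi>"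
    and v: "v \<in> slice f g'" "v \<cdot> k = l' \<cdot> \<psi> \<cdot> \<phi>"
  shows "\<exists>!t. (t \<in> slice g g' \<and> t \<cdot> l = l' \<cdot> \<psi>) \<and> t \<cdot> u = v"
proof -
  note F = opextD[OF assms(1)] note G = opextD[OF assms(2)] note G' = opextD[OF assms(3)]
  define p i s where "p = sd_proj \<B> C B \<xi>" and "i = sd_ker \<B> C B \<xi>" and "s = sd_section \<B> C B \<xi>"
  define p\<^sub>1 i\<^sub>1 s\<^sub>1 where "p\<^sub>1 = sd_proj \<B> C B' \<zeta>" and "i\<^sub>1 = sd_ker \<B> C B' \<zeta>" and "s\<^sub>1 = sd_section \<B> C B' \<zeta>"
  define p\<^sub>2 i\<^sub>2 s\<^sub>2 where "p\<^sub>2 = sd_proj \<B> C D \<omega>" and "i\<^sub>2 = sd_ker \<B> C D \<omega>" and "s\<^sub>2 = sd_section \<B> C D \<omega>"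
  note D = p_def i_def s_def note D1 = p\<^sub>1_def i\<^sub>1_def s\<^sub>1_def note D2 = p\<^sub>2_def i\<^sub>2_def s\<^sub>2_def
  note S = semidirect_associated[OF F(10), folded D]
  note S1 = semidirect_associated[OF G(10), folded D1]
  note S2 = semidirect_associated[OF G'(10), folded D2]
  note a = associatedD[OF S] note a1 = associatedD[OF S1] note a2 = associatedD[OF S2]
  obtain m where m: "translation p i s f k m" "free_transitive p f m"
    by (rule opext_translation[OF assms(1) D])
  obtain m\<^sub>1 where m1: "translation p\<^sub>1 i\<^sub>1 s\<^sub>1 g l m\<^sub>1" "free_transitive p\<^sub>1 g m\<^sub>1"
    by (rule opext_translation[OF assms(2) D1])
  obtain m\<^sub>2 where m2: "translation p\<^sub>2 i\<^sub>2 s\<^sub>2 g' l' m\<^sub>2"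
    by (rule opext_translation[OF assms(3) D2])
  obtain b\<^sub>1 where b1: "translation p\<^sub>1 i\<^sub>1 s\<^sub>1 p\<^sub>1 i\<^sub>1 b\<^sub>1" using semidirect_translation[OF G(10) D1] by blast
  obtain b\<^sub>2 where b2: "translation p\<^sub>2 i\<^sub>2 s\<^sub>2 p\<^sub>2 i\<^sub>2 b\<^sub>2" using semidirect_translation[OF G'(10) D2] by blast
  obtain h where h: "h \<in> slice p p\<^sub>1" "h \<cdot> s = s\<^sub>1" "h \<cdot> i = i\<^sub>1 \<cdot> \<phi>"
    by (rule split_extension_map[OF S abelian_actionD(3-5)[OF F(10)] S1 abelian_actionD(3-5)[OF G(10)] \<phi>])
  obtain h' where h': "h' \<in> slice p\<^sub>1 p\<^sub>2" "h' \<cdot> s\<^sub>1 = s\<^sub>2" "h' \<cdot> i\<^sub>1 = i\<^sub>2 \<cdot> \<psi>"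
    by (rule split_extension_map[OF S1 abelian_actionD(3-5)[OF G(10)] S2 abelian_actionD(3-5)[OF G'(10)] \<psi>])
  note ha = slice_HomD[OF h(1)] note h'a = slice_HomD[OF h'(1)]
  note ua = slice_HomD[OF u(1)] note va = slice_HomD[OF v(1)]
  have hh: "h' \<cdot> h \<in> slice p p\<^sub>2" "(h' \<cdot> h) \<cdot> s = s\<^sub>2" "(h' \<cdot> h) \<cdot> i = i\<^sub>2 \<cdot> \<psi> \<cdot> \<phi>"
  proof -
    show "h' \<cdot> h \<in> slice p p\<^sub>2" by (rule slice_trans[OF h(1) h'(1) a2(8)])
    show "(h' \<cdot> h) \<cdot> s = s\<^sub>2" using h h' ha h'a a(8-12) by simp
    show "(h' \<cdot> h) \<cdot> i = i\<^sub>2 \<cdot> \<psi> \<cdot> \<phi>"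
      using h(3) ha h'a a(8-12) a1(4,8-12) a2(4,8-12) \<phi> \<psi> comp_reassoc[OF h'(3), of \<phi>] by simp
  qed
  let ?e = "pb1 \<B> f g" and ?x = "pb2 \<B> f g"
  have fg: "arr f" "arr g" "tgt f = tgt g" using F G by simp_all
  define t where "t = g \<cdot> ?x"
  have t: "arr t" "src t = src ?x" using fg by (simp_all add: t_def)
  have e: "?e \<in> slice t f" and x: "?x \<in> slice t g"
    using fg pb_commute[OF fg] unfolding t_def by (simp_all add: slice_Hom_iff)
  have ue: "u \<cdot> ?e \<in> slice t g" by (rule slice_trans[OF e u(1) fg(2)])
  have ve: "v \<cdot> ?e \<in> slice t g'" by (rule slice_trans[OF e v(1) G'(1)])
  obtain \<sigma> where \<sigma>: "\<sigma> \<in> slice t p\<^sub>1" "m\<^sub>1 \<cdot> pair p\<^sub>1 g \<sigma> (u \<cdot> ?e) = ?x"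
    using m1(2) ue x unfolding free_transitive_def by metis
  have h\<sigma>: "h' \<cdot> \<sigma> \<in> slice t p\<^sub>2" by (rule slice_trans[OF \<sigma>(1) h'(1) a2(8)])
  define w where "w = m\<^sub>2 \<cdot> pair p\<^sub>2 g' (h' \<cdot> \<sigma>) (v \<cdot> ?e)"
  have w: "w \<in> slice t g'" unfolding w_def by (rule translate_slice[OF m2 h\<sigma> ve])
  note wa = slice_HomD[OF w] note \<sigma>a = slice_HomD[OF \<sigma>(1)]
  have w_comp: "w \<cdot> c = m\<^sub>2 \<cdot> pair p\<^sub>2 g' (h' \<cdot> \<sigma> \<cdot> c) (v \<cdot> ?e \<cdot> c)"
    and \<sigma>_comp: "\<sigma> \<cdot> c \<in> slice (t \<cdot> c) p\<^sub>1" "?e \<cdot> c \<in> slice (t \<cdot> c) f"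
      "m\<^sub>1 \<cdot> pair p\<^sub>1 g (\<sigma> \<cdot> c) (u \<cdot> ?e \<cdot> c) = ?x \<cdot> c"
    if c: "arr c" "tgt c = src t" for c
  proof -
    have r: "(h' \<cdot> \<sigma>) \<cdot> c = h' \<cdot> \<sigma> \<cdot> c" "(v \<cdot> ?e) \<cdot> c = v \<cdot> ?e \<cdot> c" "(u \<cdot> ?e) \<cdot> c = u \<cdot> ?e \<cdot> c"
      using c h'a \<sigma>a va ua t fg by simp_all
    show "w \<cdot> c = m\<^sub>2 \<cdot> pair p\<^sub>2 g' (h' \<cdot> \<sigma> \<cdot> c) (v \<cdot> ?e \<cdot> c)"
      unfolding w_def translate_comp[OF m2 h\<sigma> ve c] r ..
    show "\<sigma> \<cdot> c \<in> slice (t \<cdot> c) p\<^sub>1" "?e \<cdot> c \<in> slice (t \<cdot> c) f"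
      using slice_comp[OF \<sigma>(1) a1(8) c] slice_comp[OF e fg(1) c] .
    show "m\<^sub>1 \<cdot> pair p\<^sub>1 g (\<sigma> \<cdot> c) (u \<cdot> ?e \<cdot> c) = ?x \<cdot> c"
      using translate_comp[OF m1(1) \<sigma>(1) ue c] unfolding \<sigma>(2) r by simp
  qed
  \<comment> \<open>as the translation of \<open>G\<close> is free, \<open>\<sigma>\<close> takes the value \<open>\<tau>\<close> at the element \<open>(y, z)\<close> of \<open>E \<times>\<^sub>C G\<close>\<close>
  have w_pair: "w \<cdot> pair f g y z = m\<^sub>2 \<cdot> pair p\<^sub>2 g' (h' \<cdot> \<tau>) (v \<cdot> y)"
    if y: "y \<in> slice r f" "\<tau> \<in> slice r p\<^sub>1" "z = m\<^sub>1 \<cdot> pair p\<^sub>1 g \<tau> (u \<cdot> y)" for r y z \<tau>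
  proof -
    have uy: "u \<cdot> y \<in> slice r g" by (rule slice_trans[OF y(1) u(1) fg(2)])
    note za = translate_slice[OF m1(1) y(2) uy, folded y(3)]
    let ?c = "pair f g y z"
    have c: "arr ?c" "tgt ?c = src t" "src ?c = src r" "?e \<cdot> ?c = y" "?x \<cdot> ?c = z"
      using fg slice_HomD[OF y(1)] slice_HomD[OF za] t by simp_all
    have tc: "t \<cdot> ?c = r" unfolding t_def using c fg slice_HomD[OF za] t by simp
    have "\<sigma> \<cdot> ?c = \<tau>"
      by (rule translate_cancel[OF m1(2) uy])
        (use \<sigma>_comp[OF c(1,2)] y za c tc in simp_all)
    then show ?thesis using w_comp[OF c(1,2)] c(4) by simp
  qed
  let ?a = "pb1 \<B> ?x ?x" and ?b = "pb2 \<B> ?x ?x"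
  have ab: "arr ?a" "tgt ?a = src t" "arr ?b" "tgt ?b = src t" "?x \<cdot> ?a = ?x \<cdot> ?b"
    using fg t pb_commute[of ?x ?x] by simp_all
  have xr: "is_regular_epi \<B> ?x" by (rule regular_epi_pb2[OF fg F(9)])
  \<comment> \<open>replacing \<open>e\<close> by its translate by \<open>\<tau>\<close> changes \<open>\<sigma>\<close> by the image of \<open>\<tau>\<close>, and \<open>v \<cdot> e\<close> by the image in
    the third semidirect product; the two changes cancel in \<open>w\<close>\<close>
  have wab: "w \<cdot> ?a = w \<cdot> ?b"
  proof -
    define r where "r = t \<cdot> ?a"
    have tb: "t \<cdot> ?b = r"
    proof -
      have d: "arr ?x" "src g = tgt ?x" "src ?x = tgt ?a" "src ?x = tgt ?b" using fg ab(2,4) t by simp_all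
      show ?thesis
        unfolding r_def t_def comp_assoc[OF ab(3) d(1) fg(2) d(4,2)] comp_assoc[OF ab(1) d(1) fg(2) d(3,2)] ab(5) ..
    qed
    note A = \<sigma>_comp[OF ab(1,2), folded r_def] note B = \<sigma>_comp[OF ab(3,4), unfolded tb]
    obtain \<tau> where \<tau>: "\<tau> \<in> slice r p" "m \<cdot> pair p f \<tau> (?e \<cdot> ?a) = ?e \<cdot> ?b"
      using m(2) A(2) B(2) unfolding free_transitive_def by metis
    have h\<tau>: "h \<cdot> \<tau> \<in> slice r p\<^sub>1" by (rule slice_trans[OF \<tau>(1) h(1) a1(8)])
    have uea: "u \<cdot> ?e \<cdot> ?a \<in> slice r g" by (rule slice_trans[OF A(2) u(1) fg(2)])
    have vea: "v \<cdot> ?e \<cdot> ?a \<in> slice r g'" by (rule slice_trans[OF A(2) v(1) G'(1)])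
    have ub: "u \<cdot> ?e \<cdot> ?b = m\<^sub>1 \<cdot> pair p\<^sub>1 g (h \<cdot> \<tau>) (u \<cdot> ?e \<cdot> ?a)"
      using translate_natural[OF m(1) m1(1) h \<phi>(1) _ _ u \<tau>(1) A(2)] \<tau>(2) \<phi> a a1 by simp
    have vb: "v \<cdot> ?e \<cdot> ?b = m\<^sub>2 \<cdot> pair p\<^sub>2 g' ((h' \<cdot> h) \<cdot> \<tau>) (v \<cdot> ?e \<cdot> ?a)"
      using translate_natural[OF m(1) m2 hh _ _ _ v \<tau>(1) A(2)] \<tau>(2) \<phi> \<psi> a a2 by simp
    have r: "(h' \<cdot> h) \<cdot> \<tau> = h' \<cdot> h \<cdot> \<tau>" using slice_HomD[OF \<tau>(1)] ha h'a by simp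
    have "m\<^sub>1 \<cdot> pair p\<^sub>1 g (\<sigma> \<cdot> ?a) (u \<cdot> ?e \<cdot> ?a) =
        m\<^sub>1 \<cdot> pair p\<^sub>1 g (b\<^sub>1 \<cdot> pair p\<^sub>1 p\<^sub>1 (\<sigma> \<cdot> ?b) (h \<cdot> \<tau>)) (u \<cdot> ?e \<cdot> ?a)"
      using translate_assoc[OF m1(1) b1 B(1) h\<tau> uea] A(3) B(3) ab(5) unfolding ub by simp
    then have \<sigma>a: "\<sigma> \<cdot> ?a = b\<^sub>1 \<cdot> pair p\<^sub>1 p\<^sub>1 (\<sigma> \<cdot> ?b) (h \<cdot> \<tau>)"
      by (rule translate_cancel[OF m1(2) uea A(1) translate_slice[OF b1 B(1) h\<tau>]])
        (rule translate_slice[OF m1(1) A(1) uea])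
    have "h' \<cdot> \<sigma> \<cdot> ?a = b\<^sub>2 \<cdot> pair p\<^sub>2 p\<^sub>2 (h' \<cdot> \<sigma> \<cdot> ?b) (h' \<cdot> h \<cdot> \<tau>)"
      unfolding \<sigma>a using translate_natural[OF b1 b2 h' \<psi>(1) _ _ h'(1,3) B(1) h\<tau>] \<psi> a1 a2 by simp
    then show ?thesis
      unfolding w_comp[OF ab(1,2)] w_comp[OF ab(3,4)] vb r
      using translate_assoc[OF m2 b2 slice_trans[OF B(1) h'(1) a2(8)] slice_trans[OF h\<tau> h'(1) a2(8)] vea]
      by simp
  qed
  have "src w = src ?x" using wa(2) t(2) by simp
  from regular_epi_descent[OF xr wa(1) this wab]
  obtain n where n: "arr n" "src n = tgt ?x" "tgt n = tgt w" "n \<cdot> ?x = w" .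
  have nD: "src n = src g" "tgt n = src g'" using n wa fg by simp_all
  have "g' \<cdot> n = g"
    by (rule regular_epi_epi[OF xr]) (use n nD wa(4) t_def fg G' in simp_all)
  then have ns: "n \<in> slice g g'" using n nD by (simp add: slice_Hom_iff)
  have n_pair: "n \<cdot> z = m\<^sub>2 \<cdot> pair p\<^sub>2 g' (h' \<cdot> \<tau>) (v \<cdot> y)"
    if y: "y \<in> slice r f" "\<tau> \<in> slice r p\<^sub>1" "z = m\<^sub>1 \<cdot> pair p\<^sub>1 g \<tau> (u \<cdot> y)" for r y z \<tau>
  proof -
    note za = translate_slice[OF m1(1) y(2) slice_trans[OF y(1) u(1) fg(2)], folded y(3)]
    have c: "arr (pair f g y z)" "tgt (pair f g y z) = src ?x" "?x \<cdot> pair f g y z = z"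
      using fg slice_HomD[OF y(1)] slice_HomD[OF za] by simp_all
    have "n \<cdot> z = w \<cdot> pair f g y z"
      using comp_reassoc[OF n(4) _ n(1,2) c(1,2)] c(3) fg by simp
    then show ?thesis using w_pair[OF y] by simp
  qed
  have nu: "n \<cdot> u = v"
  proof -
    have y: "ide (src f) \<in> slice f f" "s\<^sub>1 \<cdot> f \<in> slice f p\<^sub>1"
      using fg F(5) a1 comp_reassoc[OF a1(14), of f] by (simp_all add: slice_Hom_iff)
    have "u = m\<^sub>1 \<cdot> pair p\<^sub>1 g (s\<^sub>1 \<cdot> f) (u \<cdot> ide (src f))"
      using translate_unit[OF m1(1) u(1)] ua by simp
    note n_pair[OF y this]
    moreover have "h' \<cdot> s\<^sub>1 \<cdot> f = s\<^sub>2 \<cdot> f" using comp_reassoc[OF h'(2), of f] a1 h'a F by simp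
    ultimately show ?thesis using translate_unit[OF m2 v(1)] va by simp
  qed
  have nl: "n \<cdot> l = l' \<cdot> \<psi>"
  proof -
    let ?z = "zero \<B> B' C" and ?y = "zero \<B> B' (src f)"
    have y: "?y \<in> slice ?z f" "i\<^sub>1 \<in> slice ?z p\<^sub>1" "l \<in> slice ?z g"
      using F G a1 by (simp_all add: slice_Hom_iff)
    have "l = m\<^sub>1 \<cdot> pair p\<^sub>1 g i\<^sub>1 (u \<cdot> ?y)"
      using translationD(17)[OF m1(1)] ua F G a1(4) by simp
    note n_pair[OF y(1,2) this]
    also have "m\<^sub>2 \<cdot> pair p\<^sub>2 g' (h' \<cdot> i\<^sub>1) (v \<cdot> ?y) = l' \<cdot> \<psi>"
    proof -
      have z: "p\<^sub>2 \<cdot> i\<^sub>2 = g' \<cdot> zero \<B> D (src g')" using a2 G' by simp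
      have "pair p\<^sub>2 g' (i\<^sub>2 \<cdot> \<psi>) (zero \<B> B' (src g')) = pair p\<^sub>2 g' i\<^sub>2 (zero \<B> D (src g')) \<cdot> \<psi>"
        using z a2(3,4,8-12) G' G(13) \<psi> by (subst pbpair_comp) simp_all
      moreover have "m\<^sub>2 \<cdot> pair p\<^sub>2 g' i\<^sub>2 (zero \<B> D (src g')) \<cdot> \<psi> = l' \<cdot> \<psi>"
        using comp_reassoc[OF translationD(17)[OF m2], of \<psi>] translationD(13,14)[OF m2] z a2(3,4,8-12) G' \<psi>
        by simp
      ultimately show ?thesis using va F G(13) h'(3) by simp
    qed
    finally show ?thesis .
  qed
  show ?thesis
  proof (rule ex1I[of _ n])
    show "(n \<in> slice g g' \<and> n \<cdot> l = l' \<cdot> \<psi>) \<and> n \<cdot> u = v" using ns nl nu by blast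
    fix n' assume n': "(n' \<in> slice g g' \<and> n' \<cdot> l = l' \<cdot> \<psi>) \<and> n' \<cdot> u = v"
    then have n's: "n' \<in> slice g g'" "n' \<cdot> l = l' \<cdot> \<psi>" "n' \<cdot> u = v" by auto
    note n'a = slice_HomD[OF n's(1)]
    have "n' \<cdot> u \<cdot> ?e = v \<cdot> ?e" using comp_reassoc[OF n's(3), of ?e] ua n'a fg by simp
    then have "n' \<cdot> ?x = w"
      using translate_natural[OF m1(1) m2 h' \<psi>(1) _ _ n's(1,2) \<sigma>(1) ue] \<psi> a1 a2 \<sigma>(2) unfolding w_def by simp
    then show "n' = n"
      by (intro regular_epi_epi[OF xr, of n' n]) (use n'a n fg in simp_all)
  qed
qed

lemma opcartesian_liftingI:
  assumes "opext \<B> C B \<xi> f k" "opext \<B> C B' \<zeta> g l"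
    and \<phi>: "arr \<phi>" "src \<phi> = B" "tgt \<phi> = B'" "\<phi> \<cdot> \<xi> = \<zeta> \<cdot> flat_map \<B> (ide C) \<phi>"
    and u: "u \<in> ext_Hom \<B> f k g l (ide C) \<phi>"
  shows "opcartesian_lifting \<B> C f k B' \<zeta> \<phi> g l u"
  unfolding opcartesian_lifting_def
proof (intro conjI allI impI)
  show "opext \<B> C B' \<zeta> g l" "u \<in> ext_Hom \<B> f k g l (ide C) \<phi>" by fact+
  note F = opextD[OF assms(1)] note G = opextD[OF assms(2)]
  fix D \<omega> \<psi> g' l' v
  assume A: "opext \<B> C D \<omega> g' l' \<and> abelian_action_morphism \<B> C B' \<zeta> C D \<omega> (ide C) \<psi> \<and>
        v \<in> ext_Hom \<B> f k g' l' (ide C) (\<psi> \<cdot> \<phi>)"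
  then have \<psi>: "arr \<psi>" "src \<psi> = B'" "tgt \<psi> = D" "\<psi> \<cdot> \<zeta> = \<omega> \<cdot> flat_map \<B> (ide C) \<psi>"
    by (auto simp: abelian_action_morphism_def Hom_def)
  have "v \<in> slice f g'" "v \<cdot> k = l' \<cdot> \<psi> \<cdot> \<phi>" "u \<in> slice f g" "u \<cdot> k = l \<cdot> \<phi>"
    using A u unfolding ext_Hom_over[OF F(1,5)] by auto
  then show "\<exists>!t. t \<in> ext_Hom \<B> g l g' l' (ide C) \<psi> \<and> t \<cdot> u = v"
    unfolding ext_Hom_over[OF G(1,5)] using opcartesian_extension[OF assms(1,2) _ \<phi> \<psi>] A by blast
qed

text \<open>Both \<open>u\<close> and \<open>u'\<close> are opcartesian over \<open>\<phi>\<close>, so each factors uniquely through the other.\<close>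

lemma opcartesian_codomains_isomorphic:
  assumes "opext \<B> C B \<xi> f k" "opext \<B> C B' \<zeta> g l" "opext \<B> C B' \<zeta> q j"
    and \<phi>: "arr \<phi>" "src \<phi> = B" "tgt \<phi> = B'" "\<phi> \<cdot> \<xi> = \<zeta> \<cdot> flat_map \<B> (ide C) \<phi>"
    and u: "u \<in> ext_Hom \<B> f k g l (ide C) \<phi>" and u': "u' \<in> ext_Hom \<B> f k q j (ide C) \<phi>"
  shows "opext_isomorphic \<B> C B' \<zeta> q j g l"
proof -
  note F = opextD[OF assms(1)] note G = opextD[OF assms(2)] note Q = opextD[OF assms(3)]
  note z = abelian_actionD[OF G(10)]
  have id: "arr (ide B')" "src (ide B') = B'" "tgt (ide B') = B'"
      "ide B' \<cdot> \<zeta> = \<zeta> \<cdot> flat_map \<B> (ide C) (ide B')"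
    using z by (simp_all add: flat_map_ide)
  have id\<phi>: "ide B' \<cdot> \<phi> = \<phi>" using \<phi> by simp
  have U: "u \<in> slice f g" "u \<cdot> k = l \<cdot> \<phi>" "u' \<in> slice f q" "u' \<cdot> k = j \<cdot> \<phi>"
    using u u' unfolding ext_Hom_over[OF F(1,5)] by auto
  note ua = slice_HomD[OF U(1)] note u'a = slice_HomD[OF U(3)]
  note car = opcartesian_extension[OF assms(1) _ _ \<phi> id, unfolded id\<phi>]
  obtain t where t: "t \<in> slice q g" "t \<cdot> j = l \<cdot> ide B'" "t \<cdot> u' = u"
    using car[OF assms(3,2) U(3,4,1,2)] by blast
  obtain t' where t': "t' \<in> slice g q" "t' \<cdot> l = j \<cdot> ide B'" "t' \<cdot> u = u'"
    using car[OF assms(2,3) U] by blast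
  note ta = slice_HomD[OF t(1)] note t'a = slice_HomD[OF t'(1)]
  have tj: "t \<cdot> j = l" "t' \<cdot> l = j" using t(2) t'(2) G Q by simp_all
  have "t' \<cdot> t = ide (src q)"
  proof -
    have "(t' \<cdot> t) \<cdot> u' = u'" "(t' \<cdot> t) \<cdot> j = j \<cdot> ide B'"
      using ta(1-3) t'a(1-3) u'a(1-3) t(3) t'(3) Q(2-4,13) tj by simp_all
    moreover have "ide (src q) \<in> slice q q" "ide (src q) \<cdot> j = j \<cdot> ide B'"
      "ide (src q) \<cdot> u' = u'"
      using Q u'a by (simp_all add: slice_Hom_iff)
    ultimately show ?thesis
      using car[OF assms(3,3) U(3,4,3,4)] slice_trans[OF t(1) t'(1) Q(1)] by blast
  qed
  moreover have "t \<cdot> t' = ide (src g)"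
  proof -
    have "(t \<cdot> t') \<cdot> u = u" "(t \<cdot> t') \<cdot> l = l \<cdot> ide B'"
      using ta(1-3) t'a(1-3) ua(1-3) t(3) t'(3) G(2-4,13) tj by simp_all
    moreover have "ide (src g) \<in> slice g g" "ide (src g) \<cdot> l = l \<cdot> ide B'"
      "ide (src g) \<cdot> u = u"
      using G ua by (simp_all add: slice_Hom_iff)
    ultimately show ?thesis
      using car[OF assms(2,2) U(1,2,1,2)] slice_trans[OF t'(1) t(1) G(1)] by blast
  qed
  ultimately have "is_iso \<B> t" using ta t'a by (intro is_isoI[of t t']) simp_all
  moreover have "t \<in> ext_Hom \<B> q j g l (ide C) (ide B')"
    using t unfolding ext_Hom_over[OF Q(1,5)] by blast
  ultimately show ?thesis
    unfolding opext_isomorphic_def using assms(2,3) by blast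
qed

lemma isomorphic_extension_ext_Hom:
  assumes "opext_isomorphic \<B> C B' \<zeta> q j g l" "arr f" "tgt f = C" "arr k" "tgt k = src f"
    and "arr \<phi>" "tgt \<phi> = B'" "u \<in> ext_Hom \<B> f k g l (ide C) \<phi>"
  shows "ext_Hom \<B> f k q j (ide C) \<phi> \<noteq> {}"
proof -
  obtain h where o: "opext \<B> C B' \<zeta> q j" "opext \<B> C B' \<zeta> g l" and h: "h \<in> ext_Hom \<B> q j g l (ide C) (ide B')" "is_iso \<B> h"
    using assms(1) unfolding opext_isomorphic_def by blast
  note Q = opextD[OF o(1)] note G = opextD[OF o(2)]
  have h1: "h \<in> slice q g" "h \<cdot> j = l" using h Q G unfolding ext_Hom_over[OF Q(1,5)] by simp_all
  note ha = slice_HomD[OF h1(1)]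
  have u: "u \<in> slice f g" "u \<cdot> k = l \<cdot> \<phi>" using assms unfolding ext_Hom_over[OF assms(2,3)] by simp_all
  note ua = slice_HomD[OF u(1)]
  obtain h' where h': "arr h'" "src h' = tgt h" "tgt h' = src h" "h' \<cdot> h = ide (src h)"
    "h \<cdot> h' = ide (tgt h)"
    using h(2) by (rule is_isoE)
  have "q \<cdot> h' = g" using comp_reassoc[OF ha(4), of h'] ha h' Q G by simp
  then have 1: "h' \<in> slice g q" using h' ha by (simp add: slice_Hom_iff)
  have 2: "h' \<cdot> l = j" using comp_reassoc[OF h'(4), of j] ha h' Q h1(2) by simp
  have "(h' \<cdot> u) \<cdot> k = j \<cdot> \<phi>"
    using comp_reassoc[OF 2, of \<phi>] u(2) ua h' ha assms G by simp
  then have "h' \<cdot> u \<in> ext_Hom \<B> f k q j (ide C) \<phi>"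
    unfolding ext_Hom_over[OF assms(2,3)] using slice_trans[OF u(1) 1 Q(1)] by blast
  then show ?thesis by blast
qed

section \<open>The action of the automorphisms of the semidirect product\<close>

lemma opext_pi1_group:
  assumes "abelian_action \<B> C B \<xi>"
  shows "group (opext_pi1 \<B> C B \<xi>)"
proof -
  define p i s where "p = sd_proj \<B> C B \<xi>" and "i = sd_ker \<B> C B \<xi>" and "s = sd_section \<B> C B \<xi>"
  note D = p_def[symmetric] i_def[symmetric] s_def[symmetric]
  note a = associatedD[OF semidirect_associated[OF assms], unfolded D]
  have eq: "opext_pi1 \<B> C B \<xi> = \<lparr>carrier = {\<gamma> \<in> slice p p. \<gamma> \<cdot> i = i \<and> is_iso \<B> \<gamma>},
      mult = (\<lambda>\<gamma> \<delta>. \<gamma> \<cdot> \<delta>), one = ide (src p)\<rparr>"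
    unfolding opext_pi1_def Let_def D using a by (auto simp: ext_Hom_over)
  show ?thesis
    unfolding eq
  proof (rule groupI, simp_all)
    fix x y z assume x: "x \<in> slice p p \<and> x \<cdot> i = i \<and> is_iso \<B> x"
      and y: "y \<in> slice p p \<and> y \<cdot> i = i \<and> is_iso \<B> y"
    then have xs: "x \<in> slice p p" "y \<in> slice p p" by auto
    note xa = slice_HomD[OF xs(1)] slice_HomD[OF xs(2)]
    obtain x' where x': "arr x'" "src x' = tgt x" "tgt x' = src x" "x' \<cdot> x = ide (src x)"
      "x \<cdot> x' = ide (tgt x)" using x is_isoE by metis
    obtain y' where y': "arr y'" "src y' = tgt y" "tgt y' = src y" "y' \<cdot> y = ide (src y)"
      "y \<cdot> y' = ide (tgt y)" using y is_isoE by metis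
    have "is_iso \<B> (x \<cdot> y)"
    proof (rule is_isoI[of _ "y' \<cdot> x'"])
      show "(y' \<cdot> x') \<cdot> x \<cdot> y = ide (src (x \<cdot> y))"
        using comp_reassoc[OF x'(4), of y] xa(1-3,5-7) x'(1-3) y' by simp
      show "(x \<cdot> y) \<cdot> y' \<cdot> x' = ide (tgt (x \<cdot> y))"
        using comp_reassoc[OF y'(5), of x'] xa(1-3,5-7) x' y'(1-3) by simp
    qed (use xa x' y' in simp_all)
    moreover have "(x \<cdot> y) \<cdot> i = i" using x y xa a by simp
    ultimately show "x \<cdot> y \<in> slice p p \<and> (x \<cdot> y) \<cdot> i = i \<and> is_iso \<B> (x \<cdot> y)"
      using slice_trans[OF xs(2,1) a(8)] by blast
  next
    show "ide (src p) \<in> slice p p \<and> ide (src p) \<cdot> i = i \<and> is_iso \<B> (ide (src p))"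
      using a by (simp add: slice_Hom_iff is_iso_ide)
  next
    fix x y z assume "x \<in> slice p p \<and> x \<cdot> i = i \<and> is_iso \<B> x"
      "y \<in> slice p p \<and> y \<cdot> i = i \<and> is_iso \<B> y" "z \<in> slice p p \<and> z \<cdot> i = i \<and> is_iso \<B> z"
    then show "(x \<cdot> y) \<cdot> z = x \<cdot> y \<cdot> z" by (auto simp: slice_Hom_iff)
  next
    fix x assume x: "x \<in> slice p p \<and> x \<cdot> i = i \<and> is_iso \<B> x"
    then have "x \<in> slice p p" by auto
    note xa = slice_HomD[OF this]
    then show "ide (src p) \<cdot> x = x" by simp
    obtain x' where x': "arr x'" "src x' = tgt x" "tgt x' = src x" "x' \<cdot> x = ide (src x)"
      "x \<cdot> x' = ide (tgt x)" using x is_isoE by metis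
    have "p \<cdot> x' = p" using comp_reassoc[OF xa(4), of x'] xa x' a(8) by simp
    moreover have "x' \<cdot> i = i" using comp_reassoc[OF x'(4), of i] xa x' a x by simp
    moreover have "is_iso \<B> x'" using x' xa by (intro is_isoI[of x' x]) simp_all
    ultimately have "x' \<in> slice p p \<and> x' \<cdot> i = i \<and> is_iso \<B> x'"
      using x' xa by (simp add: slice_Hom_iff)
    then show "\<exists>y. y \<in> slice p p \<and> y \<cdot> i = i \<and> is_iso \<B> y \<and> y \<cdot> x = ide (src p)"
      using x'(4) xa by auto
  qed
qed

end

text \<open>The addition \<open>b\<close> of the semidirect product \<open>S\<close> and the translation \<open>m\<close> of the extension by \<open>S\<close>
  are parameters, although they are determined: \<open>m\<close> is the Baer unit.\<close>

locale torsor = semi_abelian +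
  fixes C B \<xi> q j p i s b m
  assumes opext: "opext \<B> C B \<xi> q j"
    and p_def: "p = sd_proj \<B> C B \<xi>" and i_def: "i = sd_ker \<B> C B \<xi>" and s_def: "s = sd_section \<B> C B \<xi>"
    and b: "translation p i s p i b"
    and m: "translation p i s q j m" and free: "free_transitive p q m"
begin

lemmas Q = opextD[OF opext]
lemmas S = associatedD[OF semidirect_associated[OF Q(10)], folded p_def i_def s_def]

lemma pi1_carrier:
  "\<gamma> \<in> carrier (opext_pi1 \<B> C B \<xi>) \<longleftrightarrow> \<gamma> \<in> slice p p \<and> \<gamma> \<cdot> i = i \<and> is_iso \<B> \<gamma>"
  unfolding opext_pi1_def Let_def p_def[symmetric] i_def[symmetric] using S by (simp add: ext_Hom_over)

text \<open>Both sides agree on the kernel and on the section of \<open>S\<close>; on the latter by the right unit law. Hence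
  an endomorphism of \<open>S\<close> over \<open>C\<close> and under \<open>B\<close> is determined by the section \<open>\<gamma> \<cdot> s\<close>.\<close>

lemma pi1_translation:
  assumes "\<gamma> \<in> slice p p" "\<gamma> \<cdot> i = i" "x \<in> slice t p"
  shows "\<gamma> \<cdot> x = b \<cdot> pair p p (\<gamma> \<cdot> s \<cdot> t) x"
proof -
  note ga = slice_HomD[OF assms(1)] note xa = slice_HomD[OF assms(3)]
  let ?I = "ide (src p)"
  have e: "p \<cdot> \<gamma> \<cdot> s \<cdot> p = p" "p \<cdot> s \<cdot> p = p"
    using comp_reassoc[OF ga(4), of "s \<cdot> p"] comp_reassoc[OF S(14), of p] S ga by simp_all
  have I: "\<gamma> \<cdot> s \<cdot> p \<in> slice p p" "?I \<in> slice p p"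
    using S ga e by (simp_all add: slice_Hom_iff)
  note M = translate_slice[OF b I] note tc = translate_comp[OF b I]
  have "\<gamma> = b \<cdot> pair p p (\<gamma> \<cdot> s \<cdot> p) ?I"
  proof (rule split_joint_epi[OF S(1,2)])
    let ?z = "zero \<B> B C"
    have 1: "(\<gamma> \<cdot> s \<cdot> p) \<cdot> i = s \<cdot> ?z" "?I \<cdot> i = i"
      using S(3,4,6-15) ga by simp_all
    have "i \<in> slice ?z p" using S by (simp add: slice_Hom_iff)
    then show "\<gamma> \<cdot> i = (b \<cdot> pair p p (\<gamma> \<cdot> s \<cdot> p) ?I) \<cdot> i"
      unfolding tc[OF S(9,11)] 1 assms(2) using translate_unit[OF b] by simp
    have 2: "(\<gamma> \<cdot> s \<cdot> p) \<cdot> s = \<gamma> \<cdot> s" "?I \<cdot> s = s \<cdot> ide C"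
      using S(3,4,6-15) ga by simp_all
    have "\<gamma> \<cdot> s \<in> slice (ide C) p"
      using S(3,4,6-14) ga comp_reassoc[OF ga(4), of s] by (simp add: slice_Hom_iff)
    then show "\<gamma> \<cdot> s = (b \<cdot> pair p p (\<gamma> \<cdot> s \<cdot> p) ?I) \<cdot> s"
      unfolding tc[OF S(10,12)] 2 using translate_right_unit[OF b] by simp
  qed (use ga slice_HomD[OF M] in simp_all)
  then have "\<gamma> \<cdot> x = (b \<cdot> pair p p (\<gamma> \<cdot> s \<cdot> p) ?I) \<cdot> x" by simp
  also have "\<dots> = b \<cdot> pair p p (\<gamma> \<cdot> s \<cdot> t) x"
  proof -
    have "(\<gamma> \<cdot> s \<cdot> p) \<cdot> x = \<gamma> \<cdot> s \<cdot> t" "?I \<cdot> x = x" using S(3,8-13) ga(1-3) xa by simp_all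
    then show ?thesis unfolding tc[OF xa(1,3)] by simp
  qed
  finally show ?thesis .
qed

text \<open>The automorphism with \<open>\<gamma> \<cdot> s = \<tau>\<close> is the translation by \<open>\<tau>\<close>.\<close>

lemma pi1_of_section:
  assumes "\<tau> \<in> slice (ide C) p"
  obtains \<gamma> where "\<gamma> \<in> carrier (opext_pi1 \<B> C B \<xi>)" "\<gamma> \<cdot> s = \<tau>"
proof -
  note ta = slice_HomD[OF assms]
  have ta: "arr \<tau>" "src \<tau> = C" "tgt \<tau> = src p" "p \<cdot> \<tau> = ide C" using ta S by simp_all
  let ?I = "ide (src p)"
  have e: "p \<cdot> \<tau> \<cdot> p = p" using comp_reassoc[OF ta(4), of p] S ta by simp
  have I: "\<tau> \<cdot> p \<in> slice p p" "?I \<in> slice p p"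
    using S ta e by (simp_all add: slice_Hom_iff)
  define \<gamma> where "\<gamma> = b \<cdot> pair p p (\<tau> \<cdot> p) ?I"
  have g: "\<gamma> \<in> slice p p" unfolding \<gamma>_def by (rule translate_slice[OF b I])
  note ga = slice_HomD[OF g] note tc = translate_comp[OF b I, folded \<gamma>_def]
  have gi: "\<gamma> \<cdot> i = i"
  proof -
    let ?z = "zero \<B> B C"
    have 1: "(\<tau> \<cdot> p) \<cdot> i = s \<cdot> ?z" "?I \<cdot> i = i"
      using S(3,4,6-15) ta by simp_all
    have "i \<in> slice ?z p" using S by (simp add: slice_Hom_iff)
    then show ?thesis
      unfolding tc[OF S(9,11)] 1 using translate_unit[OF b] by simp
  qed
  have gs: "\<gamma> \<cdot> s = \<tau>"
  proof -
    have 2: "(\<tau> \<cdot> p) \<cdot> s = \<tau>" "?I \<cdot> s = s \<cdot> ide C"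
      using S(3,4,6-15) ta by simp_all
    then show ?thesis
      unfolding tc[OF S(10,12)] 2 using translate_right_unit[OF b assms] by simp
  qed
  have pt: "is_point \<B> p \<tau>" using ta S by (intro is_pointI) simp_all
  \<comment> \<open>\<open>\<gamma>\<close> is a morphism of points from \<open>(p, s)\<close> to \<open>(p, \<tau>)\<close> that is the identity on \<open>B\<close>\<close>
  have "is_iso \<B> \<gamma>"
    by (rule split_short_five[OF S(1) pt _ S(2,2) _ _ _ _ gs is_iso_ide[OF S(7)]])
      (use ga gi S(3,4,6-13) in simp_all)
  then show ?thesis using that pi1_carrier g gi gs by blast
qed

abbreviation translated where
  "translated \<gamma> y \<equiv> opext_translate \<B> C B \<xi> q j \<gamma> y"

lemma translated_eq:
  assumes "y \<in> slice f q"
  shows "translated \<gamma> y = m \<cdot> pair p q (\<gamma> \<cdot> s \<cdot> f) y"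
proof -
  have "baer_unit \<B> C B \<xi> q j = m"
    by (rule baer_unit_eq) (use m S Q in \<open>simp_all add: p_def i_def s_def\<close>)
  then show ?thesis
    unfolding opext_translate_def p_def[symmetric] s_def[symmetric] using slice_HomD(4)[OF assms] by simp
qed

context
  fixes f
  assumes f: "arr f" "tgt f = C"
begin

lemma section_over:
  assumes "\<gamma> \<in> slice p p"
  shows "\<gamma> \<cdot> s \<cdot> f \<in> slice f p"
  using slice_HomD[OF assms] S(3,8-14) f comp_reassoc[of p \<gamma> p "s \<cdot> f"] comp_reassoc[OF S(14), of f]
  by (simp add: slice_Hom_iff)

lemma translated_slice:
  assumes "\<gamma> \<in> slice p p" "y \<in> slice f q"
  shows "translated \<gamma> y \<in> slice f q"
  unfolding translated_eq[OF assms(2)] by (rule translate_slice[OF m section_over[OF assms(1)] assms(2)])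

lemma translated_kernel:
  assumes "\<gamma> \<in> slice p p" "y \<in> slice f q" "is_kernel \<B> k f"
  shows "translated \<gamma> y \<cdot> k = y \<cdot> k"
proof -
  note ga = slice_HomD[OF assms(1)] note ka = kernel_arr[OF assms(3)]
  have "translated \<gamma> y \<cdot> k = m \<cdot> pair p q ((\<gamma> \<cdot> s \<cdot> f) \<cdot> k) (y \<cdot> k)"
    unfolding translated_eq[OF assms(2)]
    by (rule translate_comp[OF m section_over[OF assms(1)] assms(2) ka(1,3)])
  also have "(\<gamma> \<cdot> s \<cdot> f) \<cdot> k = s \<cdot> f \<cdot> k"
    using S(3,8-13) f ka ga(1-3) by simp
  also have "m \<cdot> pair p q (s \<cdot> f \<cdot> k) (y \<cdot> k) = y \<cdot> k"
    by (rule translate_unit[OF m slice_comp[OF assms(2) Q(1) ka(1,3)]])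
  finally show ?thesis .
qed

lemma translated_ide:
  assumes "y \<in> slice f q"
  shows "translated (ide (src p)) y = y"
proof -
  have "ide (src p) \<cdot> s \<cdot> f = s \<cdot> f" using S(3,8-13) f by simp
  then show ?thesis unfolding translated_eq[OF assms] using translate_unit[OF m assms] by simp
qed

lemma translated_comp:
  assumes "\<gamma> \<in> slice p p" "\<gamma> \<cdot> i = i" "\<delta> \<in> slice p p" "y \<in> slice f q"
  shows "translated (\<gamma> \<cdot> \<delta>) y = translated \<gamma> (translated \<delta> y)"
proof -
  note ds = section_over[OF assms(3)] note gs = section_over[OF assms(1)]
  have "(\<gamma> \<cdot> \<delta>) \<cdot> s \<cdot> f = b \<cdot> pair p p (\<gamma> \<cdot> s \<cdot> f) (\<delta> \<cdot> s \<cdot> f)"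
    using pi1_translation[OF assms(1,2) ds] slice_HomD[OF assms(1)] slice_HomD[OF assms(3)] S(3,8-13) f
    by simp
  then show ?thesis
    unfolding translated_eq[OF translated_slice[OF assms(3,4)]] unfolding translated_eq[OF assms(4)]
    using translate_assoc[OF m b gs ds assms(4)] by simp
qed

text \<open>The difference \<open>\<sigma>\<close> of \<open>y\<close> and \<open>y'\<close> vanishes on the kernel of \<open>f\<close>, hence comes from a section.\<close>

lemma translated_simply_transitive:
  assumes "is_kernel \<B> k f" "is_cokernel \<B> f k" "y \<in> slice f q" "y' \<in> slice f q" "y \<cdot> k = y' \<cdot> k"
  shows "\<exists>!\<gamma>. \<gamma> \<in> carrier (opext_pi1 \<B> C B \<xi>) \<and> translated \<gamma> y = y'"
proof -
  note ka = kernel_arr[OF assms(1)]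
  obtain \<sigma> where \<sigma>: "\<sigma> \<in> slice f p" "m \<cdot> pair p q \<sigma> y = y'"
    using free assms unfolding free_transitive_def by metis
  note sa = slice_HomD[OF \<sigma>(1)]
  let ?z = "zero \<B> (src k) C"
  have yk: "y \<cdot> k \<in> slice ?z q"
    using slice_comp[OF assms(3) Q(1) ka(1,3)] ka(4) f by simp
  have sk: "\<sigma> \<cdot> k \<in> slice ?z p" "s \<cdot> ?z \<in> slice ?z p"
    using slice_comp[OF \<sigma>(1) S(8) ka(1,3)] ka f S by (simp_all add: slice_Hom_iff)
  have "m \<cdot> pair p q (\<sigma> \<cdot> k) (y \<cdot> k) = y \<cdot> k"
    using translate_comp[OF m \<sigma>(1) assms(3) ka(1,3)] unfolding \<sigma>(2) assms(5) by simp
  moreover have "m \<cdot> pair p q (s \<cdot> ?z) (y \<cdot> k) = y \<cdot> k" by (rule translate_unit[OF m yk])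
  ultimately have "\<sigma> \<cdot> k = s \<cdot> ?z"
    using translate_cancel[OF free yk sk] yk by simp
  then have "\<sigma> \<cdot> k = zero \<B> (src k) (tgt \<sigma>)" using S(8-13) ka sa by simp
  from cokernel_factor[OF assms(2) sa(1,2) this]
  obtain \<tau> where \<tau>: "arr \<tau>" "src \<tau> = tgt f" "tgt \<tau> = tgt \<sigma>" "\<tau> \<cdot> f = \<sigma>" .
  have fe: "is_regular_epi \<B> f" by (rule cokernel_regular_epi[OF assms(2)])
  have "p \<cdot> \<tau> = ide C"
    by (rule regular_epi_epi[OF fe]) (use \<tau> sa S(3,6,8) f in simp_all)
  then have "\<tau> \<in> slice (ide C) p" using \<tau> sa f S(6) by (simp add: slice_Hom_iff)
  then obtain \<gamma> where \<gamma>: "\<gamma> \<in> carrier (opext_pi1 \<B> C B \<xi>)" "\<gamma> \<cdot> s = \<tau>" by (rule pi1_of_section)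
  have g: "\<gamma> \<in> slice p p" using \<gamma>(1) unfolding pi1_carrier by blast
  have "\<gamma> \<cdot> s \<cdot> f = \<sigma>"
    using comp_reassoc[OF \<gamma>(2), of f] \<tau>(4) slice_HomD[OF g] S(8-13) f by simp
  then have "translated \<gamma> y = y'" unfolding translated_eq[OF assms(3)] using \<sigma>(2) by simp
  moreover have "\<delta> = \<gamma>" if d: "\<delta> \<in> carrier (opext_pi1 \<B> C B \<xi>)" "translated \<delta> y = y'" for \<delta>
  proof -
    have ds: "\<delta> \<in> slice p p" "\<delta> \<cdot> i = i" and gs: "\<gamma> \<cdot> i = i" using d(1) \<gamma>(1) unfolding pi1_carrier by auto
    note da = slice_HomD[OF ds(1)] note ga = slice_HomD[OF g]
    have "\<delta> \<cdot> s \<cdot> f = \<sigma>"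
      by (rule translate_cancel[OF free assms(3) section_over[OF ds(1)] \<sigma>(1)])
        (use d(2) \<sigma>(2) assms(4) in \<open>simp_all add: translated_eq[OF assms(3)]\<close>)
    then have "\<delta> \<cdot> s = \<gamma> \<cdot> s"
      using \<open>\<gamma> \<cdot> s \<cdot> f = \<sigma>\<close> by (intro regular_epi_epi[OF fe, of "\<delta> \<cdot> s"]) (use da ga S(8-13) f in simp_all)
    then show ?thesis
      by (intro split_joint_epi[OF S(1,2), of \<delta> \<gamma>]) (use da ga ds(2) gs in simp_all)
  qed
  ultimately show ?thesis using \<gamma>(1) by blast
qed

end

end

lemma group_actionI:
  assumes "group G" "\<And>g x. g \<in> carrier G \<Longrightarrow> x \<in> E \<Longrightarrow> act g x \<in> E"
    "\<And>x. x \<in> E \<Longrightarrow> act \<one>\<^bsub>G\<^esub> x = x"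
    "\<And>g h x. g \<in> carrier G \<Longrightarrow> h \<in> carrier G \<Longrightarrow> x \<in> E \<Longrightarrow> act (g \<otimes>\<^bsub>G\<^esub> h) x = act g (act h x)"
    "\<And>g. g \<in> carrier G \<Longrightarrow> act g \<in> extensional E"
  shows "group_action G E act"
proof -
  interpret G: group G by fact
  have bij: "act g \<in> Bij E" if g: "g \<in> carrier G" for g
  proof -
    have 1: "act (inv\<^bsub>G\<^esub> g) (act g x) = x" "act g (act (inv\<^bsub>G\<^esub> g) x) = x" if "x \<in> E" for x
      using assms(3)[OF that] assms(4)[of "inv\<^bsub>G\<^esub> g" g x] assms(4)[of g "inv\<^bsub>G\<^esub> g" x] g that by simp_all
    have "bij_betw (act g) E E"
      by (rule bij_betw_byWitness[where f' = "act (inv\<^bsub>G\<^esub> g)"]) (use 1 assms(2) g in auto)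
    then show ?thesis using assms(5)[OF g] by (simp add: Bij_def)
  qed
  have "act \<in> hom G (BijGroup E)"
  proof (rule homI)
    show "act g \<in> carrier (BijGroup E)" if "g \<in> carrier G" for g using bij[OF that] by (simp add: BijGroup_def)
    fix g h assume gh: "g \<in> carrier G" "h \<in> carrier G"
    have "act (g \<otimes>\<^bsub>G\<^esub> h) = compose E (act g) (act h)"
    proof (rule extensionalityI[of _ E])
      show "act (g \<otimes>\<^bsub>G\<^esub> h) \<in> extensional E" using assms(5) gh by simp
      show "compose E (act g) (act h) \<in> extensional E" by simp
    qed (use assms(4) gh in \<open>simp add: compose_eq\<close>)
    then show "act (g \<otimes>\<^bsub>G\<^esub> h) = act g \<otimes>\<^bsub>BijGroup E\<^esub> act h"
      using bij gh by (simp add: BijGroup_def)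
  qed
  then show ?thesis
    unfolding group_action_def group_hom_def group_hom_axioms_def
    using assms(1) group_BijGroup by blast
qed

context semi_abelian
begin

text \<open>This is the universal property of the pullback \<open>\<phi>\<^sub>0\<^sup>*E'\<close>, applied to arrows with a prescribed
  restriction to the kernels.\<close>

lemma ext_Hom_pullback:
  assumes "opext \<B> C' B' \<xi>' f' k'" and \<phi>: "\<phi>\<^sub>0 \<in> Hom \<B> C C'" "\<phi>\<^sub>1 \<in> Hom \<B> B B'"
    and f: "is_kernel \<B> k f" "tgt f = C" "src k = B"
  defines "M \<equiv> ext_Hom \<B> f k f' k' \<phi>\<^sub>0 \<phi>\<^sub>1"
    and "N \<equiv> ext_Hom \<B> f k (pb2 \<B> f' \<phi>\<^sub>0) (pull_ext_ker \<B> \<phi>\<^sub>0 f' k') (ide C) \<phi>\<^sub>1"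
  shows "e \<in> M \<Longrightarrow> pair f' \<phi>\<^sub>0 e f \<in> N" "e \<in> M \<Longrightarrow> pb1 \<B> f' \<phi>\<^sub>0 \<cdot> pair f' \<phi>\<^sub>0 e f = e"
    "y \<in> N \<Longrightarrow> pb1 \<B> f' \<phi>\<^sub>0 \<cdot> y \<in> M" "y \<in> N \<Longrightarrow> pair f' \<phi>\<^sub>0 (pb1 \<B> f' \<phi>\<^sub>0 \<cdot> y) f = y"
proof -
  note o = opextD[OF assms(1)] note ka = kernel_arr[OF f(1)]
  have \<phi>: "arr \<phi>\<^sub>0" "src \<phi>\<^sub>0 = C" "tgt \<phi>\<^sub>0 = C'" "arr \<phi>\<^sub>1" "src \<phi>\<^sub>1 = B" "tgt \<phi>\<^sub>1 = B'" "C \<in> Obj \<B>" "B \<in> Obj \<B>"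
    using \<phi> by (auto simp: Hom_def)
  have fg: "arr f'" "arr \<phi>\<^sub>0" "tgt f' = tgt \<phi>\<^sub>0" using o \<phi> by simp_all
  define p q j where "p = pb1 \<B> f' \<phi>\<^sub>0" and "q = pb2 \<B> f' \<phi>\<^sub>0" and "j = pull_ext_ker \<B> \<phi>\<^sub>0 f' k'"
  note D = p_def[symmetric] q_def[symmetric] j_def[symmetric]
  have pb: "is_pullback \<B> f' \<phi>\<^sub>0 p q" unfolding p_def q_def using fg by (rule pb_pullback)
  note pa = pullback_arr[OF pb]
  have j: "j = pair f' \<phi>\<^sub>0 k' (zero \<B> B' C)" unfolding j_def pull_ext_ker_def using o \<phi> by simp
  have ja: "arr j" "src j = B'" "tgt j = src p" "p \<cdot> j = k'" "q \<cdot> j = zero \<B> B' C"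
    unfolding j p_def q_def using o \<phi> fg by simp_all
  have M: "e \<in> M \<longleftrightarrow> e \<in> slice (\<phi>\<^sub>0 \<cdot> f) f' \<and> e \<cdot> k = k' \<cdot> \<phi>\<^sub>1" for e
    unfolding M_def ext_Hom_def slice_Hom_def using ka f \<phi> by auto
  have N: "y \<in> N \<longleftrightarrow> y \<in> slice f q \<and> y \<cdot> k = j \<cdot> \<phi>\<^sub>1" for y
    unfolding N_def D by (rule ext_Hom_over[OF ka(2) f(2)])
  have C: "tgt f = src \<phi>\<^sub>0" using f \<phi> by simp
  note cb = slice_change_of_base[OF pb ka(2) C]
  have pj: "p \<cdot> j \<cdot> \<phi>\<^sub>1 = k' \<cdot> \<phi>\<^sub>1" using comp_reassoc[OF ja(4), of \<phi>\<^sub>1] ja pa \<phi> by simp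
  have qj: "q \<cdot> j \<cdot> \<phi>\<^sub>1 = zero \<B> B C" using comp_reassoc[OF ja(5), of \<phi>\<^sub>1] ja pa \<phi> by simp
  \<comment> \<open>composition with \<open>k\<close> is compared after the projection \<open>p\<close>, as \<open>q\<close> sends both sides to \<open>0\<close>\<close>
  have key: "p \<cdot> y \<in> M \<longleftrightarrow> y \<in> N" if y: "y \<in> slice f q" for y
  proof -
    note ya = slice_HomD[OF y]
    have "y \<cdot> k = j \<cdot> \<phi>\<^sub>1" if "p \<cdot> y \<cdot> k = k' \<cdot> \<phi>\<^sub>1"
    proof (rule pullback_ext[OF pb])
      show "p \<cdot> y \<cdot> k = p \<cdot> j \<cdot> \<phi>\<^sub>1" using that pj by simp
      show "q \<cdot> y \<cdot> k = q \<cdot> j \<cdot> \<phi>\<^sub>1" using comp_reassoc[OF ya(4), of k] ya ka pa f qj by simp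
    qed (use ya ka pa ja \<phi> f in simp_all)
    moreover have "(p \<cdot> y) \<cdot> k = p \<cdot> y \<cdot> k" using ya ka pa by simp
    ultimately show ?thesis using M N cb(1)[OF y] y pj by auto
  qed
  have pair: "pair f' \<phi>\<^sub>0 e f \<in> slice f q" "p \<cdot> pair f' \<phi>\<^sub>0 e f = e" if "e \<in> M" for e
  proof -
    have "e \<in> slice (\<phi>\<^sub>0 \<cdot> f) f'" using that M by blast
    note ea = slice_HomD[OF this]
    show "pair f' \<phi>\<^sub>0 e f \<in> slice f q" "p \<cdot> pair f' \<phi>\<^sub>0 e f = e"
      unfolding p_def q_def using ea fg ka C by (simp_all add: slice_Hom_iff)
  qed
  show "pb1 \<B> f' \<phi>\<^sub>0 \<cdot> pair f' \<phi>\<^sub>0 e f = e" if "e \<in> M" using pair(2)[OF that] unfolding D .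
  show "pair f' \<phi>\<^sub>0 e f \<in> N" if "e \<in> M" using key[OF pair(1)[OF that]] pair(2)[OF that] that by simp
  show "pb1 \<B> f' \<phi>\<^sub>0 \<cdot> y \<in> M" if "y \<in> N" using key[of y] that N unfolding D by blast
  show "pair f' \<phi>\<^sub>0 (pb1 \<B> f' \<phi>\<^sub>0 \<cdot> y) f = y" if "y \<in> N"
  proof -
    have "y \<in> slice f q" using that N by blast
    note ya = slice_HomD[OF this]
    show ?thesis using pbpair_eta[OF fg, of y] ya unfolding q_def using fg by simp
  qed
qed

lemma ext_Hom_simply_transitive:
  assumes "opext \<B> C B \<xi> f k" "opext \<B> C' B' \<xi>' f' k'" "\<phi>\<^sub>0 \<in> Hom \<B> C C'" "\<phi>\<^sub>1 \<in> Hom \<B> B B'"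
  shows "simply_transitive (opext_pi1 \<B> C B' (pull_action \<B> \<phi>\<^sub>0 B' \<xi>')) (ext_Hom \<B> f k f' k' \<phi>\<^sub>0 \<phi>\<^sub>1)
    (opext_pi1_action \<B> f k f' k' \<xi>' \<phi>\<^sub>0 \<phi>\<^sub>1)"
proof -
  note F = opextD[OF assms(1)]
  define \<zeta> q j where "\<zeta> = pull_action \<B> \<phi>\<^sub>0 B' \<xi>'" and "q = pb2 \<B> f' \<phi>\<^sub>0" and "j = pull_ext_ker \<B> \<phi>\<^sub>0 f' k'"
  note D = \<zeta>_def[symmetric] q_def[symmetric] j_def[symmetric]
  have Q: "opext \<B> C B' \<zeta> q j" unfolding \<zeta>_def q_def j_def by (rule opext_pullback[OF assms(2,3)])
  define P I S where "P = sd_proj \<B> C B' \<zeta>" and "I = sd_ker \<B> C B' \<zeta>" and "S = sd_section \<B> C B' \<zeta>"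
  obtain m where m: "translation P I S q j m" "free_transitive P q m"
    by (rule opext_translation[OF Q P_def I_def S_def])
  obtain b where b: "translation P I S P I b"
    using semidirect_translation[OF opextD(10)[OF Q] P_def I_def S_def] by blast
  interpret T: torsor \<B> C B' \<zeta> q j P I S b m
    by unfold_locales (use Q m b in \<open>simp_all add: P_def I_def S_def\<close>)
  define M N where "M = ext_Hom \<B> f k f' k' \<phi>\<^sub>0 \<phi>\<^sub>1" and "N = ext_Hom \<B> f k q j (ide C) \<phi>\<^sub>1"
  define act where "act = opext_pi1_action \<B> f k f' k' \<xi>' \<phi>\<^sub>0 \<phi>\<^sub>1"
  let ?\<Gamma> = "opext_pi1 \<B> C B' \<zeta>"
  let ?t = "\<lambda>e. pair f' \<phi>\<^sub>0 e f" and ?p = "pb1 \<B> f' \<phi>\<^sub>0"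
  note iso = ext_Hom_pullback[OF assms(2,3,4) F(7,5,4), folded q_def j_def, folded M_def N_def]
  have N: "y \<in> N \<longleftrightarrow> y \<in> slice f q \<and> y \<cdot> k = j \<cdot> \<phi>\<^sub>1" for y
    unfolding N_def by (rule ext_Hom_over[OF F(1,5)])
  have act: "act \<gamma> e = ?p \<cdot> T.translated \<gamma> (?t e)" if "e \<in> M" for \<gamma> e
  proof -
    have "src \<phi>\<^sub>0 = C" "src k' = B'" using assms(3) opextD(4)[OF assms(2)] by (simp_all add: Hom_def)
    then show ?thesis
      using that unfolding act_def opext_pi1_action_def M_def by (simp add: D)
  qed
  have ext: "act \<gamma> \<in> extensional M" for \<gamma>
    unfolding act_def opext_pi1_action_def M_def by simp
  have tN: "T.translated \<gamma> y \<in> N" if "\<gamma> \<in> carrier ?\<Gamma>" "y \<in> N" for \<gamma> y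
    using that T.translated_slice[OF F(1,5)] T.translated_kernel[OF F(1,5) _ _ F(7)] N T.pi1_carrier by auto
  have actM: "act \<gamma> e \<in> M" "?t (act \<gamma> e) = T.translated \<gamma> (?t e)" if "\<gamma> \<in> carrier ?\<Gamma>" "e \<in> M" for \<gamma> e
    using iso(3,4)[OF tN[OF that(1) iso(1)[OF that(2)]]] act[OF that(2)] by simp_all
  have one: "\<one>\<^bsub>?\<Gamma>\<^esub> = ide (src P)" by (simp add: opext_pi1_def Let_def P_def)
  have mult: "\<gamma> \<otimes>\<^bsub>?\<Gamma>\<^esub> \<delta> = \<gamma> \<cdot> \<delta>" for \<gamma> \<delta> by (simp add: opext_pi1_def Let_def)
  have "group_action ?\<Gamma> M act"
  proof (rule group_actionI)
    show "group ?\<Gamma>" by (rule opext_pi1_group[OF opextD(10)[OF Q]])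
    show "act \<one>\<^bsub>?\<Gamma>\<^esub> e = e" if "e \<in> M" for e
      unfolding act[OF that] one
      using T.translated_ide[OF F(1,5)] iso(1,2)[OF that] N by simp
    fix \<gamma> \<delta> e assume g: "\<gamma> \<in> carrier ?\<Gamma>" "\<delta> \<in> carrier ?\<Gamma>" and e: "e \<in> M"
    have "T.translated (\<gamma> \<cdot> \<delta>) (?t e) = T.translated \<gamma> (T.translated \<delta> (?t e))"
      by (rule T.translated_comp[OF F(1,5)]) (use g iso(1)[OF e] N T.pi1_carrier in auto)
    then show "act (\<gamma> \<otimes>\<^bsub>?\<Gamma>\<^esub> \<delta>) e = act \<gamma> (act \<delta> e)"
      unfolding mult act[OF e, of "\<gamma> \<cdot> \<delta>"] act[OF actM(1)[OF g(2) e]] actM(2)[OF g(2) e] by simp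
  qed (use actM ext in auto)
  moreover have "\<exists>!\<gamma>. \<gamma> \<in> carrier ?\<Gamma> \<and> act \<gamma> e = e'" if e: "e \<in> M" "e' \<in> M" for e e'
  proof -
    have "act \<gamma> e = e' \<longleftrightarrow> T.translated \<gamma> (?t e) = ?t e'" if "\<gamma> \<in> carrier ?\<Gamma>" for \<gamma>
      using actM[OF that e(1)] iso(2)[OF e(2)] iso(2)[OF actM(1)[OF that e(1)]] by metis
    moreover have "\<exists>!\<gamma>. \<gamma> \<in> carrier ?\<Gamma> \<and> T.translated \<gamma> (?t e) = ?t e'"
      by (rule T.translated_simply_transitive[OF F(1,5,7,8)])
        (use iso(1)[OF e(1)] iso(1)[OF e(2)] N in auto)
    ultimately show ?thesis by blast
  qed
  ultimately show ?thesis
    unfolding simply_transitive_def D M_def[symmetric] act_def[symmetric] by blast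
qed

end

theorem theorem4p4:
  fixes \<B> :: "('o, 'a) cat"
    and C B C' B' :: 'o
    and f k f' k' \<xi> \<xi>' \<phi>\<^sub>0 \<phi>\<^sub>1 :: 'a
  assumes "semi_abelian \<B>"
    and "abelian_extension \<B> C B f k" and "induces \<B> f k \<xi>"
    and "abelian_extension \<B> C' B' f' k'" and "induces \<B> f' k' \<xi>'"
    and "abelian_action_morphism \<B> C B \<xi> C' B' \<xi>' \<phi>\<^sub>0 \<phi>\<^sub>1"
  shows
    "let M = ext_Hom \<B> f k f' k' \<phi>\<^sub>0 \<phi>\<^sub>1;
         \<zeta> = pull_action \<B> \<phi>\<^sub>0 B' \<xi>';
         q = pb2 \<B> f' \<phi>\<^sub>0; j = pull_ext_ker \<B> \<phi>\<^sub>0 f' k'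
     in (M \<noteq> {} \<longleftrightarrow>
          (\<exists>g l. is_push_forward \<B> C f k B' \<zeta> \<phi>\<^sub>1 g l \<and> opext_isomorphic \<B> C B' \<zeta> q j g l)) \<and>
        (\<forall>g l. is_push_forward \<B> C f k B' \<zeta> \<phi>\<^sub>1 g l \<longrightarrow>
          (M \<noteq> {} \<longleftrightarrow> opext_isomorphic \<B> C B' \<zeta> q j g l)) \<and>
        (M \<noteq> {} \<longrightarrow>
          simply_transitive (opext_pi1 \<B> C B' \<zeta>) M (opext_pi1_action \<B> f k f' k' \<xi>' \<phi>\<^sub>0 \<phi>\<^sub>1))"
proof -
  interpret semi_abelian \<B> by fact
  have E: "opext \<B> C B \<xi> f k" and E': "opext \<B> C' B' \<xi>' f' k'"
    using assms(2-5) unfolding opext_def by auto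
  note F = opextD[OF E] note F' = opextD[OF E'] note x' = abelian_actionD[OF F'(10)]
  have \<phi>: "\<phi>\<^sub>0 \<in> Hom \<B> C C'" "\<phi>\<^sub>1 \<in> Hom \<B> B B'" and eq: "Comp \<B> \<phi>\<^sub>1 \<xi> = Comp \<B> \<xi>' (flat_map \<B> \<phi>\<^sub>0 \<phi>\<^sub>1)"
    using assms(6) unfolding abelian_action_morphism_def by auto
  have \<phi>0: "\<phi>\<^sub>0 \<in> Arr \<B>" "Dom \<B> \<phi>\<^sub>0 = C" "Cod \<B> \<phi>\<^sub>0 = C'"
    and \<phi>1: "\<phi>\<^sub>1 \<in> Arr \<B>" "Dom \<B> \<phi>\<^sub>1 = B" "Cod \<B> \<phi>\<^sub>1 = B'"
    using \<phi> by (auto simp: Hom_def)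
  define M \<zeta> q j where "M = ext_Hom \<B> f k f' k' \<phi>\<^sub>0 \<phi>\<^sub>1" and "\<zeta> = pull_action \<B> \<phi>\<^sub>0 B' \<xi>'"
    and "q = pb2 \<B> f' \<phi>\<^sub>0" and "j = pull_ext_ker \<B> \<phi>\<^sub>0 f' k'"
  note D = M_def[symmetric] \<zeta>_def[symmetric] q_def[symmetric] j_def[symmetric]
  have Q: "opext \<B> C B' \<zeta> q j" unfolding \<zeta>_def q_def j_def by (rule opext_pullback[OF E' \<phi>(1)])
  have eq\<zeta>: "Comp \<B> \<phi>\<^sub>1 \<xi> = Comp \<B> \<zeta> (flat_map \<B> (Ide \<B> C) \<phi>\<^sub>1)"
    unfolding eq \<zeta>_def pull_action_def using \<phi>0 \<phi>1 x' F by (simp add: flat_map_comp)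
  note iso = ext_Hom_pullback[OF E' \<phi> F(7,5,4), unfolded D]
  have MN: "M \<noteq> {} \<longleftrightarrow> ext_Hom \<B> f k q j (Ide \<B> C) \<phi>\<^sub>1 \<noteq> {}" using iso(1,3) by blast
  have ne: "M \<noteq> {}" if h: "is_push_forward \<B> C f k B' \<zeta> \<phi>\<^sub>1 g l" "opext_isomorphic \<B> C B' \<zeta> q j g l" for g l
  proof -
    obtain u where "u \<in> ext_Hom \<B> f k g l (Ide \<B> C) \<phi>\<^sub>1"
      using h(1) unfolding is_push_forward_def opcartesian_lifting_def by blast
    then show ?thesis
      unfolding MN using isomorphic_extension_ext_Hom[OF h(2) F(1,5,2,3) \<phi>1(1,3)] by blast
  qed
  have push: "opext_isomorphic \<B> C B' \<zeta> q j g l" if h: "M \<noteq> {}" "is_push_forward \<B> C f k B' \<zeta> \<phi>\<^sub>1 g l" for g l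
  proof -
    obtain u where "opext \<B> C B' \<zeta> g l" "u \<in> ext_Hom \<B> f k g l (Ide \<B> C) \<phi>\<^sub>1"
      using h(2) unfolding is_push_forward_def opcartesian_lifting_def by blast
    moreover obtain u' where "u' \<in> ext_Hom \<B> f k q j (Ide \<B> C) \<phi>\<^sub>1" using h(1) MN by blast
    ultimately show ?thesis using opcartesian_codomains_isomorphic[OF E _ Q \<phi>1 eq\<zeta>] by blast
  qed
  have self: "is_push_forward \<B> C f k B' \<zeta> \<phi>\<^sub>1 q j" if "M \<noteq> {}"
    using that opcartesian_liftingI[OF E Q \<phi>1 eq\<zeta>] unfolding MN is_push_forward_def by blast
  have "simply_transitive (opext_pi1 \<B> C B' \<zeta>) M (opext_pi1_action \<B> f k f' k' \<xi>' \<phi>\<^sub>0 \<phi>\<^sub>1)"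
    using ext_Hom_simply_transitive[OF E E' \<phi>] unfolding D .
  then show ?thesis
    unfolding Let_def D using ne push self by blast
qed

end
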